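(* Let $f=\sum_\gamma c_\gamma\mathcal{L}_\gamma$ be a formal power series in $x_1,x_2,\dots$, where the (possibly infinite) sum is over weak compositions $\gamma$ and $c_\gamma\in\mathbb{Z}[\beta]$. Then: (1) $f$ is quasisymmetric if and only if $c_\gamma=c_\delta$ for all weak compositions $\gamma,\delta$ with $\gamma^+=\delta^+$; (2) $f$ is symmetric if and only if $c_\gamma=c_\delta$ for all weak compositions $\gamma,\delta$ with $\lambda(\gamma)=\lambda(\delta)$. Furthermore, if $f$ is quasisymmetric (resp. symmetric), then $f$ is $\mathcal{G}_\alpha$-positive (resp. $G_\lambda$-positive) if and only if $f$ is $\mathcal{L}_\gamma$-positive.
   Context: $\beta$ is an indeterminate; power series have coefficients in $\mathbb{Z}[\beta]$ and infinite sums are understood coefficientwise. A weak composition (resp. composition) is a finite sequence of nonnegative (resp. positive) integers; weak compositions differing only by trailing zeros are identified, and likewise for partitions. $|\gamma|=\sum_i\gamma_i$. A partition is a weak composition with weakly decreasing parts; $\lambda(\gamma)$ is the unique partition with the same parts as $\gamma$, and $\gamma^+$ is the composition obtained from $\gamma$ by dropping its zero parts. A formal power series $f$ is quasisymmetric if for all positive integers $\alpha_1,\dots,\alpha_k$ and all $i_1<\dots<i_k$, the coefficient of $x_{i_1}^{\alpha_1}\cdots x_{i_k}^{\alpha_k}$ in $f$ equals that of $x_1^{\alpha_1}\cdots x_k^{\alpha_k}$. It is symmetric if it is invariant under all finite permutations of the variables. $f$ is $\mathcal{L}_\gamma$-positive (resp. $\mathcal{G}_\alpha$-positive, $G_\lambda$-positive)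 if the coefficients in its expansion as a (possibly infinite) linear combination of the $\mathcal{L}_\gamma$ (over weak compositions $\gamma$), resp. the $\mathcal{G}_\alpha$ (over compositions $\alpha$), resp. the $G_\lambda$ (over partitions $\lambda$), are all nonnegative, i.e. in $\mathbb{Z}_{\ge0}[\beta]$. Skyline diagrams. The skyline diagram of $\gamma=(\gamma_1,\dots,\gamma_n)$ has left-justified rows numbered $1,\dots,n$ from top to bottom, with boxes $(i,j)$, $1\le j\le\gamma_i$, in row $i$, plus a basement box $(i,0)$ in each row containing the fixed value $b_i=i$. A set-valued filling assigns a nonempty finite set of positive integers to each non-basement box. The maximum of a box is its anchor entry; the other entries of the box are free entries. A basement box is treated as a box with the single (anchor) entry $i$. Triples, for rows $i<j$ and a column $k\ge0$. Type A (when $\gamma_i\ge\gamma_j$): the boxes $(i,k),(i,k+1),(j,k+1)$, with anchor entries $c,a,b$ respectively. Type B (when $\gamma_i<\gamma_j$): the boxes $(i,k),(j,k),(j,k+1)$, with anchor entries $b,c,a$ respectively. (All three boxes must exist; basement boxes are allowed.) A triple is an inversion triple if $b>c\ge a$ or $c\ge a>b$. A set-valued filling is semistandard if: (S1) entries do not repeat in a column; (S2) rows, including the basement, are weakly decreasing from left to right, where for sets $A\ge B$ means $\min A\ge\max B$; (S3) every triple of anchor entries (including basement boxes) is an inversion triple; (S4) every free entry is in the highest (lowest-numbered) row possible within its column: a free entry $x$ in column $j$ lies in the smallest-numbered row $i$ such that the box $(i,j)$ exists, $x$ is smaller than the anchor entry of $(i,j)$ (so $x$ is free there), and placing $x$ there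 does not violate (S2), i.e. $x$ is at least the anchor entry of $(i,j+1)$ if that box exists. $\mathsf{SetSkyFill}(\gamma)$ is the set of semistandard set-valued fillings of shape $\gamma$ with basement $b_i=i$. For such $F$, $|F|$ is the total number of entries (not counting the basement) and $x^F=\prod_i x_i^{m_i}$, where $m_i$ is the number of occurrences of $i$ in $F$ outside the basement. The combinatorial Lascoux atom is $$\mathcal{L}_\gamma=\sum_{F\in\mathsf{SetSkyFill}(\gamma)}\beta^{|F|-|\gamma|}x^F\in\mathbb{Z}[\beta][x_1,\dots,x_n].$$ For a composition $\alpha$, the quasisymmetric Grothendieck function is $\mathcal{G}_\alpha=\sum_{\gamma:\ \gamma^+=\alpha}\mathcal{L}_\gamma$, the sum over all weak compositions $\gamma$ with $\gamma^+=\alpha$. A set-valued reverse tableau of shape $\lambda$ is a filling of the Young diagram of $\lambda$ (English notation) by nonempty finite sets of positive integers such that rows are weakly decreasing from left to right ($\min A\ge\max B$ for $B$ immediately right of $A$) and columns are strictly decreasing from top to bottom ($\min A>\max B$ for $B$ immediately below $A$). $\mathsf{SetRT}(\lambda)$ is the set of these. For $T\in\mathsf{SetRT}(\lambda)$, $|T|$ is the total number of entries, $x^T=\prod_i x_i^{\#\{i\text{'s in }T\}}$, and $G_\lambda=\sum_{T\in\mathsf{SetRT}(\lambda)}\beta^{|T|-|\lambda|}x^T$. *)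

theory Defs
  imports
    "HOL-Library.Multiset"
    "HOL-Computational_Algebra.Polynomial"
    "HOL-Combinatorics.Permutations"
begin

text \<open>
  \<open>\<int>[\<beta>]\<close> is \<^typ>\<open>int poly\<close>, with \<open>\<beta>\<close> the polynomial variable. A monomial in
  \<open>x\<^sub>1, x\<^sub>2, \<dots>\<close> is the multiset of its variable indices, so that the exponent of \<open>x\<^sub>i\<close> is
  \<^term>\<open>count m i\<close>; a power series is its coefficient function. The index 0 is not
  a variable: none of the series below has a monomial containing it.
\<close>

type_synonym series = "nat multiset \<Rightarrow> int poly"

text \<open>
  Coefficientwise sum of \<open>c\<^sub>i B\<^sub>i\<close> over \<open>i \<in> I\<close>, where \<open>I\<close> may be infinite as long as, for each
  monomial, only finitely many terms contribute. This is automatic for the three families used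
  here: the objects indexed by \<open>\<gamma>\<close> only contain monomials of degree at least \<open>|\<gamma>|\<close>, and every
  monomial of the Lascoux atom of \<open>\<gamma>\<close> contains \<open>x\<^sub>i\<close> whenever \<open>\<gamma>\<^sub>i > 0\<close>, because the anchor of
  the box \<open>(i, 1)\<close> is forced to be \<open>i\<close>.
\<close>

definition lin_comb :: "'i set \<Rightarrow> ('i \<Rightarrow> int poly) \<Rightarrow> ('i \<Rightarrow> series) \<Rightarrow> series" where
  "lin_comb I c B = (\<lambda>m. \<Sum>i | i \<in> I \<and> c i * B i m \<noteq> 0. c i * B i m)"

definition nonneg_coeffs :: "int poly \<Rightarrow> bool" where
  "nonneg_coeffs p \<longleftrightarrow> (\<forall>k. coeff p k \<ge> 0)"

definition positive_in :: "'i set \<Rightarrow> ('i \<Rightarrow> series) \<Rightarrow> series \<Rightarrow> bool" where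
  "positive_in I B f \<longleftrightarrow> (\<exists>c. f = lin_comb I c B \<and> (\<forall>i\<in>I. nonneg_coeffs (c i)))"

definition monomial :: "nat list \<Rightarrow> nat list \<Rightarrow> nat multiset" where
  "monomial idx \<alpha> = (\<Sum>j<length \<alpha>. replicate_mset (\<alpha> ! j) (idx ! j))"

definition quasisymmetric :: "series \<Rightarrow> bool" where
  "quasisymmetric f \<longleftrightarrow>
    (\<forall>\<alpha> idx. (\<forall>a\<in>set \<alpha>. 0 < a) \<and> length idx = length \<alpha> \<and> (\<forall>i\<in>set idx. 0 < i) \<and>
      sorted_wrt (<) idx \<longrightarrow> f (monomial idx \<alpha>) = f (monomial [1..<length \<alpha> + 1] \<alpha>))"

definition symmetric :: "series \<Rightarrow> bool" where
  "symmetric f \<longleftrightarrow>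
    (\<forall>S \<pi>. finite S \<and> S \<subseteq> {1..} \<and> \<pi> permutes S \<longrightarrow> (\<forall>m. f (image_mset \<pi> m) = f m))"

text \<open>
  Weak compositions and partitions are taken modulo trailing zeros; each class is represented by
  its unique list without trailing zeros.
\<close>

definition weak_compositions :: "nat list set" where
  "weak_compositions = {\<gamma>. \<gamma> \<noteq> [] \<longrightarrow> last \<gamma> \<noteq> 0}"

definition compositions :: "nat list set" where
  "compositions = {\<alpha>. \<forall>a\<in>set \<alpha>. 0 < a}"

definition partitions :: "nat list set" where
  "partitions = {\<mu> \<in> weak_compositions. sorted_wrt (\<ge>) \<mu>}"

definition flatten :: "nat list \<Rightarrow> nat list" where
  "flatten \<gamma> = filter (\<lambda>a. 0 < a) \<gamma>"

definition sort_parts :: "nat list \<Rightarrow> nat list" where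
  "sort_parts \<gamma> = rev (sort (flatten \<gamma>))"

text \<open>Rows are numbered from 1, as are the non-basement columns; column 0 is the basement.\<close>

definition part :: "nat list \<Rightarrow> nat \<Rightarrow> nat" where
  "part \<gamma> i = \<gamma> ! (i - 1)"

definition diagram :: "nat list \<Rightarrow> (nat \<times> nat) set" where
  "diagram \<gamma> = {(i, j). 1 \<le> i \<and> i \<le> length \<gamma> \<and> 1 \<le> j \<and> j \<le> part \<gamma> i}"

definition basement :: "nat list \<Rightarrow> (nat \<times> nat) set" where
  "basement \<gamma> = {(i, 0) | i. 1 \<le> i \<and> i \<le> length \<gamma>}"

type_synonym filling = "nat \<times> nat \<Rightarrow> nat set"

definition is_entry_set :: "nat set \<Rightarrow> bool" where
  "is_entry_set A \<longleftrightarrow> finite A \<and> A \<noteq> {} \<and> A \<subseteq> {1..}"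

text \<open>Both functions count only boxes in \<open>D\<close>, which is used without the basement.\<close>

definition weight :: "(nat \<times> nat) set \<Rightarrow> filling \<Rightarrow> nat multiset" where
  "weight D F = (\<Sum>b\<in>D. mset_set (F b))"

definition num_entries :: "(nat \<times> nat) set \<Rightarrow> filling \<Rightarrow> nat" where
  "num_entries D F = (\<Sum>b\<in>D. card (F b))"

text \<open>
  The series \<open>\<Sum>F\<in>\<F>. \<beta>\<^bsup>|F| - |\<gamma>|\<^esup> x\<^sup>F\<close>. The set \<open>\<F>\<close> may be infinite, but it contains only
  finitely many fillings of a given weight, since fillings are empty outside the diagram
  (and fixed on the basement).
\<close>

definition gen_series :: "nat list \<Rightarrow> filling set \<Rightarrow> series" where
  "gen_series \<gamma> \<F> = (\<lambda>m. \<Sum>F | F \<in> \<F> \<and> weight (diagram \<gamma>) F = m.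
      monom 1 (num_entries (diagram \<gamma>) F - sum_list \<gamma>))"

definition sky_filling :: "nat list \<Rightarrow> filling \<Rightarrow> bool" where
  "sky_filling \<gamma> F \<longleftrightarrow>
    (\<forall>b\<in>diagram \<gamma>. is_entry_set (F b)) \<and>
    (\<forall>(i, j)\<in>basement \<gamma>. F (i, j) = {i}) \<and>
    (\<forall>b. b \<notin> diagram \<gamma> \<union> basement \<gamma> \<longrightarrow> F b = {})"

definition anchor :: "filling \<Rightarrow> nat \<times> nat \<Rightarrow> nat" where
  "anchor F b = Max (F b)"

definition set_ge :: "nat set \<Rightarrow> nat set \<Rightarrow> bool" where
  "set_ge A B \<longleftrightarrow> Min A \<ge> Max B"

definition set_gt :: "nat set \<Rightarrow> nat set \<Rightarrow> bool" where
  "set_gt A B \<longleftrightarrow> Min A > Max B"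

definition distinct_columns :: "nat list \<Rightarrow> filling \<Rightarrow> bool" where
  "distinct_columns \<gamma> F \<longleftrightarrow>
    (\<forall>i i' j. i \<noteq> i' \<and> (i, j) \<in> diagram \<gamma> \<and> (i', j) \<in> diagram \<gamma> \<longrightarrow> F (i, j) \<inter> F (i', j) = {})"

text \<open>For \<open>k = 0\<close> this compares the first box of a row with the basement.\<close>

definition decreasing_rows :: "nat list \<Rightarrow> filling \<Rightarrow> bool" where
  "decreasing_rows \<gamma> F \<longleftrightarrow>
    (\<forall>i k. (i, k + 1) \<in> diagram \<gamma> \<longrightarrow> set_ge (F (i, k)) (F (i, k + 1)))"

definition inversion_triple :: "nat \<Rightarrow> nat \<Rightarrow> nat \<Rightarrow> bool" where
  "inversion_triple a b c \<longleftrightarrow> (b > c \<and> c \<ge> a) \<or> (c \<ge> a \<and> a > b)"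

definition inversion_triples :: "nat list \<Rightarrow> filling \<Rightarrow> bool" where
  "inversion_triples \<gamma> F \<longleftrightarrow>
    (\<forall>i j k. 1 \<le> i \<and> i < j \<and> j \<le> length \<gamma> \<longrightarrow>
      (let E = diagram \<gamma> \<union> basement \<gamma> in
        (part \<gamma> i \<ge> part \<gamma> j \<and> {(i, k), (i, k + 1), (j, k + 1)} \<subseteq> E \<longrightarrow>
          inversion_triple (anchor F (i, k + 1)) (anchor F (j, k + 1)) (anchor F (i, k))) \<and>
        (part \<gamma> i < part \<gamma> j \<and> {(i, k), (j, k), (j, k + 1)} \<subseteq> E \<longrightarrow>
          inversion_triple (anchor F (j, k + 1)) (anchor F (i, k)) (anchor F (j, k)))))"

definition can_be_free :: "nat list \<Rightarrow> filling \<Rightarrow> nat \<Rightarrow> nat \<times> nat \<Rightarrow> bool" where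
  "can_be_free \<gamma> F x = (\<lambda>(i, j). (i, j) \<in> diagram \<gamma> \<and> x < anchor F (i, j) \<and>
    ((i, j + 1) \<in> diagram \<gamma> \<longrightarrow> x \<ge> anchor F (i, j + 1)))"

definition free_entries_highest :: "nat list \<Rightarrow> filling \<Rightarrow> bool" where
  "free_entries_highest \<gamma> F \<longleftrightarrow>
    (\<forall>(i, j)\<in>diagram \<gamma>. \<forall>x\<in>F (i, j). x \<noteq> anchor F (i, j) \<longrightarrow>
      can_be_free \<gamma> F x (i, j) \<and> (\<forall>i'<i. \<not> can_be_free \<gamma> F x (i', j)))"

definition SetSkyFill :: "nat list \<Rightarrow> filling set" where
  "SetSkyFill \<gamma> = {F. sky_filling \<gamma> F \<and> distinct_columns \<gamma> F \<and> decreasing_rows \<gamma> F \<and>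
    inversion_triples \<gamma> F \<and> free_entries_highest \<gamma> F}"

definition lascoux_atom :: "nat list \<Rightarrow> series" where
  "lascoux_atom \<gamma> = gen_series \<gamma> (SetSkyFill \<gamma>)"

definition quasi_grothendieck :: "nat list \<Rightarrow> series" where
  "quasi_grothendieck \<alpha> =
    lin_comb {\<gamma> \<in> weak_compositions. flatten \<gamma> = \<alpha>} (\<lambda>_. 1) lascoux_atom"

definition SetRT :: "nat list \<Rightarrow> filling set" where
  "SetRT \<mu> = {T.
    (\<forall>b\<in>diagram \<mu>. is_entry_set (T b)) \<and>
    (\<forall>b. b \<notin> diagram \<mu> \<longrightarrow> T b = {}) \<and>
    (\<forall>i j. (i, j) \<in> diagram \<mu> \<and> (i, j + 1) \<in> diagram \<mu> \<longrightarrow> set_ge (T (i, j)) (T (i, j + 1))) \<and>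
    (\<forall>i j. (i, j) \<in> diagram \<mu> \<and> (i + 1, j) \<in> diagram \<mu> \<longrightarrow> set_gt (T (i, j)) (T (i + 1, j)))}"

definition grothendieck :: "nat list \<Rightarrow> series" where
  "grothendieck \<mu> = gen_series \<mu> (SetRT \<mu>)"

end

theory Submission imports Defs begin

text \<open>
  Skyline fillings and reverse tableaux are both determined by their columns, that is by the set of
  anchors and the set of all entries of each column. For skyline fillings the triple conditions say
  that the anchors of each column are placed greedily, from the largest to the smallest, so the
  anchor sets determine both the shape and the arrangement. Whether a free entry fits into a
  column depends only on how many anchors of this column and of the next one exceed it.

  Hence \<open>\<L>\<^sub>\<gamma>\<close> counts the column data whose greedy arrangement has shape \<open>\<gamma>\<close>, while \<open>G\<^sub>\<lambda>\<close> counts those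
  whose column heights are conjugate to \<open>\<lambda>\<close>, so that \<open>G\<^sub>\<lambda>\<close> is the sum of the \<open>\<L>\<^sub>\<gamma>\<close> with \<open>\<lambda>(\<gamma>) = \<lambda>\<close>.
  An increasing relabelling of the letters preserves greedy arrangements up to relabelling of the
  rows, which makes \<open>\<G>\<^sub>\<alpha>\<close> quasisymmetric. For the symmetry of \<open>G\<^sub>\<lambda>\<close>, the column data are built by
  adding the letters one at a time in decreasing order, and the transfer matrices of two letters
  commute.

  Finally, the \<open>\<L>\<^sub>\<gamma>\<close> are unitriangular with respect to the monomials \<open>x\<^sup>\<gamma>\<close>, for an order in which
  \<open>\<gamma>\<^sup>+\<close>, and also its increasing rearrangement, does not come after \<open>\<gamma>\<close>. So a (quasi)symmetric \<open>f\<close>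
  with \<open>c\<^sub>\<gamma> = 0\<close> for these representatives vanishes, and in general one subtracts from \<open>f\<close> a
  combination of the \<open>\<G>\<^sub>\<alpha>\<close> or the \<open>G\<^sub>\<lambda>\<close>.
\<close>

section \<open>Column data\<close>

text \<open>A free entry that fits at all has exactly one place under either rule, the highest or
  the lowest admissible row. The number of admissible rows is a difference of two counts of anchors,
  hence the same for both kinds of fillings, and so both can be indexed by the same pairs. The power
  of \<beta> is the degree of the monomial minus the degree of the shape, so identities between
  series become equalities of natural numbers, one monomial at a time.

  Letters are added in decreasing order because a smallest letter sees only the heights of the
  columns: whether it may be a free entry, and whether the interlacing holds below it, is decided by
  cardinalities. This is why heights suffice as the states of a transfer matrix. Commutation cannot
  be checked column by column, since the choices in one column depend on the intermediate height of
  the next one; the induction therefore keeps track of whether the first column grows with the first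
  or with the second letter.\<close>

definition num_above :: "nat set \<Rightarrow> nat \<Rightarrow> nat" where
  "num_above X x = card {a \<in> X. x < a}"

text \<open>
  Rows of lengths \<open>p\<close> are filled with anchors: \<open>A i j\<close>, for \<open>j < p i\<close>, is the anchor of the box
  \<open>(i, j + 1)\<close>, so columns are counted from 0 here. The other values of \<open>A\<close> are junk.
\<close>

definition arrangement :: "(nat \<Rightarrow> nat) \<Rightarrow> (nat \<Rightarrow> nat \<Rightarrow> nat) \<Rightarrow> bool" where
  "arrangement p A \<longleftrightarrow> finite {i. 0 < p i} \<and> (\<forall>i j. j < p i \<longrightarrow> 0 < A i j) \<and>
    (\<forall>i j. Suc j < p i \<longrightarrow> A i (Suc j) \<le> A i j) \<and> (\<forall>j. inj_on (\<lambda>i. A i j) {i. j < p i})"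

definition column :: "(nat \<Rightarrow> nat) \<Rightarrow> (nat \<Rightarrow> nat \<Rightarrow> nat) \<Rightarrow> nat \<Rightarrow> nat set" where
  "column p A j = (\<lambda>i. A i j) ` {i. j < p i}"

definition allowed_rows :: "(nat \<Rightarrow> nat) \<Rightarrow> (nat \<Rightarrow> nat \<Rightarrow> nat) \<Rightarrow> nat \<Rightarrow> nat \<Rightarrow> nat set" where
  "allowed_rows p A j x = {i. j < p i \<and> x < A i j \<and> (Suc j < p i \<longrightarrow> A i (Suc j) \<le> x)}"

text \<open>\<open>C j\<close> is the set of anchors and \<open>U j\<close> the set of all entries of column \<open>j\<close>.\<close>

definition coldata :: "((nat \<Rightarrow> nat set) \<times> (nat \<Rightarrow> nat set)) set" where
  "coldata = {(C, U). (\<forall>j. finite (U j) \<and> C j \<subseteq> U j \<and> U j \<subseteq> {1..}) \<and> (\<exists>n. \<forall>j\<ge>n. C j = {}) \<and>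
    (\<forall>j x. num_above (C (Suc j)) x \<le> num_above (C j) x) \<and>
    (\<forall>j. \<forall>u\<in>U j - C j. num_above (C (Suc j)) u < num_above (C j) u)}"

lemma finite_rows: "arrangement p A \<Longrightarrow> finite {i. j < p i}"
  unfolding arrangement_def by (elim conjE, rule finite_subset[rotated]) auto

lemma finite_column: "arrangement p A \<Longrightarrow> finite (column p A j)"
  by (simp add: column_def finite_rows)

lemma finite_allowed_rows: "arrangement p A \<Longrightarrow> finite (allowed_rows p A j x)"
  by (rule finite_subset[OF _ finite_rows[of p A j]]) (auto simp: allowed_rows_def)

lemma num_above_column:
  assumes "arrangement p A"
  shows "num_above (column p A j) x = card {i. j < p i \<and> x < A i j}"
proof -
  have "{a \<in> column p A j. x < a} = (\<lambda>i. A i j) ` {i. j < p i \<and> x < A i j}"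
    by (auto simp: column_def)
  moreover have "inj_on (\<lambda>i. A i j) {i. j < p i \<and> x < A i j}"
    using assms unfolding arrangement_def by (auto intro: inj_on_subset)
  ultimately show ?thesis by (simp add: num_above_def card_image)
qed

text \<open>
  Rows being weakly decreasing, the rows whose entry in column \<open>j + 1\<close> exceeds \<open>x\<close> are among those
  whose entry in column \<open>j\<close> does, and the difference of the two sets is \<open>allowed_rows\<close>.
  So whether a free entry fits in a column does not depend on the arrangement.
\<close>

lemma card_allowed_rows:
  assumes "arrangement p A"
  shows "num_above (column p A (Suc j)) x + card (allowed_rows p A j x) = num_above (column p A j) x"
proof -
  have mono: "A i (Suc j) \<le> A i j" if "Suc j < p i" for i
    using assms that by (auto simp: arrangement_def)
  have eq: "{i. j < p i \<and> x < A i j} = {i. Suc j < p i \<and> x < A i (Suc j)} \<union> allowed_rows p A j x"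
    using mono by (fastforce simp: allowed_rows_def)
  have "finite {i. Suc j < p i \<and> x < A i (Suc j)}"
    by (rule finite_subset[OF _ finite_rows[OF assms, of "Suc j"]]) auto
  moreover have "{i. Suc j < p i \<and> x < A i (Suc j)} \<inter> allowed_rows p A j x = {}"
    by (auto simp: allowed_rows_def)
  ultimately show ?thesis
    unfolding num_above_column[OF assms] eq
    by (subst card_Un_disjoint) (simp_all add: finite_allowed_rows[OF assms])
qed

text \<open>
  Free entries go to the row selected by \<open>pick\<close> among the allowed ones: the highest for skyline
  fillings (\<open>Min\<close>), the lowest for reverse tableaux (\<open>Max\<close>).
\<close>

definition pick_filling ::
  "(nat set \<Rightarrow> nat) \<Rightarrow> (nat \<Rightarrow> nat) \<Rightarrow> (nat \<Rightarrow> nat \<Rightarrow> nat set) \<Rightarrow> bool" where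
  "pick_filling pick p H \<longleftrightarrow>
    (\<forall>i j. if j < p i then is_entry_set (H i j) else H i j = {}) \<and>
    arrangement p (\<lambda>i j. Max (H i j)) \<and>
    (\<forall>i j. \<forall>x\<in>H i j. x \<noteq> Max (H i j) \<longrightarrow> x \<notin> column p (\<lambda>i j. Max (H i j)) j \<and>
      i \<in> allowed_rows p (\<lambda>i j. Max (H i j)) j x \<and>
      i = pick (allowed_rows p (\<lambda>i j. Max (H i j)) j x))"

definition build_filling ::
  "(nat set \<Rightarrow> nat) \<Rightarrow> (nat \<Rightarrow> nat) \<Rightarrow> (nat \<Rightarrow> nat \<Rightarrow> nat) \<Rightarrow> (nat \<Rightarrow> nat set) \<Rightarrow>
    nat \<Rightarrow> nat \<Rightarrow> nat set" where
  "build_filling pick p A U = (\<lambda>i j. if j < p i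
    then insert (A i j) {x \<in> U j - column p A j. pick (allowed_rows p A j x) = i} else {})"

lemma pick_filling_entry_set:
  assumes "pick_filling pick p H" "j < p i"
  shows "is_entry_set (H i j)"
proof -
  have "if j < p i then is_entry_set (H i j) else H i j = {}"
    using assms(1) unfolding pick_filling_def by blast
  then show ?thesis using assms(2) by simp
qed

lemma pick_filling_row_le:
  assumes "pick_filling pick p H" "x \<in> H i j"
  shows "j < p i" "x \<le> Max (H i j)"
proof -
  have *: "if j < p i then is_entry_set (H i j) else H i j = {}"
    using assms(1) unfolding pick_filling_def by blast
  show "j < p i" using * assms(2) by (auto split: if_splits)
  then show "x \<le> Max (H i j)" using * assms(2) by (auto simp: is_entry_set_def)
qed

text \<open>A common entry that is the anchor of one box cannot be free in the other; so it is the
  anchor of both, and anchors are injective on a column. A common free entry lies in the row given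
  by \<open>pick\<close>, which does not depend on the box.\<close>

lemma pick_filling_disjoint:
  assumes pf: "pick_filling pick p H" and x: "x \<in> H i j" "x \<in> H i' j"
  shows "i = i'"
proof -
  let ?A = "\<lambda>i j. Max (H i j)"
  have free: "x \<notin> column p ?A j" "k = pick (allowed_rows p ?A j x)" if "x \<in> H k j" "x \<noteq> ?A k j" for k
    using pf that unfolding pick_filling_def by blast+
  have inside: "j < p i" "j < p i'" using x[THEN pick_filling_row_le(1)[OF pf]] .
  show ?thesis
  proof (cases "x = ?A i j \<or> x = ?A i' j")
    case True
    then have "x \<in> column p ?A j" using inside unfolding column_def by blast
    then have "?A i j = ?A i' j" using free(1) x by metis
    moreover have "inj_on (\<lambda>i. ?A i j) {i. j < p i}"
      using pf by (simp add: pick_filling_def arrangement_def)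
    ultimately show ?thesis using inside by (auto dest: inj_onD)
  next
    case False
    then show ?thesis using free(2)[of i] free(2)[of i'] x by simp
  qed
qed

text \<open>Nothing is lost by keeping only the anchors and the union of each column: the row of a
  free entry is a function of the anchors. This is the injectivity behind the later
  bijection.\<close>

lemma pick_filling_eq_build:
  assumes "pick_filling pick p H"
  shows "H = build_filling pick p (\<lambda>i j. Max (H i j)) (\<lambda>j. \<Union>i. H i j)"
proof (intro ext equalityI subsetI)
  fix i j x
  assume x: "x \<in> H i j"
  have 1: "j < p i" by (rule pick_filling_row_le(1)[OF assms x])
  have 2: "\<exists>i. x \<in> H i j" using x ..
  show "x \<in> build_filling pick p (\<lambda>i j. Max (H i j)) (\<lambda>j. \<Union>i. H i j) i j"
  proof (cases "x = Max (H i j)")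
    case True
    then show ?thesis using 1 unfolding build_filling_def by simp
  next
    case False
    then have "x \<notin> column p (\<lambda>i j. Max (H i j)) j" "pick (allowed_rows p (\<lambda>i j. Max (H i j)) j x) = i"
      using assms x unfolding pick_filling_def by metis+
    then show ?thesis using 1 2 unfolding build_filling_def by simp
  qed
next
  fix i j x
  assume x: "x \<in> build_filling pick p (\<lambda>i j. Max (H i j)) (\<lambda>j. \<Union>i. H i j) i j"
  then have i: "j < p i" by (auto simp: build_filling_def split: if_splits)
  then have "finite (H i j)" "H i j \<noteq> {}"
    using pick_filling_entry_set[OF assms] by (auto simp: is_entry_set_def)
  then have mx: "Max (H i j) \<in> H i j" by simp
  show "x \<in> H i j"
  proof (cases "x = Max (H i j)")
    case False
    with x i obtain i' where i': "x \<in> H i' j" "x \<notin> column p (\<lambda>i j. Max (H i j)) j"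
      "pick (allowed_rows p (\<lambda>i j. Max (H i j)) j x) = i"
      by (auto simp: build_filling_def)
    have "j < p i'" using pick_filling_row_le[OF assms i'(1)] by simp
    then have "x \<noteq> Max (H i' j)" using i'(2) by (auto simp: column_def)
    then have "i' = i" using assms i' by (auto simp: pick_filling_def)
    then show ?thesis using i' by simp
  qed (use mx in simp)
qed

text \<open>Both inequalities of \<open>coldata\<close> come from \<open>card_allowed_rows\<close>:
  the difference of the two counts is the number of allowed rows, and at a free entry it is positive
  because the row holding the entry is allowed.\<close>

lemma pick_filling_coldata:
  assumes "pick_filling pick p H"
  shows "(column p (\<lambda>i j. Max (H i j)), \<lambda>j. \<Union>i. H i j) \<in> coldata"
proof -
  let ?A = "\<lambda>i j. Max (H i j)"
  have arr: "arrangement p ?A" and es: "\<And>i j. j < p i \<Longrightarrow> is_entry_set (H i j)"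
    and em: "\<And>i j. \<not> j < p i \<Longrightarrow> H i j = {}"
    using assms by (auto simp: pick_filling_def split: if_splits)
  have U: "(\<Union>i. H i j) = (\<Union>i\<in>{i. j < p i}. H i j)" for j
    using em by blast
  have fin: "finite (\<Union>i. H i j)" for j
    unfolding U using es finite_rows[OF arr, of j] by (auto simp: is_entry_set_def)
  have sub: "column p ?A j \<subseteq> (\<Union>i. H i j)" for j
  proof -
    have "?A i j \<in> H i j" if "j < p i" for i
      using es[OF that] unfolding is_entry_set_def by (meson Max_in)
    then show ?thesis unfolding column_def by blast
  qed
  have pos: "(\<Union>i. H i j) \<subseteq> {1..}" for j
    unfolding U using es by (auto simp: is_entry_set_def)
  \<comment> \<open>Columns beyond the longest row are empty; the inserted 0 gives
    \<open>Max\<close> a value when there are no rows.\<close>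
  have "column p ?A j = {}" if j: "Max (insert 0 (p ` {i. 0 < p i})) \<le> j" for j
  proof -
    have "\<not> j < p i" for i
    proof
      assume "j < p i"
      then have "p i \<le> Max (insert 0 (p ` {i. 0 < p i}))"
        using finite_rows[OF arr, of 0] by (intro Max_ge) auto
      with j \<open>j < p i\<close> show False by simp
    qed
    then show "column p ?A j = {}" by (auto simp: column_def)
  qed
  moreover have "num_above (column p ?A (Suc j)) x \<le> num_above (column p ?A j) x" for j x
    using card_allowed_rows[OF arr, of j x] by simp
  moreover have "num_above (column p ?A (Suc j)) u < num_above (column p ?A j) u"
    if u: "u \<in> (\<Union>i. H i j) - column p ?A j" for j u
  proof -
    obtain i where i: "u \<in> H i j" using u by auto
    then have "u \<noteq> ?A i j"
      using pick_filling_row_le[OF assms i] u by (auto simp: column_def)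
    then have "i \<in> allowed_rows p ?A j u"
      using assms i by (auto simp: pick_filling_def)
    then have "card (allowed_rows p ?A j u) > 0"
      using finite_allowed_rows[OF arr] by (auto simp: card_gt_0_iff)
    then show ?thesis using card_allowed_rows[OF arr, of j u] by simp
  qed
  ultimately show ?thesis
    unfolding coldata_def mem_Collect_eq prod.case
    using fin sub pos by (intro conjI allI ballI impI exI) assumption+
qed

text \<open>For a non-anchor the strict inequality in \<open>coldata\<close> says that some row is
  allowed, so \<open>pick\<close> chooses from a nonempty set. The entries added to a box are
  smaller than its anchor, hence all anchors remain the maxima and \<open>column\<close> and
  \<open>allowed_rows\<close> do not change.\<close>

lemma
  assumes arr: "arrangement p A" and cd: "(column p A, U) \<in> coldata"
    and pick: "\<And>S. finite S \<Longrightarrow> S \<noteq> {} \<Longrightarrow> pick S \<in> S"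
  shows Max_build_filling: "j < p i \<Longrightarrow> Max (build_filling pick p A U i j) = A i j"
    and UN_build_filling: "(\<Union>i. build_filling pick p A U i j) = U j"
    and pick_filling_build: "pick_filling pick p (build_filling pick p A U)"
proof -
  let ?H = "build_filling pick p A U"
  have fin: "finite (U j)" and sub: "column p A j \<subseteq> U j" and pos: "U j \<subseteq> {1..}" for j
    using cd by (auto simp: coldata_def)
  have allowed: "pick (allowed_rows p A j x) \<in> allowed_rows p A j x"
    if "x \<in> U j - column p A j" for j x
  proof (rule pick)
    have "num_above (column p A (Suc j)) x < num_above (column p A j) x"
      using cd that by (auto simp: coldata_def)
    then have "card (allowed_rows p A j x) > 0" using card_allowed_rows[OF arr, of j x] by linarith
    then show "allowed_rows p A j x \<noteq> {}" by auto
  qed (rule finite_allowed_rows[OF arr])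
  have finH: "finite (?H i j)" for i j
    using fin by (auto simp: build_filling_def)
  show Max: "Max (?H i j) = A i j" if "j < p i" for i j
  proof (rule Max_eqI)
    fix y assume "y \<in> ?H i j"
    then show "y \<le> A i j" using allowed[of y j] that
      by (auto simp: build_filling_def allowed_rows_def)
  next
    show "A i j \<in> ?H i j" using that by (simp add: build_filling_def)
  qed (rule finH)
  show UN: "(\<Union>i. ?H i j) = U j" for j
  proof (intro equalityI subsetI)
    fix x assume "x \<in> (\<Union>i. ?H i j)"
    then show "x \<in> U j" using sub[of j] by (auto simp: build_filling_def column_def split: if_splits)
  next
    fix x assume x: "x \<in> U j"
    show "x \<in> (\<Union>i. ?H i j)"
    proof (cases "x \<in> column p A j")
      case True
      then show ?thesis by (auto simp: build_filling_def column_def)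
    next
      case False
      then show ?thesis using x allowed[of x j]
        by (auto simp: build_filling_def allowed_rows_def intro!: exI[of _ "pick (allowed_rows p A j x)"])
    qed
  qed
  have arr': "arrangement p (\<lambda>i j. Max (?H i j))"
    using arr Max unfolding arrangement_def
    by (auto simp: inj_on_def)
  have col': "column p (\<lambda>i j. Max (?H i j)) = column p A"
    using Max by (auto simp: column_def fun_eq_iff)
  have all': "allowed_rows p (\<lambda>i j. Max (?H i j)) = allowed_rows p A"
    using Max by (auto simp: allowed_rows_def fun_eq_iff)
  have es: "is_entry_set (?H i j)" if "j < p i" for i j
  proof -
    have "?H i j \<subseteq> {1..}" using UN[of j] pos[of j] by blast
    then show ?thesis using that finH[of i j] by (auto simp: is_entry_set_def build_filling_def)
  qed
  have em: "?H i j = {}" if "\<not> j < p i" for i j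
    using that by (auto simp: build_filling_def)
  show "pick_filling pick p ?H"
    unfolding pick_filling_def col' all'
  proof (intro conjI allI ballI impI)
    show "if j < p i then is_entry_set (?H i j) else ?H i j = {}" for i j
      using es em by auto
    show "arrangement p (\<lambda>i j. Max (?H i j))" by (rule arr')
    fix i j x assume x: "x \<in> ?H i j" "x \<noteq> Max (?H i j)"
    then have i: "j < p i" by (auto simp: build_filling_def split: if_splits)
    with x Max[OF i] have "x \<in> U j - column p A j" "pick (allowed_rows p A j x) = i"
      by (auto simp: build_filling_def)
    then show "x \<notin> column p A j" "i \<in> allowed_rows p A j x" "i = pick (allowed_rows p A j x)"
      using allowed[of x j] by auto
  qed
qed

section \<open>Weight of column data, and finiteness for a given weight\<close>

definition has_weight :: "(nat \<Rightarrow> nat set) \<Rightarrow> nat multiset \<Rightarrow> bool" where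
  "has_weight U m \<longleftrightarrow> (\<forall>x. count m x = card {j. x \<in> U j})"

text \<open>Without anchors in the column, the strict inequality required of a free entry would make
  a count smaller than 0.\<close>

lemma coldata_nonempty:
  assumes "(C, U) \<in> coldata" "x \<in> U j"
  shows "C j \<noteq> {}"
proof
  assume "C j = {}"
  then have "x \<in> U j - C j" using assms(2) by simp
  then have "num_above (C (Suc j)) x < num_above (C j) x" using assms(1) by (auto simp: coldata_def)
  then have "num_above (C (Suc j)) x < num_above {} x" using \<open>C j = {}\<close> by simp
  then show False by (simp add: num_above_def)
qed

lemma coldata_finite_columns:
  assumes "(C, U) \<in> coldata"
  shows "finite {j. x \<in> U j}"
proof -
  obtain n where "\<forall>j\<ge>n. C j = {}" using assms by (auto simp: coldata_def)
  then have "{j. x \<in> U j} \<subseteq> {..<n}" using coldata_nonempty[OF assms] by (force simp: not_le[symmetric])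
  then show ?thesis by (rule finite_subset) simp
qed

lemma has_weight_mem:
  assumes "(C, U) \<in> coldata" "has_weight U m"
  shows "x \<in># m \<longleftrightarrow> (\<exists>j. x \<in> U j)"
  using assms coldata_finite_columns[OF assms(1), of x]
  by (auto simp: has_weight_def card_gt_0_iff simp flip: count_greater_zero_iff)

lemma coldata_column_antimono:
  assumes "(C, U) \<in> coldata" "i \<le> j"
  shows "num_above (C j) x \<le> num_above (C i) x"
  using assms(2)
proof (induction j rule: dec_induct)
  case (step n)
  moreover have "num_above (C (Suc n)) x \<le> num_above (C n) x" using assms(1) by (auto simp: coldata_def)
  ultimately show ?case by linarith
qed simp

lemma num_above_0: "X \<subseteq> {1..} \<Longrightarrow> num_above X 0 = card X"
  unfolding num_above_def by (rule arg_cong[where f = card]) force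

text \<open>Nonempty columns form an initial segment, because heights decrease, and each contributes
  to the size of \<open>m\<close>. So the columns from \<open>size m\<close> on are empty, and the
  others are subsets of \<open>set_mset m\<close>.\<close>

lemma finite_coldata_weight: "finite {(C, U). (C, U) \<in> coldata \<and> has_weight U m}"
proof -
  let ?Fs = "{U. \<forall>j. (j \<in> {..<size m} \<longrightarrow> U j \<in> Pow (set_mset m)) \<and> (j \<notin> {..<size m} \<longrightarrow> U j = {})}"
  have "finite ?Fs" by (intro finite_set_of_finite_funs) auto
  moreover have "C \<in> ?Fs \<and> U \<in> ?Fs" if cd: "(C, U) \<in> coldata" and wt: "has_weight U m" for C U
  proof -
    have sub: "C j \<subseteq> U j" "U j \<subseteq> set_mset m" for j
      using cd has_weight_mem[OF cd wt] by (auto simp: coldata_def)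
    have em: "U j = {}" if "size m \<le> j" for j
    proof (rule ccontr)
      assume "U j \<noteq> {}"
      then have "C j \<noteq> {}" using coldata_nonempty[OF cd] by auto
      have fin: "finite (C i)" "C i \<subseteq> {1..}" for i using cd by (auto simp: coldata_def intro: finite_subset)
      then have "C i \<noteq> {}" if "i \<le> j" for i
        using coldata_column_antimono[OF cd that, of 0] \<open>C j \<noteq> {}\<close> fin[of i] fin[of j]
        by (auto simp: num_above_0)
      then have "\<forall>i\<in>{..j}. \<exists>x. x \<in> U i" using sub(1) by blast
      \<comment> \<open>\<open>f\<close> picks one entry in each of the columns 0 to
        \<open>j\<close>; grouping these columns by the picked letter gives
        \<open>Suc j \<le> size m\<close>.\<close>
      then obtain f where f: "\<And>i. i \<le> j \<Longrightarrow> f i \<in> U i" by (metis atMost_iff)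
      have "Suc j = (\<Sum>x\<in>set_mset m. card {i \<in> {..j}. f i = x})"
      proof -
        have "card {..j} = (\<Sum>x\<in>set_mset m. card {i \<in> {..j}. f i = x})"
          using f sub(2) 
          by (subst card_eq_sum, subst sum.group[of "{..j}" "set_mset m" f "\<lambda>_. 1", symmetric]) (auto simp: subset_iff)
        then show ?thesis by simp
      qed
      also have "\<dots> \<le> (\<Sum>x\<in>set_mset m. card {i. x \<in> U i})"
        using f by (intro sum_mono card_mono coldata_finite_columns[OF cd]) auto
      also have "\<dots> = size m" using wt by (simp add: has_weight_def size_multiset_overloaded_eq)
      finally show False using that by simp
    qed
    moreover have "C j = {}" if "size m \<le> j" for j using em[OF that] sub(1)[of j] by auto
    ultimately show ?thesis using sub by (auto simp: not_less) blast+
  qed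
  then have "{(C, U). (C, U) \<in> coldata \<and> has_weight U m} \<subseteq> ?Fs \<times> ?Fs" by blast
  ultimately show ?thesis by (meson finite_SigmaI finite_subset)
qed

lemma column_cong:
  "(\<And>i j. j < p i \<Longrightarrow> A i j = A' i j) \<Longrightarrow> column p A = column p A'"
  by (auto simp: column_def fun_eq_iff)

lemma allowed_rows_cong:
  "(\<And>i j. j < p i \<Longrightarrow> A i j = A' i j) \<Longrightarrow> allowed_rows p A = allowed_rows p A'"
  by (auto simp: allowed_rows_def fun_eq_iff)

lemma build_filling_cong:
  assumes "\<And>i j. j < p i \<Longrightarrow> A i j = A' i j"
  shows "build_filling pick p A U = build_filling pick p A' U"
proof -
  have "column p A = column p A'" "allowed_rows p A = allowed_rows p A'"
    using assms by (auto intro!: column_cong allowed_rows_cong)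
  then show ?thesis unfolding build_filling_def using assms by (simp add: fun_eq_iff)
qed

text \<open>\<open>P\<close> stands for \<open>greedy\<close> or \<open>strict_columns\<close>, the
  condition that leaves at most one arrangement for given anchor sets. The hypothesis
  \<open>cong\<close> makes \<open>P\<close> blind to the junk values of an arrangement outside its
  rows.\<close>

lemma bij_betw_pick_fillings:
  assumes pick: "\<And>S. finite S \<Longrightarrow> S \<noteq> {} \<Longrightarrow> pick S \<in> S"
    and unique: "\<And>A A' i j. arrangement p A \<Longrightarrow> P A \<Longrightarrow> arrangement p A' \<Longrightarrow> P A' \<Longrightarrow>
      column p A = column p A' \<Longrightarrow> j < p i \<Longrightarrow> A i j = A' i j"
    and cong: "\<And>A A'. P A \<Longrightarrow> (\<And>i j. j < p i \<Longrightarrow> A i j = A' i j) \<Longrightarrow> P A'"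
  shows "bij_betw (\<lambda>H. (column p (\<lambda>i j. Max (H i j)), \<lambda>j. \<Union>i. H i j))
    {H. pick_filling pick p H \<and> P (\<lambda>i j. Max (H i j))}
    {(C, U). (C, U) \<in> coldata \<and> (\<exists>A. arrangement p A \<and> P A \<and> column p A = C)}"
proof (rule bij_betwI')
  fix H H' assume H: "H \<in> {H. pick_filling pick p H \<and> P (\<lambda>i j. Max (H i j))}"
    and H': "H' \<in> {H. pick_filling pick p H \<and> P (\<lambda>i j. Max (H i j))}"
  let ?M = "\<lambda>H i j. Max (H i j :: nat set)"
  have arr: "arrangement p (?M H)" "arrangement p (?M H')"
    using H H' by (auto simp: pick_filling_def)
  show "((column p (?M H), \<lambda>j. \<Union>i. H i j) = (column p (?M H'), \<lambda>j. \<Union>i. H' i j)) = (H = H')"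
  proof
    assume eq: "(column p (?M H), \<lambda>j. \<Union>i. H i j) = (column p (?M H'), \<lambda>j. \<Union>i. H' i j)"
    have "H = build_filling pick p (?M H) (\<lambda>j. \<Union>i. H i j)"
      using H by (intro pick_filling_eq_build) simp
    also have "\<dots> = build_filling pick p (?M H') (\<lambda>j. \<Union>i. H i j)"
    proof (rule build_filling_cong)
      have P: "P (?M H)" "P (?M H')" using H H' by blast+
      have col: "column p (?M H) = column p (?M H')" using eq by blast
      show "?M H i j = ?M H' i j" if "j < p i" for i j
        by (rule unique[OF arr(1) P(1) arr(2) P(2) col that])
    qed
    also have "\<dots> = build_filling pick p (?M H') (\<lambda>j. \<Union>i. H' i j)" using eq by simp
    also have "\<dots> = H'"
      using H' by (intro pick_filling_eq_build[symmetric]) simp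
    finally show "H = H'" .
  qed simp
next
  fix H assume "H \<in> {H. pick_filling pick p H \<and> P (\<lambda>i j. Max (H i j))}"
  then have H: "pick_filling pick p H" "P (\<lambda>i j. Max (H i j))" by simp_all
  moreover have "arrangement p (\<lambda>i j. Max (H i j))" using H(1) by (simp add: pick_filling_def)
  ultimately show "(column p (\<lambda>i j. Max (H i j)), \<lambda>j. \<Union>i. H i j)
      \<in> {(C, U). (C, U) \<in> coldata \<and> (\<exists>A. arrangement p A \<and> P A \<and> column p A = C)}"
    using pick_filling_coldata[OF H(1)] by blast
next
  fix CU assume "CU \<in> {(C, U). (C, U) \<in> coldata \<and> (\<exists>A. arrangement p A \<and> P A \<and> column p A = C)}"
  then obtain A U where CU: "CU = (column p A, U)" and cd: "(column p A, U) \<in> coldata"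
    and A: "arrangement p A" "P A" by auto
  let ?H = "build_filling pick p A U"
  have Max: "Max (?H i j) = A i j" if "j < p i" for i j
    using Max_build_filling[where pick = pick, OF A(1) cd pick that] .
  have UN: "(\<lambda>j. \<Union>i. ?H i j) = U"
    using UN_build_filling[where pick = pick, OF A(1) cd pick] by (rule ext)
  have "P (\<lambda>i j. Max (?H i j))" by (rule cong[OF A(2)]) (simp add: Max)
  moreover have "pick_filling pick p ?H"
    using pick_filling_build[where pick = pick, OF A(1) cd pick] .
  moreover have "CU = (column p (\<lambda>i j. Max (?H i j)), \<lambda>j. \<Union>i. ?H i j)"
    using column_cong[of p "\<lambda>i j. Max (?H i j)" A] Max by (simp add: CU UN)
  ultimately show "\<exists>H\<in>{H. pick_filling pick p H \<and> P (\<lambda>i j. Max (H i j))}.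
      CU = (column p (\<lambda>i j. Max (H i j)), \<lambda>j. \<Union>i. H i j)" by blast
qed

section \<open>Greedy arrangements: uniqueness and existence for given anchor sets\<close>

definition greedy :: "(nat \<Rightarrow> nat) \<Rightarrow> (nat \<Rightarrow> nat \<Rightarrow> nat) \<Rightarrow> bool" where
  "greedy p A \<longleftrightarrow> (\<forall>i. 0 < p i \<longrightarrow> A i 0 = i) \<and>
    (\<forall>j i i'. i < i' \<and> j < p i \<and> Suc j < p i' \<longrightarrow>
      A i j < A i' (Suc j) \<or> Suc j < p i \<and> A i' (Suc j) < A i (Suc j))"

text \<open>
  For fixed column sets, the second condition says that the entries of column \<open>j + 1\<close> are placed
  from the largest to the smallest, each in the topmost free row whose entry in column \<open>j\<close> is not
  smaller. Hence the column sets determine the arrangement.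
\<close>

lemma arrangement_row_le: "arrangement p A \<Longrightarrow> Suc j < p i \<Longrightarrow> A i (Suc j) \<le> A i j"
  by (simp add: arrangement_def)

lemma greedyD:
  "greedy p A \<Longrightarrow> i < i' \<Longrightarrow> j < p i \<Longrightarrow> Suc j < p i' \<Longrightarrow>
    A i j < A i' (Suc j) \<or> Suc j < p i \<and> A i' (Suc j) < A i (Suc j)"
  by (simp add: greedy_def)

text \<open>Induction on the number of larger anchors in the column. Suppose \<open>d\<close> lies
  in row \<open>i\<close> of \<open>A\<close> and in a lower row \<open>i'\<close> of
  \<open>A'\<close>. Row \<open>i\<close> could hold \<open>d\<close> in \<open>A'\<close> too,
  since the previous columns agree, so greediness puts a larger anchor there. By induction that
  anchor is in row \<open>i\<close> of \<open>A\<close> as well, where \<open>d\<close> is. The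
  other case is symmetric.\<close>

lemma greedy_step_unique:
  assumes arr: "arrangement p A" "arrangement p' A'" and g: "greedy p A" "greedy p' A'"
    and col: "column p A (Suc j) = column p' A' (Suc j)"
    and prev: "\<And>i. j < p i \<longleftrightarrow> j < p' i" "\<And>i. j < p i \<Longrightarrow> A i j = A' i j"
    and i: "Suc j < p i" and i': "Suc j < p' i'" and eq: "A i (Suc j) = A' i' (Suc j)"
  shows "i = i'"
proof -
  have "\<forall>i i'. Suc j < p i \<and> Suc j < p' i' \<and> A i (Suc j) = d \<and> A' i' (Suc j) = d \<longrightarrow> i = i'" for d
  proof (induction "num_above (column p A (Suc j)) d" arbitrary: d rule: less_induct)
    case less
    have IH: "k = k'"
      if "Suc j < p k" "Suc j < p' k'" "A k (Suc j) = A' k' (Suc j)" "d < A k (Suc j)" for k k'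
    proof -
      have "num_above (column p A (Suc j)) (A k (Suc j)) < num_above (column p A (Suc j)) d"
        unfolding num_above_def
      proof (rule psubset_card_mono)
        have "A k (Suc j) \<in> column p A (Suc j)" using that(1) by (auto simp: column_def)
        then show "{a \<in> column p A (Suc j). A k (Suc j) < a} \<subset> {a \<in> column p A (Suc j). d < a}"
          using that(4) by force
      qed (use finite_column[OF arr(1)] in simp)
      from less[OF this] that show ?thesis by metis
    qed
    have col1: "\<exists>k. Suc j < p k \<and> A k (Suc j) = A' k' (Suc j)" if "Suc j < p' k'" for k'
    proof -
      have "A' k' (Suc j) \<in> column p A (Suc j)" using that col by (auto simp: column_def)
      then show ?thesis by (auto simp: column_def)
    qed
    have col2: "\<exists>k'. Suc j < p' k' \<and> A' k' (Suc j) = A k (Suc j)" if "Suc j < p k" for k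
    proof -
      have "A k (Suc j) \<in> column p' A' (Suc j)" using that col by (auto simp: column_def)
      then show ?thesis by (auto simp: column_def)
    qed
    show ?case
    proof (intro allI impI)
      fix i i' assume h: "Suc j < p i \<and> Suc j < p' i' \<and> A i (Suc j) = d \<and> A' i' (Suc j) = d"
      have le: "A i (Suc j) \<le> A i j" "A' i' (Suc j) \<le> A' i' j"
        using arrangement_row_le[OF arr(1), of j i] arrangement_row_le[OF arr(2), of j i'] h by auto
      show "i = i'"
      proof (rule linorder_cases[of i i'])
        assume i: "i < i'"
        have "j < p' i" using prev(1)[of i] h by linarith
        then have "A' i j < A' i' (Suc j) \<or> Suc j < p' i \<and> A' i' (Suc j) < A' i (Suc j)"
          using h greedyD[OF g(2) i] by blast
        moreover have "A i j = A' i j" using prev(2)[of i] h by linarith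
        ultimately have *: "Suc j < p' i" "d < A' i (Suc j)" using le h by auto
        obtain k where "Suc j < p k" "A k (Suc j) = A' i (Suc j)" using col1[OF *(1)] by auto
        then have "k = i" "A k (Suc j) \<noteq> d" using IH[of k i] * by auto
        then show ?thesis using h by auto
      next
        assume i: "i' < i"
        have "j < p i'" using prev(1)[of i'] h by linarith
        then have "A i' j < A i (Suc j) \<or> Suc j < p i' \<and> A i (Suc j) < A i' (Suc j)"
          using h greedyD[OF g(1) i] by blast
        moreover have "A i' j = A' i' j" using prev(2)[of i'] \<open>j < p i'\<close> by blast
        ultimately have *: "Suc j < p i'" "d < A i' (Suc j)" using le h by auto
        obtain k where "Suc j < p' k" "A' k (Suc j) = A i' (Suc j)" using col2[OF *(1)] by auto
        then have "i' = k" "A' k (Suc j) \<noteq> d" using IH[of i' k] * by auto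
        then show ?thesis using h by auto
      qed
    qed
  qed
  then show ?thesis using i i' eq by blast
qed

text \<open>Column 0 shows which rows are present, since row \<open>i\<close> starts with
  \<open>i\<close>, and each further column shows which rows continue. Thus the shape is determined
  together with the entries.\<close>

lemma greedy_unique:
  assumes arr: "arrangement p A" "arrangement p' A'" and g: "greedy p A" "greedy p' A'"
    and col: "column p A = column p' A'"
  shows "p = p'" "j < p i \<Longrightarrow> A i j = A' i j"
proof -
  have step: "\<forall>i. (j < p i \<longleftrightarrow> j < p' i) \<and> (j < p i \<longrightarrow> A i j = A' i j)" for j
  proof (induction j)
    case 0
    have "column p A 0 = {i. 0 < p i}" "column p' A' 0 = {i. 0 < p' i}"
      using g by (force simp: column_def greedy_def)+
    then have "{i. 0 < p i} = {i. 0 < p' i}" using col by simp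
    then have "0 < p i \<longleftrightarrow> 0 < p' i" for i by blast
    then show ?case using g unfolding greedy_def by metis
  next
    case (Suc j)
    have col': "column p A (Suc j) = column p' A' (Suc j)" using col by simp
    have uniq: "i = i'" if "Suc j < p i" "Suc j < p' i'" "A i (Suc j) = A' i' (Suc j)" for i i'
      using greedy_step_unique[OF arr g col' _ _ that] Suc by blast
    show ?case
    proof (intro allI)
      fix i
      have 1: "Suc j < p' i \<and> A i (Suc j) = A' i (Suc j)" if "Suc j < p i"
      proof -
        have "A i (Suc j) \<in> column p' A' (Suc j)" using that col' by (auto simp: column_def)
        then obtain k where "Suc j < p' k" "A i (Suc j) = A' k (Suc j)" by (auto simp: column_def)
        then show ?thesis using uniq[OF that, of k] by auto
      qed
      have 2: "Suc j < p i" if "Suc j < p' i"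
      proof -
        have "A' i (Suc j) \<in> column p A (Suc j)" using that col' by (auto simp: column_def)
        then obtain k where "Suc j < p k" "A k (Suc j) = A' i (Suc j)" by (auto simp: column_def)
        then show ?thesis using uniq[of k i] that by auto
      qed
      show "(Suc j < p i \<longleftrightarrow> Suc j < p' i) \<and> (Suc j < p i \<longrightarrow> A i (Suc j) = A' i (Suc j))"
        using 1 2 by blast
    qed
  qed
  show "p = p'"
  proof
    fix i show "p i = p' i" using step[of "p i"] step[of "p' i"] by (meson linorder_neqE_nat less_irrefl)
  qed
  show "j < p i \<Longrightarrow> A i j = A' i j" using step by blast
qed

text \<open>A counting condition of Hall type for nested sets of candidates. The induction adds a
  new least element \<open>d\<close>, so the larger ones are already placed. The hypothesis at
  \<open>d\<close> leaves at least one unoccupied row that can hold it, and the topmost of these,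
  \<open>Min V\<close>, is taken.\<close>

lemma greedy_placement_exists:
  fixes a :: "nat \<Rightarrow> nat"
  assumes "finite D" "finite R" "\<And>d. d \<in> D \<Longrightarrow> card {d'\<in>D. d \<le> d'} \<le> card {i\<in>R. d \<le> a i}"
  shows "\<exists>g. inj_on g D \<and> g ` D \<subseteq> R \<and> (\<forall>d\<in>D. d \<le> a (g d)) \<and>
    (\<forall>d\<in>D. \<forall>i\<in>R. i < g d \<longrightarrow> a i < d \<or> (\<exists>d'\<in>D. d < d' \<and> g d' = i))"
  using assms(1,3)
proof (induction D rule: finite_linorder_min_induct)
  case empty
  then show ?case by simp
next
  case (insert d D)
  have "card {d'\<in>D. e \<le> d'} \<le> card {i\<in>R. e \<le> a i}" if "e \<in> D" for e
  proof -
    have "card {d'\<in>D. e \<le> d'} \<le> card {d'\<in>insert d D. e \<le> d'}"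
      using insert.hyps(1) by (intro card_mono) auto
    also have "\<dots> \<le> card {i\<in>R. e \<le> a i}" using insert.prems[of e] that by simp
    finally show ?thesis .
  qed
  from insert.IH[OF this] obtain g where g: "inj_on g D" "g ` D \<subseteq> R" "\<forall>d\<in>D. d \<le> a (g d)"
    "\<forall>d\<in>D. \<forall>i\<in>R. i < g d \<longrightarrow> a i < d \<or> (\<exists>d'\<in>D. d < d' \<and> g d' = i)" by auto
  have dD: "d \<notin> D" using insert.hyps(2) by blast
  define V where "V = {i\<in>R. d \<le> a i} - g ` D"
  have "{d' \<in> insert d D. d \<le> d'} = insert d D" using insert.hyps(2) by auto
  then have "card (insert d D) \<le> card {i\<in>R. d \<le> a i}" using insert.prems[of d] by simp
  moreover have "card (g ` D) = card D" using g(1) by (rule card_image)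
  ultimately have "card (g ` D) < card {i\<in>R. d \<le> a i}"
    using dD insert.hyps(1) by simp
  then have "V \<noteq> {}" unfolding V_def using insert.hyps(1)
    by (metis Diff_eq_empty_iff card_mono finite_imageI not_le)
  moreover have finV: "finite V" unfolding V_def using assms(2) by simp
  ultimately have MV: "Min V \<in> V" by (rule Min_in[rotated])
  define g' where "g' = g(d := Min V)"
  have g'D: "g' e = g e" if "e \<in> D" for e using that dD by (auto simp: g'_def)
  have g'd: "g' d = Min V" by (simp add: g'_def)
  have "inj_on g' (insert d D)"
  proof -
    have "inj_on g' D" using g(1) g'D by (simp add: inj_on_def)
    moreover have "g' ` D = g ` D" using g'D by auto
    ultimately show ?thesis using MV dD by (auto simp: g'd V_def)
  qed
  moreover have "g' ` insert d D \<subseteq> R" using g(2) g'D g'd MV by (auto simp: V_def)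
  moreover have "\<forall>e\<in>insert d D. e \<le> a (g' e)" using g(3) g'D g'd MV by (auto simp: V_def)
  moreover have "a i < e \<or> (\<exists>d'\<in>insert d D. e < d' \<and> g' d' = i)"
    if e: "e \<in> insert d D" "i \<in> R" "i < g' e" for e i
  proof (cases "e = d")
    case True
    then have "i \<notin> V" using e(3) g'd Min_le[OF finV, of i] by fastforce
    then have "a i < d \<or> i \<in> g ` D" using e(2) by (auto simp: V_def)
    then show ?thesis using insert.hyps(2) g'D True by force
  next
    case False
    then have "e \<in> D" using e by simp
    then show ?thesis using g(4) e g'D by (metis insertCI)
  qed
  ultimately show ?case by blast
qed

text \<open>The number of elements at least \<open>d\<close> is the number of those above
  \<open>d - 1\<close>, whence the restriction to nonzero \<open>d\<close>.\<close>

lemma interlace_above_eq: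
  assumes "\<And>x. num_above D x \<le> num_above C x" "d \<noteq> 0"
  shows "card {d'\<in>D. d \<le> d'} \<le> card {c\<in>C. d \<le> c}"
proof -
  have "{d'\<in>X. d \<le> d'} = {a \<in> X. d - 1 < a}" for X using assms(2) by auto
  then show ?thesis using assms(1)[of "d - 1"] by (simp add: num_above_def)
qed

text \<open>Induction on the number of columns. The anchors of column 0 go to the rows with their
  own numbers, and column \<open>n\<close> is placed against column \<open>n - 1\<close> by
  \<open>greedy_placement_exists\<close>, whose counting condition is the interlacing in
  \<open>coldata\<close>.\<close>

lemma greedy_exists_aux:
  assumes cd: "(C, U) \<in> coldata"
  shows "\<exists>p A. arrangement p A \<and> greedy p A \<and> (\<forall>i. p i \<le> n) \<and> (\<forall>j<n. column p A j = C j)"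
proof (induction n)
  case 0
  show ?case
    by (rule exI[of _ "\<lambda>_. 0"], rule exI[of _ "\<lambda>_ _. 0"]) (simp add: arrangement_def greedy_def)
next
  case (Suc n)
  have C: "finite (C j)" "C j \<subseteq> {1..}" for j
    using cd by (auto simp: coldata_def intro: finite_subset)
  show ?case
  proof (cases "n = 0")
    case True
    have col: "column (\<lambda>i. if i \<in> C 0 then 1 else 0) (\<lambda>i _. i) 0 = C 0"
      by (auto simp: column_def)
    show ?thesis
      by (rule exI[of _ "\<lambda>i. if i \<in> C 0 then 1 else 0"], rule exI[of _ "\<lambda>i _. i"])
        (use C[of 0] True col in \<open>auto simp: arrangement_def greedy_def\<close>)
  next
    case False
    then obtain k where k: "n = Suc k" by (cases n) auto
    from Suc obtain p A where arr: "arrangement p A" and gr: "greedy p A" and p: "\<And>i. p i \<le> n"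
      and col: "\<And>j. j < n \<Longrightarrow> column p A j = C j" by blast
    let ?R = "{i. k < p i}"
    have finR: "finite ?R" by (rule finite_rows[OF arr])
    have "card {d'\<in>C n. d \<le> d'} \<le> card {i\<in>?R. d \<le> A i k}" if "d \<in> C n" for d
    proof -
      have d: "d \<noteq> 0" using that C(2)[of n] by auto
      have "num_above (C n) x \<le> num_above (C k) x" for x using cd k by (auto simp: coldata_def)
      then have "card {d'\<in>C n. d \<le> d'} \<le> card {c\<in>C k. d \<le> c}" using d by (rule interlace_above_eq)
      also have "\<dots> = card {c\<in>column p A k. d \<le> c}" using col[of k] k by simp
      also have "{c\<in>column p A k. d \<le> c} = (\<lambda>i. A i k) ` {i\<in>?R. d \<le> A i k}"
        by (auto simp: column_def)
      also have "card \<dots> \<le> card {i\<in>?R. d \<le> A i k}"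
        using finR by (intro card_image_le) simp
      finally show ?thesis .
    qed
    from greedy_placement_exists[OF C(1) finR this] obtain g where
      g: "inj_on g (C n)" "g ` C n \<subseteq> ?R" "\<forall>d\<in>C n. d \<le> A (g d) k"
      "\<forall>d\<in>C n. \<forall>i\<in>?R. i < g d \<longrightarrow> A i k < d \<or> (\<exists>d'\<in>C n. d < d' \<and> g d' = i)" by blast
    \<comment> \<open>Rows chosen by \<open>g\<close> reach column \<open>k = n - 1\<close> and have
      length at most \<open>n\<close>, so their length was exactly \<open>n\<close> and grows by
      one.\<close>
    define p' where "p' i = (if i \<in> g ` C n then Suc n else p i)" for i
    define A' where "A' i j = (if j = n then inv_into (C n) g i else A i j)" for i j
    have p': "n < p' i \<longleftrightarrow> i \<in> g ` C n" for i using p[of i] by (auto simp: p'_def)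
    have p'n: "j < p' i \<longleftrightarrow> j < p i" if "j < n" for i j
    proof (cases "i \<in> g ` C n")
      case True
      then have "k < p i" using g(2) by blast
      then have "p i = n" using p[of i] k by simp
      then show ?thesis using True that by (simp add: p'_def)
    qed (simp add: p'_def)
    have p'le: "p' i \<le> Suc n" for i using p[of i] by (simp add: p'_def)
    have A'n: "A' i n \<in> C n" "g (A' i n) = i" if "n < p' i" for i
      using that unfolding p' by (auto simp: A'_def f_inv_into_f inv_into_into)
    have A'g: "A' (g d) n = d" if "d \<in> C n" for d using that g(1) by (simp add: A'_def)
    have A'j: "A' i j = A i j" if "j < n" for i j using that by (simp add: A'_def)
    have coln: "column p' A' n = C n"
      using A'n(1) A'g p' by (force simp: column_def image_iff)
    have colj: "column p' A' j = column p A j" if "j < n" for j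
      using p'n[OF that] A'j[OF that] by (simp add: column_def)
    have arr': "arrangement p' A'"
      unfolding arrangement_def
    proof (intro conjI allI impI)
      have "{i. 0 < p' i} = {i. 0 < p i}" using p'n[of 0] False by simp
      then show "finite {i. 0 < p' i}" using finite_rows[OF arr, of 0] by simp
      fix i j
      show "0 < A' i j" if "j < p' i"
      proof (cases "j = n")
        case True
        then show ?thesis using A'n(1)[of i] that C(2)[of n] by auto
      next
        case jn: False
        then have "j < n" using that p'le[of i] by simp
        then show ?thesis using arr that by (simp add: A'j p'n arrangement_def)
      qed
      show "A' i (Suc j) \<le> A' i j" if "Suc j < p' i"
      proof (cases "Suc j = n")
        case True
        then have "j = k" using k by simp
        then show ?thesis using g(3) A'n[of i] A'j[of k i] True that k by force
      next
        case jn: False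
        then have "Suc j < n" using that p'le[of i] by simp
        then show ?thesis using arr that by (simp add: A'j p'n arrangement_def)
      qed
      show "inj_on (\<lambda>i. A' i j) {i. j < p' i}"
      proof (cases "j < n")
        case True
        then show ?thesis using arr by (simp add: A'j p'n arrangement_def)
      next
        case jn: False
        show ?thesis
        proof (cases "j = n")
          case True
          then show ?thesis by (intro inj_onI) (metis A'n(2) mem_Collect_eq)
        next
          case False
          then have "\<not> j < p' i" for i using jn p'le[of i] by simp
          then have "{i. j < p' i} = {}" by simp
          then show ?thesis by simp
        qed
      qed
    qed
    have gr': "greedy p' A'"
      unfolding greedy_def
    proof (intro conjI allI impI)
      fix i assume "0 < p' i"
      then show "A' i 0 = i" using False p'n[of 0 i] gr by (simp add: A'j greedy_def)
    next
      fix j i i' assume h: "i < i' \<and> j < p' i \<and> Suc j < p' i'"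
      have "Suc j \<le> n" using h p'le[of i'] by simp
      show "A' i j < A' i' (Suc j) \<or> Suc j < p' i \<and> A' i' (Suc j) < A' i (Suc j)"
      proof (cases "Suc j = n")
        case True
        then have jk: "j = k" using k by simp
        have i: "i \<in> ?R" using h p'n[of k i] k jk by simp
        have i': "A' i' n \<in> C n" "g (A' i' n) = i'" using h True A'n by auto
        then have "A i k < A' i' n \<or> (\<exists>d'\<in>C n. A' i' n < d' \<and> g d' = i)"
          using bspec[OF bspec[OF g(4) i'(1)] i] h unfolding i'(2) by blast
        then show ?thesis
        proof
          assume "A i k < A' i' n"
          then have "A' i j < A' i' (Suc j)" using True jk k A'j[of k i] by simp
          then show ?thesis ..
        next
          assume "\<exists>d'\<in>C n. A' i' n < d' \<and> g d' = i"
          then have "n < p' i" "A' i' n < A' i n" using A'g p' by auto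
          then show ?thesis using True by simp
        qed
      next
        case jn: False
        then have "Suc j < n" using \<open>Suc j \<le> n\<close> by simp
        then have "j < n" by simp
        have "A i j < A i' (Suc j) \<or> Suc j < p i \<and> A i' (Suc j) < A i (Suc j)"
          using h p'n[OF \<open>j < n\<close>] p'n[OF \<open>Suc j < n\<close>] by (intro greedyD[OF gr]) auto
        then show ?thesis
          using p'n[OF \<open>Suc j < n\<close>] A'j[OF \<open>j < n\<close>] A'j[OF \<open>Suc j < n\<close>] by simp
      qed
    qed
    have "\<forall>j<Suc n. column p' A' j = C j"
      using coln colj col by (auto simp: less_Suc_eq)
    with arr' gr' p'le show ?thesis by blast
  qed
qed

lemma greedy_exists:
  assumes cd: "(C, U) \<in> coldata"
  shows "\<exists>p A. arrangement p A \<and> greedy p A \<and> column p A = C"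
proof -
  obtain n where n: "\<And>j. n \<le> j \<Longrightarrow> C j = {}" using cd by (auto simp: coldata_def)
  obtain p A where *: "arrangement p A" "greedy p A" "\<And>i. p i \<le> n" "\<And>j. j < n \<Longrightarrow> column p A j = C j"
    using greedy_exists_aux[OF cd, of n] by blast
  have "column p A j = C j" for j
  proof (cases "j < n")
    case False
    then have "\<not> j < p i" for i using *(3)[of i] by simp
    then show ?thesis using n[of j] False by (simp add: column_def)
  qed (rule *(4))
  then show ?thesis using * by blast
qed

section \<open>Skyline fillings\<close>

text \<open>Extension by 0 removes the dependence on trailing zeros, so that shapes can be compared
  as functions.\<close>

definition row_length :: "nat list \<Rightarrow> nat \<Rightarrow> nat" where
  "row_length \<gamma> i = (if 1 \<le> i \<and> i \<le> length \<gamma> then part \<gamma> i else 0)"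

lemma mem_diagram [simp]: "(i, Suc j) \<in> diagram \<gamma> \<longleftrightarrow> j < row_length \<gamma> i"
  by (auto simp: diagram_def row_length_def)

lemma not_mem_diagram_0 [simp]: "(i, 0) \<notin> diagram \<gamma>"
  by (simp add: diagram_def)

lemma mem_basement [simp]: "(i, j) \<in> basement \<gamma> \<longleftrightarrow> 1 \<le> i \<and> i \<le> length \<gamma> \<and> j = 0"
  by (auto simp: basement_def)

lemma row_length_pos: "0 < row_length \<gamma> i \<Longrightarrow> 1 \<le> i \<and> i \<le> length \<gamma>"
  by (auto simp: row_length_def split: if_splits)

lemma finite_row_length: "finite {i. j < row_length \<gamma> i}"
  by (rule finite_subset[of _ "{..length \<gamma>}"]) (auto simp: row_length_def)

lemma diagram_eq: "diagram \<gamma> = (\<lambda>(i, j). (i, Suc j)) ` (SIGMA i:{i. 0 < row_length \<gamma> i}. {..<row_length \<gamma> i})"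
proof (intro equalityI subsetI)
  fix b assume b: "b \<in> diagram \<gamma>"
  obtain i k where ik: "b = (i, k)" by (cases b)
  then obtain j where "k = Suc j" using b by (cases k) auto
  then show "b \<in> (\<lambda>(i, j). (i, Suc j)) ` (SIGMA i:{i. 0 < row_length \<gamma> i}. {..<row_length \<gamma> i})"
    using b ik by force
qed auto

lemma finite_diagram: "finite (diagram \<gamma>)"
  unfolding diagram_eq using finite_row_length[of 0] by auto

text \<open>The triple conditions for the anchors \<open>a i k\<close> of the boxes \<open>(i, k)\<close>, including the basement.\<close>

definition triples :: "nat \<Rightarrow> (nat \<Rightarrow> nat) \<Rightarrow> (nat \<Rightarrow> nat \<Rightarrow> nat) \<Rightarrow> bool" where
  "triples N p a \<longleftrightarrow> (\<forall>i j k. 1 \<le> i \<and> i < j \<and> j \<le> N \<longrightarrow>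
    (p j \<le> p i \<and> k < p j \<longrightarrow> inversion_triple (a i (Suc k)) (a j (Suc k)) (a i k)) \<and>
    (p i < p j \<and> k \<le> p i \<longrightarrow> inversion_triple (a j (Suc k)) (a i k) (a j k)))"

lemma triplesD:
  assumes "triples N p a" "1 \<le> i" "i < j" "j \<le> N"
  shows "p j \<le> p i \<Longrightarrow> k < p j \<Longrightarrow> inversion_triple (a i (Suc k)) (a j (Suc k)) (a i k)"
    "p i < p j \<Longrightarrow> k \<le> p i \<Longrightarrow> inversion_triple (a j (Suc k)) (a i k) (a j k)"
  using assms by (auto simp: triples_def)

text \<open>The existence of the three boxes becomes an inequality for \<open>k\<close>. The bound
  in type B is weak because \<open>(i, k)\<close> may be the last box of row \<open>i\<close>, or
  its basement box if the row is empty.\<close>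

lemma inversion_triples_iff:
  "inversion_triples \<gamma> F \<longleftrightarrow> triples (length \<gamma>) (row_length \<gamma>) (\<lambda>i k. anchor F (i, k))"
proof -
  have E: "(i, k) \<in> diagram \<gamma> \<union> basement \<gamma> \<longleftrightarrow> 1 \<le> i \<and> i \<le> length \<gamma> \<and> k \<le> row_length \<gamma> i" for i k
    using row_length_pos[of \<gamma> i] by (cases k) auto
  have part: "part \<gamma> i = row_length \<gamma> i" if "1 \<le> i" "i \<le> length \<gamma>" for i
    using that by (simp add: row_length_def)
  show ?thesis
    unfolding inversion_triples_def triples_def Let_def
  proof (intro all_cong1 imp_cong[OF refl])
    fix i j k assume h: "1 \<le> i \<and> i < j \<and> j \<le> length \<gamma>"
    have "part \<gamma> j \<le> part \<gamma> i \<and> {(i, k), (i, k + 1), (j, k + 1)} \<subseteq> diagram \<gamma> \<union> basement \<gamma> \<longleftrightarrow>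
        row_length \<gamma> j \<le> row_length \<gamma> i \<and> k < row_length \<gamma> j"
      unfolding insert_subset E using part[of i] part[of j] h by auto
    moreover have "part \<gamma> i < part \<gamma> j \<and> {(i, k), (j, k), (j, k + 1)} \<subseteq> diagram \<gamma> \<union> basement \<gamma> \<longleftrightarrow>
        row_length \<gamma> i < row_length \<gamma> j \<and> k \<le> row_length \<gamma> i"
      unfolding insert_subset E using part[of i] part[of j] h by auto
    ultimately show "((part \<gamma> j \<le> part \<gamma> i \<and> {(i, k), (i, k + 1), (j, k + 1)} \<subseteq> diagram \<gamma> \<union> basement \<gamma> \<longrightarrow>
          inversion_triple (anchor F (i, k + 1)) (anchor F (j, k + 1)) (anchor F (i, k))) \<and>
        (part \<gamma> i < part \<gamma> j \<and> {(i, k), (j, k), (j, k + 1)} \<subseteq> diagram \<gamma> \<union> basement \<gamma> \<longrightarrow>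
          inversion_triple (anchor F (j, k + 1)) (anchor F (i, k)) (anchor F (j, k)))) \<longleftrightarrow>
       ((row_length \<gamma> j \<le> row_length \<gamma> i \<and> k < row_length \<gamma> j \<longrightarrow>
          inversion_triple (anchor F (i, Suc k)) (anchor F (j, Suc k)) (anchor F (i, k))) \<and>
        (row_length \<gamma> i < row_length \<gamma> j \<and> k \<le> row_length \<gamma> i \<longrightarrow>
          inversion_triple (anchor F (j, Suc k)) (anchor F (i, k)) (anchor F (j, k))))"
      by (metis Suc_eq_plus1)
  qed
qed

text \<open>If the anchor of \<open>(i, 1)\<close> were some \<open>h < i\<close>, it would equal
  the basement entry of row \<open>h\<close>, and the triple of rows \<open>h\<close> and
  \<open>i\<close> at \<open>k = 0\<close> would fail in both types. After that, type A triples are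
  the greedy condition itself, while type B triples give it by following the two rows from the
  basement.\<close>

lemma triples_imp_greedy:
  assumes a0: "\<And>i. 1 \<le> i \<Longrightarrow> i \<le> N \<Longrightarrow> a i 0 = i"
    and row: "\<And>i k. k < p i \<Longrightarrow> a i (Suc k) \<le> a i k"
    and pos: "\<And>i. 0 < p i \<Longrightarrow> 1 \<le> i \<and> i \<le> N \<and> 0 < a i (Suc 0)"
    and tr: "triples N p a"
  shows "greedy p (\<lambda>i j. a i (Suc j))"
proof -
  have first: "a i (Suc 0) = i" if i: "0 < p i" for i
  proof (rule ccontr)
    assume neq: "a i (Suc 0) \<noteq> i"
    define h where "h = a i (Suc 0)"
    have "h < i" using row[OF i] a0 pos[OF i] neq by (simp add: h_def)
    have h1: "1 \<le> h" "i \<le> N" using pos[OF i] by (auto simp: h_def)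
    show False
    proof (cases "p i \<le> p h")
      case True
      then have "inversion_triple (a h (Suc 0)) (a i (Suc 0)) (a h 0)"
        using triplesD(1)[OF tr h1(1) \<open>h < i\<close> h1(2)] i by simp
      moreover have "a h (Suc 0) \<le> a h 0" using row[of 0 h] True i by simp
      ultimately show False using a0[of h] h1 \<open>h < i\<close> by (auto simp: inversion_triple_def h_def)
    next
      case False
      then have "inversion_triple (a i (Suc 0)) (a h 0) (a i 0)"
        using triplesD(2)[OF tr h1(1) \<open>h < i\<close> h1(2)] by simp
      then show False using a0[of h] a0[of i] pos[OF i] h1 \<open>h < i\<close>
        by (auto simp: inversion_triple_def h_def)
    qed
  qed
  have "a i (Suc j) < a i' (Suc (Suc j)) \<or> Suc j < p i \<and> a i' (Suc (Suc j)) < a i (Suc (Suc j))"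
    if h: "i < i'" "j < p i" "Suc j < p i'" for i i' j
  proof -
    have i: "1 \<le> i" "i' \<le> N" using pos[of i] pos[of i'] h by auto
    show ?thesis
    proof (cases "p i' \<le> p i")
      case True
      then have "inversion_triple (a i (Suc (Suc j))) (a i' (Suc (Suc j))) (a i (Suc j))"
        using triplesD(1)[OF tr i(1) h(1) i(2)] h by simp
      then show ?thesis using True h by (auto simp: inversion_triple_def)
    next
      case False
      then have lt: "p i < p i'" by simp
      \<comment> \<open>In type B the upper, shorter row stays below the next entry of the longer
        one. This starts with \<open>i < i'\<close> in the basement, and it excludes the alternative
        \<open>b > c\<close> in the next triple.\<close>
      have "k \<le> p i \<Longrightarrow> a i k < a i' (Suc k)" for k
      proof (induction k)
        case 0
        then show ?case using first[of i'] a0[of i] h i by simp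
      next
        case (Suc k)
        then have "a i (Suc k) < a i' (Suc k)" using row[of k i] by simp
        moreover have "inversion_triple (a i' (Suc (Suc k))) (a i (Suc k)) (a i' (Suc k))"
          using triplesD(2)[OF tr i(1) h(1) i(2) lt Suc.prems] .
        ultimately show ?case by (auto simp: inversion_triple_def)
      qed
      then show ?thesis using h by simp
    qed
  qed
  then show ?thesis using first by (auto simp: greedy_def)
qed

text \<open>Type A is immediate. For type B the inequality \<open>a i k < a j (Suc k)\<close> is
  proved from the right end of row \<open>i\<close> backwards: where the row ends, only the first
  greedy alternative is possible, and the inequality in one column excludes the second alternative
  in the column before.\<close>

lemma greedy_imp_triples:
  assumes a0: "\<And>i. 1 \<le> i \<Longrightarrow> i \<le> N \<Longrightarrow> a i 0 = i"
    and row: "\<And>i k. k < p i \<Longrightarrow> a i (Suc k) \<le> a i k"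
    and g: "greedy p (\<lambda>i j. a i (Suc j))"
  shows "triples N p a"
proof -
  have first: "a i (Suc 0) = i" if "0 < p i" for i
    using g that by (simp add: greedy_def)
  have next_column: "a i (Suc j) < a i' (Suc (Suc j)) \<or> Suc j < p i \<and> a i' (Suc (Suc j)) < a i (Suc (Suc j))"
    if "i < i'" "j < p i" "Suc j < p i'" for i i' j
    using greedyD[OF g that] .
  show ?thesis
    unfolding triples_def
  proof (intro allI impI conjI)
    fix i j k assume ij: "1 \<le> i \<and> i < j \<and> j \<le> N"
    {
      assume k: "p j \<le> p i \<and> k < p j"
      have "a i (Suc k) \<le> a i k" using row[of k i] k by simp
      moreover have "a i k < a j (Suc k) \<or> a j (Suc k) < a i (Suc k)"
      proof (cases k)
        case 0
        then show ?thesis using first[of j] k ij a0[of i] by simp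
      next
        case (Suc l)
        then show ?thesis using next_column[of i j l] k ij by auto
      qed
      ultimately show "inversion_triple (a i (Suc k)) (a j (Suc k)) (a i k)"
        by (auto simp: inversion_triple_def)
    next
      assume k: "p i < p j \<and> k \<le> p i"
      have "a i k < a j (Suc k)"
        using conjunct2[OF k]
      proof (induction k rule: inc_induct)
        case base
        show ?case
        proof (cases "p i")
          case 0
          then show ?thesis using first[of j] k ij a0[of i] by simp
        next
          case (Suc l)
          then show ?thesis using next_column[of i j l] k ij by auto
        qed
      next
        case (step n)
        have lt: "a i (Suc n) < a j (Suc n)" using step.IH row[of "Suc n" j] step.hyps k by simp
        show ?case
        proof (cases n)
          case 0
          then show ?thesis using first[of j] k ij a0[of i] by simp
        next
          case (Suc l)
          then show ?thesis using next_column[of i j l] lt k ij step.hyps by auto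
        qed
      qed
      moreover have "a j (Suc k) \<le> a j k" using row[of k j] k by simp
      ultimately show "inversion_triple (a j (Suc k)) (a i k) (a j k)"
        by (auto simp: inversion_triple_def)
    }
  qed
qed

lemma set_ge_iff: "finite A \<Longrightarrow> A \<noteq> {} \<Longrightarrow> set_ge A B \<longleftrightarrow> (\<forall>x\<in>A. Max B \<le> x)"
  by (simp add: set_ge_def)

lemma sky_filling_iff:
  "sky_filling \<gamma> F \<longleftrightarrow>
    (\<forall>i j. if j < row_length \<gamma> i then is_entry_set (F (i, Suc j)) else F (i, Suc j) = {}) \<and>
    (\<forall>i. F (i, 0) = (if 1 \<le> i \<and> i \<le> length \<gamma> then {i} else {}))" (is "_ \<longleftrightarrow> ?H \<and> ?B")
proof
  assume F: "sky_filling \<gamma> F"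
  have D: "is_entry_set (F b)" if "b \<in> diagram \<gamma>" for b using F that by (simp add: sky_filling_def)
  have B: "F (i, 0) = {i}" if "1 \<le> i" "i \<le> length \<gamma>" for i
  proof -
    have "\<forall>b\<in>basement \<gamma>. case b of (i, j) \<Rightarrow> F (i, j) = {i}" using F by (simp add: sky_filling_def)
    then show ?thesis using that by (auto dest: bspec[of _ _ "(i, 0)"])
  qed
  have E: "F b = {}" if "b \<notin> diagram \<gamma>" "b \<notin> basement \<gamma>" for b
    using F that unfolding sky_filling_def by blast
  show "?H \<and> ?B"
  proof (intro conjI allI)
    show "if j < row_length \<gamma> i then is_entry_set (F (i, Suc j)) else F (i, Suc j) = {}" for i j
      using D[of "(i, Suc j)"] E[of "(i, Suc j)"] by simp
    show "F (i, 0) = (if 1 \<le> i \<and> i \<le> length \<gamma> then {i} else {})" for i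
      using B[of i] E[of "(i, 0)"] by auto
  qed
next
  assume HB: "?H \<and> ?B"
  show "sky_filling \<gamma> F"
    unfolding sky_filling_def
  proof (intro conjI ballI allI impI)
    fix b assume "b \<in> diagram \<gamma>"
    moreover obtain i k where "b = (i, k)" by (cases b)
    ultimately show "is_entry_set (F b)" using HB by (cases k) (auto split: if_splits)
  next
    fix b assume "b \<in> basement \<gamma>"
    then show "case b of (i, j) \<Rightarrow> F (i, j) = {i}" using HB by auto
  next
    fix b assume "b \<notin> diagram \<gamma> \<union> basement \<gamma>"
    moreover obtain i k where "b = (i, k)" by (cases b)
    ultimately show "F b = {}" using HB by (cases k) auto
  qed
qed

lemma can_be_free_iff:
  "can_be_free \<gamma> F x (i, Suc j) \<longleftrightarrow> i \<in> allowed_rows (row_length \<gamma>) (\<lambda>i j. Max (F (i, Suc j))) j x"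
  by (auto simp: can_be_free_def allowed_rows_def anchor_def)

lemma SetSkyFill_imp:
  assumes "F \<in> SetSkyFill \<gamma>"
  shows "pick_filling Min (row_length \<gamma>) (\<lambda>i j. F (i, Suc j))"
    and "greedy (row_length \<gamma>) (\<lambda>i j. Max (F (i, Suc j)))"
proof -
  let ?p = "row_length \<gamma>" and ?A = "\<lambda>i j. Max (F (i, Suc j))"
  have sky: "sky_filling \<gamma> F" and dist: "distinct_columns \<gamma> F" and dec: "decreasing_rows \<gamma> F"
    and inv: "inversion_triples \<gamma> F" and free: "free_entries_highest \<gamma> F"
    using assms by (auto simp: SetSkyFill_def)
  have es: "if j < ?p i then is_entry_set (F (i, Suc j)) else F (i, Suc j) = {}" for i j
    using sky unfolding sky_filling_iff by blast
  have base: "F (i, 0) = {i}" if "1 \<le> i" "i \<le> length \<gamma>" for i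
    using sky that unfolding sky_filling_iff by auto
  have fin: "finite (F (i, Suc j))" "F (i, Suc j) \<noteq> {}" "F (i, Suc j) \<subseteq> {1..}" if "j < ?p i" for i j
    using es[of j i] that by (auto simp: is_entry_set_def)
  have mx: "?A i j \<in> F (i, Suc j)" if "j < ?p i" for i j
    using fin[OF that] by (intro Max_in)
  have row: "Max (F (i, Suc k)) \<le> Max (F (i, k))" if "k < ?p i" for i k
  proof -
    have "finite (F (i, k)) \<and> F (i, k) \<noteq> {}"
      using fin[of "k - 1" i] base[of i] row_length_pos[of \<gamma> i] that by (cases k) auto
    moreover have "set_ge (F (i, k)) (F (i, Suc k))"
      using dec that by (simp add: decreasing_rows_def)
    ultimately show ?thesis by (auto simp: set_ge_iff dest: bspec[OF _ Max_in])
  qed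
  have disj: "i = i'" if "x \<in> F (i, Suc j)" "x \<in> F (i', Suc j)" for x i i' j
  proof (rule ccontr)
    assume "i \<noteq> i'"
    moreover have "j < ?p i" "j < ?p i'" using es[of j i] es[of j i'] that by (auto split: if_splits)
    ultimately have "F (i, Suc j) \<inter> F (i', Suc j) = {}"
      using dist by (simp add: distinct_columns_def)
    then show False using that by blast
  qed
  have arr: "arrangement ?p ?A"
    unfolding arrangement_def
  proof (intro conjI allI impI)
    show "finite {i. 0 < ?p i}" by (rule finite_row_length)
    show "0 < ?A i j" if "j < ?p i" for i j using mx[OF that] fin(3)[OF that] by force
    show "?A i (Suc j) \<le> ?A i j" if "Suc j < ?p i" for i j using row[OF that] .
    show "inj_on (\<lambda>i. ?A i j) {i. j < ?p i}" for j
      using mx disj by (intro inj_onI) (metis mem_Collect_eq)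
  qed
  show "pick_filling Min ?p (\<lambda>i j. F (i, Suc j))"
    unfolding pick_filling_def
  proof (intro conjI allI ballI impI)
    fix i j x assume x: "x \<in> F (i, Suc j)" "x \<noteq> ?A i j"
    then have i: "j < ?p i" using es[of j i] by (auto split: if_splits)
    show "x \<notin> column ?p ?A j"
    proof
      assume "x \<in> column ?p ?A j"
      then obtain i' where i': "j < ?p i'" "x = ?A i' j" unfolding column_def by blast
      then have "x \<in> F (i', Suc j)" using mx[OF i'(1)] by simp
      then have "i = i'" by (rule disj[OF x(1)])
      then show False using i'(2) x(2) by simp
    qed
    have "can_be_free \<gamma> F x (i, Suc j) \<and> (\<forall>i'<i. \<not> can_be_free \<gamma> F x (i', Suc j))"
      using bspec[OF free[unfolded free_entries_highest_def], of "(i, Suc j)"] x i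
      by (simp add: anchor_def)
    then have *: "i \<in> allowed_rows ?p ?A j x" "\<forall>i'<i. i' \<notin> allowed_rows ?p ?A j x"
      unfolding can_be_free_iff by blast+
    then show "i \<in> allowed_rows ?p ?A j x" by simp
    show "i = Min (allowed_rows ?p ?A j x)"
    proof (rule Min_eqI[symmetric])
      show "i \<le> i'" if "i' \<in> allowed_rows ?p ?A j x" for i'
        using *(2) that by (meson not_less)
    qed (rule finite_allowed_rows[OF arr], rule *(1))
  qed (use es arr in auto)
  have "greedy ?p (\<lambda>i j. anchor F (i, Suc j))"
  proof (rule triples_imp_greedy[where N = "length \<gamma>" and a = "\<lambda>i k. anchor F (i, k)"])
    show "anchor F (i, 0) = i" if "1 \<le> i" "i \<le> length \<gamma>" for i
      using base[OF that] by (simp add: anchor_def)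
    show "anchor F (i, Suc k) \<le> anchor F (i, k)" if "k < ?p i" for i k
      using row[OF that] by (simp add: anchor_def)
    show "1 \<le> i \<and> i \<le> length \<gamma> \<and> 0 < anchor F (i, Suc 0)" if "0 < ?p i" for i
      using row_length_pos[OF that] arr that by (simp add: anchor_def arrangement_def)
    show "triples (length \<gamma>) ?p (\<lambda>i k. anchor F (i, k))"
      using inv by (simp add: inversion_triples_iff)
  qed
  then show "greedy ?p ?A" by (simp add: anchor_def)
qed

text \<open>The row condition is recovered in two halves, for anchors from
  \<open>arrangement\<close> and for free entries from \<open>allowed_rows\<close>. Against the
  basement it holds because the first anchor of row \<open>i\<close> is \<open>i\<close>.\<close>

lemma SetSkyFillI:
  assumes pf: "pick_filling Min (row_length \<gamma>) (\<lambda>i j. F (i, Suc j))"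
    and gr: "greedy (row_length \<gamma>) (\<lambda>i j. Max (F (i, Suc j)))"
    and base: "\<And>i. F (i, 0) = (if 1 \<le> i \<and> i \<le> length \<gamma> then {i} else {})"
  shows "F \<in> SetSkyFill \<gamma>"
proof -
  let ?p = "row_length \<gamma>" and ?A = "\<lambda>i j. Max (F (i, Suc j))"
  have es: "if j < ?p i then is_entry_set (F (i, Suc j)) else F (i, Suc j) = {}" for i j
    using pf unfolding pick_filling_def by blast
  have arr: "arrangement ?p ?A" using pf by (simp add: pick_filling_def)
  have fin: "finite (F (i, Suc j))" "F (i, Suc j) \<noteq> {}" "F (i, Suc j) \<subseteq> {1..}" if "j < ?p i" for i j
    using es[of j i] that by (auto simp: is_entry_set_def)
  have free: "x \<notin> column ?p ?A j" "i \<in> allowed_rows ?p ?A j x" "i = Min (allowed_rows ?p ?A j x)"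
    if "x \<in> F (i, Suc j)" "x \<noteq> ?A i j" for x i j
    using pf that unfolding pick_filling_def by blast+
  have le: "x \<le> ?A i j" if "x \<in> F (i, Suc j)" for x i j
    using pick_filling_row_le(2)[OF pf that] .
  have inside: "j < ?p i" if "x \<in> F (i, Suc j)" for x i j
    using pick_filling_row_le(1)[OF pf that] .
  have first: "?A i 0 = i" if "0 < ?p i" for i using gr that by (simp add: greedy_def)
  have "sky_filling \<gamma> F" unfolding sky_filling_iff using es base by simp
  moreover have "distinct_columns \<gamma> F"
    unfolding distinct_columns_def
  proof (intro allI impI)
    fix i i' k assume h: "i \<noteq> i' \<and> (i, k) \<in> diagram \<gamma> \<and> (i', k) \<in> diagram \<gamma>"
    then obtain j where j: "k = Suc j" by (cases k) auto
    show "F (i, k) \<inter> F (i', k) = {}"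
    proof (rule ccontr)
      assume "F (i, k) \<inter> F (i', k) \<noteq> {}"
      then obtain x where x: "x \<in> F (i, Suc j)" "x \<in> F (i', Suc j)" using j by blast
      then show False using pick_filling_disjoint[OF pf] h by blast
    qed
  qed
  moreover have "decreasing_rows \<gamma> F"
    unfolding decreasing_rows_def
  proof (intro allI impI)
    fix i k assume "(i, k + 1) \<in> diagram \<gamma>"
    then have k: "k < ?p i" by simp
    show "set_ge (F (i, k)) (F (i, k + 1))"
    proof (cases k)
      case 0
      then show ?thesis using base[of i] row_length_pos[of \<gamma> i] k first[of i] by (simp add: set_ge_def)
    next
      case (Suc j)
      have "Max (F (i, Suc k)) \<le> x" if x: "x \<in> F (i, Suc j)" for x
      proof (cases "x = ?A i j")
        case True
        then show ?thesis using arrangement_row_le[OF arr, of j i] k Suc by simp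
      next
        case False
        then show ?thesis using free(2)[OF x False] k Suc by (simp add: allowed_rows_def)
      qed
      then show ?thesis using fin[of j i] k Suc by (simp add: set_ge_iff)
    qed
  qed
  moreover have "inversion_triples \<gamma> F"
    unfolding inversion_triples_iff
  proof (rule greedy_imp_triples)
    show "anchor F (i, 0) = i" if "1 \<le> i" "i \<le> length \<gamma>" for i
      using base[of i] that by (simp add: anchor_def)
    show "anchor F (i, Suc k) \<le> anchor F (i, k)" if "k < ?p i" for i k
    proof (cases k)
      case 0
      then show ?thesis using base[of i] row_length_pos[of \<gamma> i] that first[of i] by (simp add: anchor_def)
    next
      case (Suc j)
      then show ?thesis using arrangement_row_le[OF arr, of j i] that by (simp add: anchor_def)
    qed
    show "greedy ?p (\<lambda>i j. anchor F (i, Suc j))" using gr by (simp add: anchor_def)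
  qed
  moreover have "free_entries_highest \<gamma> F"
    unfolding free_entries_highest_def
  proof (intro ballI, clarify)
    fix i k x assume h: "(i, k) \<in> diagram \<gamma>" "x \<in> F (i, k)" "x \<noteq> anchor F (i, k)"
    then obtain j where j: "k = Suc j" by (cases k) auto
    then have x: "x \<in> F (i, Suc j)" "x \<noteq> ?A i j" using h by (auto simp: anchor_def)
    have "i' \<notin> allowed_rows ?p ?A j x" if "i' < i" for i'
      using free(3)[OF x] that Min_le[OF finite_allowed_rows[OF arr], of i' j x] by auto
    then show "can_be_free \<gamma> F x (i, k) \<and> (\<forall>i'<i. \<not> can_be_free \<gamma> F x (i', k))"
      using free(2)[OF x] unfolding j can_be_free_iff by blast
  qed
  ultimately show ?thesis by (simp add: SetSkyFill_def)
qed

lemma SetSkyFill_basement: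
  "F \<in> SetSkyFill \<gamma> \<Longrightarrow> F (i, 0) = (if 1 \<le> i \<and> i \<le> length \<gamma> then {i} else {})"
  unfolding SetSkyFill_def sky_filling_iff by auto

section \<open>Reverse tableaux\<close>

definition strict_columns :: "(nat \<Rightarrow> nat) \<Rightarrow> (nat \<Rightarrow> nat \<Rightarrow> nat) \<Rightarrow> bool" where
  "strict_columns p A \<longleftrightarrow> (\<forall>i i' j. i < i' \<and> j < p i \<and> j < p i' \<longrightarrow> A i' j < A i j)"

lemma row_length_antimono:
  assumes "\<mu> \<in> partitions" "1 \<le> i" "i \<le> i'"
  shows "row_length \<mu> i' \<le> row_length \<mu> i"
proof -
  have "\<mu> ! (i' - 1) \<le> \<mu> ! (i - 1)" if "i \<noteq> i'" "i' \<le> length \<mu>"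
    using assms that sorted_wrt_nth_less[of "(\<ge>)" \<mu> "i - 1" "i' - 1"] by (auto simp: partitions_def)
  then show ?thesis using assms by (cases "i = i'") (auto simp: row_length_def part_def)
qed

text \<open>All entries further down in a column are smaller than a free entry \<open>x\<close>, so
  no lower row can take it and its own row is the lowest allowed one.\<close>

lemma SetRT_imp:
  assumes \<mu>: "\<mu> \<in> partitions" and T: "T \<in> SetRT \<mu>"
  shows "pick_filling Max (row_length \<mu>) (\<lambda>i j. T (i, Suc j))"
    and "strict_columns (row_length \<mu>) (\<lambda>i j. Max (T (i, Suc j)))"
proof -
  let ?p = "row_length \<mu>" and ?A = "\<lambda>i j. Max (T (i, Suc j))"
  have es: "if j < ?p i then is_entry_set (T (i, Suc j)) else T (i, Suc j) = {}" for i j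
    using T by (auto simp: SetRT_def)
  have fin: "finite (T (i, Suc j))" "T (i, Suc j) \<noteq> {}" "T (i, Suc j) \<subseteq> {1..}" if "j < ?p i" for i j
    using es[of j i] that by (auto simp: is_entry_set_def)
  have mx: "?A i j \<in> T (i, Suc j)" if "j < ?p i" for i j
    using fin[OF that] by (intro Max_in)
  have inside: "j < ?p i" if "x \<in> T (i, Suc j)" for i j x
    using es[of j i] that by (auto split: if_splits)
  have row: "?A i (Suc j) \<le> x" if "x \<in> T (i, Suc j)" "Suc j < ?p i" for i j x
  proof -
    have "set_ge (T (i, Suc j)) (T (i, Suc (Suc j)))" using T that by (auto simp: SetRT_def)
    then show ?thesis using fin[of j i] that by (simp add: set_ge_iff)
  qed
  \<comment> \<open>Adjacent rows are chained together; since \<mu> is a partition, the boxes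
    between the two rows exist.\<close>
  have below: "?A i' j < x" if "x \<in> T (i, Suc j)" "i < i'" "j < ?p i'" for i i' j x
    using that(2,3)
  proof (induction i')
    case (Suc k)
    have i1: "1 \<le> i" using inside[OF that(1)] row_length_pos[of \<mu> i] by simp
    then have k: "j < ?p k" using row_length_antimono[OF \<mu>, of k "Suc k"] Suc.prems by simp
    have "set_gt (T (k, Suc j)) (T (Suc k, Suc j))" using T k Suc.prems by (auto simp: SetRT_def)
    then have *: "?A (Suc k) j < y" if "y \<in> T (k, Suc j)" for y
      using fin[OF k] that by (simp add: set_gt_def)
    show ?case
    proof (cases "i = k")
      case True
      then show ?thesis using * that(1) by simp
    next
      case False
      then have "?A k j < x" using Suc k by simp
      then show ?thesis using *[OF mx[OF k]] by simp
    qed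
  qed simp
  have arr: "arrangement ?p ?A"
    unfolding arrangement_def
  proof (intro conjI allI impI)
    show "finite {i. 0 < ?p i}" by (rule finite_row_length)
    show "0 < ?A i j" if "j < ?p i" for i j using mx[OF that] fin(3)[OF that] by force
    show "?A i (Suc j) \<le> ?A i j" if "Suc j < ?p i" for i j
      using row[OF mx that] that by simp
    show "inj_on (\<lambda>i. ?A i j) {i. j < ?p i}" for j
    proof (rule linorder_inj_onI)
      fix i i' assume "i < i'" "i \<in> {i. j < ?p i}" "i' \<in> {i. j < ?p i}"
      then show "?A i j \<noteq> ?A i' j" using below[OF mx[of j i], of i'] by simp
    qed auto
  qed
  show "strict_columns ?p ?A"
    unfolding strict_columns_def using below[OF mx] by blast
  show "pick_filling Max ?p (\<lambda>i j. T (i, Suc j))"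
    unfolding pick_filling_def
  proof (intro conjI allI ballI impI)
    fix i j x assume x: "x \<in> T (i, Suc j)" "x \<noteq> ?A i j"
    have i: "j < ?p i" using inside[OF x(1)] .
    have lt: "x < ?A i j" using Max_ge[OF fin(1)[OF i] x(1)] x(2) by linarith
    show "x \<notin> column ?p ?A j"
    proof
      assume "x \<in> column ?p ?A j"
      then obtain i' where i': "j < ?p i'" "x = ?A i' j" unfolding column_def by blast
      show False
      proof (rule linorder_cases[of i i'])
        assume "i < i'"
        then show False using below[OF x(1) _ i'(1)] i' by simp
      next
        assume "i' < i"
        then show False using below[OF mx[OF i'(1)] _ i] i' lt by simp
      qed (use i' x in simp)
    qed
    show al: "i \<in> allowed_rows ?p ?A j x"
      using i lt row[OF x(1)] by (simp add: allowed_rows_def)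
    show "i = Max (allowed_rows ?p ?A j x)"
    proof (rule Max_eqI[symmetric])
      fix i' assume "i' \<in> allowed_rows ?p ?A j x"
      then have "j < ?p i'" "x < ?A i' j" by (auto simp: allowed_rows_def)
      then show "i' \<le> i" using below[OF x(1), of i'] by (meson leI less_asym)
    qed (rule finite_allowed_rows[OF arr], rule al)
  qed (use es arr in auto)
qed

text \<open>The point is that a free entry \<open>x\<close> exceeds the anchor below it. The row
  below is not allowed, because \<open>x\<close> sits in the lowest allowed row. So either its
  anchor is at most \<open>x\<close>, and then smaller because \<open>x\<close> is no anchor, or its
  next anchor exceeds \<open>x\<close>; but that one is smaller than the next anchor in the row of
  \<open>x\<close>, which is at most \<open>x\<close>.\<close>

lemma SetRTI:
  assumes \<mu>: "\<mu> \<in> partitions"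
    and pf: "pick_filling Max (row_length \<mu>) (\<lambda>i j. T (i, Suc j))"
    and st: "strict_columns (row_length \<mu>) (\<lambda>i j. Max (T (i, Suc j)))"
    and base: "\<And>i. T (i, 0) = {}"
  shows "T \<in> SetRT \<mu>"
proof -
  let ?p = "row_length \<mu>" and ?A = "\<lambda>i j. Max (T (i, Suc j))"
  have es: "if j < ?p i then is_entry_set (T (i, Suc j)) else T (i, Suc j) = {}" for i j
    using pf unfolding pick_filling_def by blast
  have arr: "arrangement ?p ?A" using pf by (simp add: pick_filling_def)
  have fin: "finite (T (i, Suc j))" "T (i, Suc j) \<noteq> {}" if "j < ?p i" for i j
    using es[of j i] that by (auto simp: is_entry_set_def)
  have free: "x \<notin> column ?p ?A j" "i \<in> allowed_rows ?p ?A j x" "i = Max (allowed_rows ?p ?A j x)"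
    if "x \<in> T (i, Suc j)" "x \<noteq> ?A i j" for x i j
    using pf that unfolding pick_filling_def by blast+
  have row: "set_ge (T (i, Suc j)) (T (i, Suc (Suc j)))" if k: "Suc j < ?p i" for i j
  proof -
    have "?A i (Suc j) \<le> x" if x: "x \<in> T (i, Suc j)" for x
    proof (cases "x = ?A i j")
      case True
      then show ?thesis using arrangement_row_le[OF arr k] by simp
    next
      case False
      then show ?thesis using free(2)[OF x False] k by (simp add: allowed_rows_def)
    qed
    then show ?thesis using fin[of j i] k by (simp add: set_ge_iff)
  qed
  have col: "set_gt (T (i, Suc j)) (T (Suc i, Suc j))" if i: "j < ?p i" "j < ?p (Suc i)" for i j
  proof -
    have "?A (Suc i) j < x" if x: "x \<in> T (i, Suc j)" for x
    proof (cases "x = ?A i j")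
      case True
      then show ?thesis using st i by (simp add: strict_columns_def)
    next
      case False
      have "Suc i \<notin> allowed_rows ?p ?A j x"
        using free(3)[OF x False] Max_ge[OF finite_allowed_rows[OF arr], of "Suc i" j x] by auto
      then have "?A (Suc i) j \<le> x \<or> Suc j < ?p (Suc i) \<and> x < ?A (Suc i) (Suc j)"
        using i by (auto simp: allowed_rows_def)
      moreover have "?A (Suc i) (Suc j) \<le> x" if k: "Suc j < ?p (Suc i)"
      proof -
        have "?p (Suc i) \<le> ?p i" using row_length_pos[of \<mu> i] i by (intro row_length_antimono[OF \<mu>]) auto
        then have k': "Suc j < ?p i" using k by simp
        then have "?A (Suc i) (Suc j) < ?A i (Suc j)" using st k by (simp add: strict_columns_def)
        moreover have "?A i (Suc j) \<le> x" using free(2)[OF x False] k' by (simp add: allowed_rows_def)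
        ultimately show ?thesis by simp
      qed
      moreover have "x \<noteq> ?A (Suc i) j"
        using free(1)[OF x False] i by (auto simp: column_def)
      ultimately show ?thesis by fastforce
    qed
    then show ?thesis using fin[of j i] i by (simp add: set_gt_def)
  qed
  have D: "\<exists>i j. b = (i, Suc j) \<and> j < ?p i" if "b \<in> diagram \<mu>" for b
    using that by (cases b, cases "snd b") auto
  show ?thesis
    unfolding SetRT_def mem_Collect_eq
  proof (intro conjI allI ballI impI)
    fix b assume "b \<in> diagram \<mu>"
    then show "is_entry_set (T b)" using D[of b] es by (auto split: if_splits)
  next
    fix b assume b: "b \<notin> diagram \<mu>"
    obtain i k where ik: "b = (i, k)" by (cases b)
    show "T b = {}" using b es base unfolding ik by (cases k) auto
  next
    fix i k assume h: "(i, k) \<in> diagram \<mu> \<and> (i, k + 1) \<in> diagram \<mu>"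
    then obtain j where "k = Suc j" by (cases k) auto
    then show "set_ge (T (i, k)) (T (i, k + 1))" using row[of j i] h by simp
  next
    fix i k assume h: "(i, k) \<in> diagram \<mu> \<and> (i + 1, k) \<in> diagram \<mu>"
    then obtain j where "k = Suc j" by (cases k) auto
    then show "set_gt (T (i, k)) (T (i + 1, k))" using col[of j i] h by simp
  qed
qed

lemma SetRT_basement: "T \<in> SetRT \<mu> \<Longrightarrow> T (i, 0) = {}"
  by (simp add: SetRT_def)

text \<open>A strictly decreasing column is the enumeration of its set by rank.\<close>

lemma bij_betw_rank:
  fixes C :: "nat set"
  assumes "finite C"
  shows "bij_betw (\<lambda>c. card {d\<in>C. c \<le> d}) C {1..card C}"
proof -
  have mono: "card {d\<in>C. c' \<le> d} < card {d\<in>C. c \<le> d}" if "c \<in> C" "c < c'" for c c'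
  proof (rule psubset_card_mono)
    have "c \<in> {d\<in>C. c \<le> d} - {d\<in>C. c' \<le> d}" using that by simp
    moreover have "{d\<in>C. c' \<le> d} \<subseteq> {d\<in>C. c \<le> d}" using that by auto
    ultimately show "{d\<in>C. c' \<le> d} \<subset> {d\<in>C. c \<le> d}" by blast
  qed (use assms in simp)
  have inj: "inj_on (\<lambda>c. card {d\<in>C. c \<le> d}) C"
  proof (rule linorder_inj_onI)
    fix c c' assume "c < c'" "c \<in> C"
    then show "card {d\<in>C. c \<le> d} \<noteq> card {d\<in>C. c' \<le> d}" using mono[of c c'] by simp
  qed auto
  have "card {d\<in>C. c \<le> d} \<in> {1..card C}" if "c \<in> C" for c
  proof -
    have "0 < card {d\<in>C. c \<le> d}" using that assms by (auto simp: card_gt_0_iff)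
    moreover have "card {d\<in>C. c \<le> d} \<le> card C" using assms by (intro card_mono) auto
    ultimately show ?thesis by simp
  qed
  then have "(\<lambda>c. card {d\<in>C. c \<le> d}) ` C = {1..card C}"
    by (intro card_subset_eq) (auto simp: card_image[OF inj])
  with inj show ?thesis by (simp add: bij_betw_def)
qed

lemma row_length_partition:
  assumes "\<mu> \<in> partitions"
  shows "{i. j < row_length \<mu> i} = {1..card {i. j < row_length \<mu> i}}"
proof -
  let ?S = "{i. j < row_length \<mu> i}"
  have down: "i \<in> ?S" if "i' \<in> ?S" "1 \<le> i" "i \<le> i'" for i i'
    using row_length_antimono[OF assms that(2,3)] that(1) by simp
  have pos: "?S \<subseteq> {1..}" using row_length_pos[of \<mu>] by fastforce
  show ?thesis
  proof (cases "?S = {}")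
    case False
    have fin: "finite ?S" by (rule finite_row_length)
    have "?S = {1..Max ?S}"
    proof (intro equalityI subsetI)
      fix i assume "i \<in> ?S"
      then show "i \<in> {1..Max ?S}" using pos Max_ge[OF fin, of i] by auto
    next
      fix i assume "i \<in> {1..Max ?S}"
      then show "i \<in> ?S" by (intro down[OF Max_in[OF fin False]]) simp_all
    qed
    moreover from this have "card ?S = card {1..Max ?S}" by (rule arg_cong)
    then have "card ?S = Max ?S" by simp
    ultimately show ?thesis by (simp only:)
  qed simp
qed

lemma strict_columns_rank:
  assumes arr: "arrangement p A" and st: "strict_columns p A" and i: "j < p i"
    and p: "{i. j < p i} = {1..h}"
  shows "card {d \<in> column p A j. A i j \<le> d} = i"
proof -
  have "A i' j \<ge> A i j \<longleftrightarrow> i' \<le> i" if "j < p i'" for i'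
  proof
    assume "A i j \<le> A i' j"
    then have "\<not> i < i'" using st i that unfolding strict_columns_def by (meson leD)
    then show "i' \<le> i" by simp
  next
    assume "i' \<le> i"
    then show "A i j \<le> A i' j"
      using st i that unfolding strict_columns_def by (cases "i' = i") (simp, meson le_neq_implies_less less_imp_le)
  qed
  then have "{d \<in> column p A j. A i j \<le> d} = (\<lambda>i. A i j) ` {i'. j < p i' \<and> i' \<le> i}"
    unfolding column_def by blast
  moreover have "{i'. j < p i' \<and> i' \<le> i} = {1..i}"
  proof -
    have "j < p i' \<longleftrightarrow> 1 \<le> i' \<and> i' \<le> h" for i'
      using eqset_imp_iff[OF p, of i'] by simp
    note rows = this
    have "i \<le> h" using rows i by blast
    then show ?thesis unfolding rows by auto
  qed
  moreover have "inj_on (\<lambda>i. A i j) {1..i}"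
  proof (rule inj_on_subset[of _ "{i. j < p i}"])
    show "inj_on (\<lambda>i. A i j) {i. j < p i}" using arr by (simp add: arrangement_def)
    have "i \<in> {1..h}" using i p by blast
    then show "{1..i} \<subseteq> {i. j < p i}" unfolding p by auto
  qed
  ultimately show ?thesis by (simp add: card_image)
qed

lemma strict_columns_unique:
  assumes arr: "arrangement p A" "arrangement p A'" and st: "strict_columns p A" "strict_columns p A'"
    and col: "column p A = column p A'" and i: "j < p i" and p: "{i. j < p i} = {1..h}"
  shows "A i j = A' i j"
proof -
  have "card {d \<in> column p A j. A i j \<le> d} = card {d \<in> column p A j. A' i j \<le> d}"
    using strict_columns_rank[OF arr(1) st(1) i p] strict_columns_rank[OF arr(2) st(2) i p] col by simp
  moreover have "A i j \<in> column p A j" "A' i j \<in> column p A' j" using i by (auto simp: column_def)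
  ultimately show ?thesis
    using bij_betw_rank[OF finite_column[OF arr(1), of j]] col by (auto simp: bij_betw_def dest: inj_onD)
qed

text \<open>The element of rank \<open>i\<close>, counted from the largest, goes to row
  \<open>i\<close>. If the entry of row \<open>i\<close> increased from column \<open>j\<close> to
  an entry \<open>d\<close> of the next column, then by interlacing at least \<open>i\<close>
  elements of column \<open>j\<close> would be at least \<open>d\<close>, and the entry of row
  \<open>i\<close> would have rank greater than \<open>i\<close>.\<close>

lemma strict_columns_exists:
  assumes cd: "(C, U) \<in> coldata" and card: "\<And>j. card {i. j < p i} = card (C j)"
    and p: "\<And>j. {i. j < p i} = {1..card {i. j < p i}}"
  shows "\<exists>A. arrangement p A \<and> strict_columns p A \<and> column p A = C"
proof -
  let ?rk = "\<lambda>j c. card {d\<in>C j. c \<le> d}"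
  have fin: "finite (C j)" and pos: "C j \<subseteq> {1..}" for j
    using cd by (auto simp: coldata_def intro: finite_subset)
  have rows: "{i. j < p i} = {1..card (C j)}" for j using p[of j] card[of j] by simp
  have bij: "bij_betw (?rk j) (C j) {i. j < p i}" for j
    unfolding rows by (rule bij_betw_rank[OF fin])
  define A where "A i j = inv_into (C j) (?rk j) i" for i j
  have A: "A i j \<in> C j" "?rk j (A i j) = i" if "j < p i" for i j
  proof -
    have "i \<in> ?rk j ` C j" using bij[of j] that by (auto simp: bij_betw_def)
    then show "A i j \<in> C j" "?rk j (A i j) = i" unfolding A_def by (rule inv_into_into, rule f_inv_into_f)
  qed
  have Ark: "A (?rk j c) j = c" if "c \<in> C j" for c j
    using bij[of j] that unfolding A_def by (intro inv_into_f_f) (simp_all add: bij_betw_def)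
  have rk_mono: "?rk j c' \<le> ?rk j c" if "c \<le> c'" for j c c'
    using that fin by (intro card_mono) auto
  have col: "column p A j = C j" for j
  proof -
    have "c \<in> column p A j" if c: "c \<in> C j" for c
    proof -
      have "A (?rk j c) j \<in> column p A j"
        unfolding column_def by (rule imageI, rule bij_betw_apply[OF bij c])
      then show ?thesis by (simp only: Ark[OF c])
    qed
    moreover have "column p A j \<subseteq> C j" using A(1) unfolding column_def by blast
    ultimately show ?thesis by blast
  qed
  have "arrangement p A"
    unfolding arrangement_def
  proof (intro conjI allI impI)
    show "finite {i. 0 < p i}" using rows[of 0] by simp
    show "0 < A i j" if "j < p i" for i j using subsetD[OF pos A(1)[OF that]] by simp
    show "inj_on (\<lambda>i. A i j) {i. j < p i}" for j
    proof (rule inj_onI)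
      fix i i' assume h: "i \<in> {i. j < p i}" "i' \<in> {i. j < p i}" "A i j = A i' j"
      have 1: "?rk j (A i j) = i" "?rk j (A i' j) = i'" using A(2) h(1,2) by blast+
      show "i = i'" by (rule trans[OF 1(1)[symmetric, unfolded h(3)] 1(2)])
    qed
    show "A i (Suc j) \<le> A i j" if i: "Suc j < p i" for i j
    proof (rule ccontr)
      assume "\<not> ?thesis"
      then have lt: "A i j < A i (Suc j)" by simp
      have i': "j < p i" using i by simp
      have "A i (Suc j) \<noteq> 0" using subsetD[OF pos A(1)[OF i]] by simp
      then have "?rk (Suc j) (A i (Suc j)) \<le> ?rk j (A i (Suc j))"
        by (intro interlace_above_eq) (use cd in \<open>auto simp: coldata_def\<close>)
      also have "\<dots> < ?rk j (A i j)"
      proof (rule psubset_card_mono)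
        have "A i j \<in> {d\<in>C j. A i j \<le> d} - {d\<in>C j. A i (Suc j) \<le> d}" using lt A(1)[OF i'] by simp
        moreover have "{d\<in>C j. A i (Suc j) \<le> d} \<subseteq> {d\<in>C j. A i j \<le> d}" using lt by auto
        ultimately show "{d\<in>C j. A i (Suc j) \<le> d} \<subset> {d\<in>C j. A i j \<le> d}" by blast
      qed (use fin in simp)
      finally show False using A(2)[OF i] A(2)[OF i'] by simp
    qed
  qed
  moreover have "strict_columns p A"
    unfolding strict_columns_def
  proof (intro allI impI)
    fix i i' j assume h: "i < i' \<and> j < p i \<and> j < p i'"
    show "A i' j < A i j"
    proof (rule ccontr)
      assume "\<not> ?thesis"
      then have "?rk j (A i' j) \<le> ?rk j (A i j)" by (intro rk_mono) simp
      moreover have "?rk j (A i j) = i" "?rk j (A i' j) = i'" using A(2) h by blast+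
      ultimately show False using h by linarith
    qed
  qed
  ultimately show ?thesis using col by blast
qed

section \<open>Counting fillings by column data\<close>

lemma size_weight: "finite D \<Longrightarrow> size (weight D F) = num_entries D F"
  by (simp add: weight_def num_entries_def size_multiset_sum)

text \<open>All fillings of weight \<open>m\<close> have \<open>size m\<close> entries, so they
  contribute the same power of \<beta>, and only their number remains to be found.\<close>

lemma gen_series_eq:
  "gen_series \<gamma> \<F> m = monom (int (card {F \<in> \<F>. weight (diagram \<gamma>) F = m})) (size m - sum_list \<gamma>)"
proof -
  have "gen_series \<gamma> \<F> m = (\<Sum>F | F \<in> \<F> \<and> weight (diagram \<gamma>) F = m. monom 1 (size m - sum_list \<gamma>))"
    unfolding gen_series_def
    by (rule sum.cong) (auto simp flip: size_weight[OF finite_diagram])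
  then show ?thesis by (simp add: of_nat_monom mult_monom)
qed

text \<open>A letter occurs at most once in a column, by \<open>pick_filling_disjoint\<close>, so
  its occurrences correspond to the columns containing it.\<close>

lemma has_weight_pick_filling:
  assumes pf: "pick_filling pick (row_length \<gamma>) (\<lambda>i j. F (i, Suc j))"
  shows "has_weight (\<lambda>j. \<Union>i. F (i, Suc j)) m \<longleftrightarrow> weight (diagram \<gamma>) F = m"
proof -
  have fin: "finite (F b)" if "b \<in> diagram \<gamma>" for b
  proof -
    obtain i j where "b = (i, Suc j)" "j < row_length \<gamma> i"
      using \<open>b \<in> diagram \<gamma>\<close> unfolding diagram_eq by auto
    then show ?thesis using pick_filling_entry_set[OF pf, of j i] by (simp add: is_entry_set_def)
  qed
  have "count (weight (diagram \<gamma>) F) x = card {j. x \<in> (\<Union>i. F (i, Suc j))}" for x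
  proof -
    have "count (weight (diagram \<gamma>) F) x = (\<Sum>b\<in>diagram \<gamma>. if x \<in> F b then 1 else 0)"
      unfolding weight_def count_sum using fin by (intro sum.cong refl) (simp add: count_mset_set')
    also have "\<dots> = card {b \<in> diagram \<gamma>. x \<in> F b}"
      using finite_diagram by (simp add: sum.If_cases Int_def)
    also have "\<dots> = card {j. x \<in> (\<Union>i. F (i, Suc j))}"
    proof (rule bij_betw_same_card[of "\<lambda>b. snd b - 1"])
      show "bij_betw (\<lambda>b. snd b - 1) {b \<in> diagram \<gamma>. x \<in> F b} {j. x \<in> (\<Union>i. F (i, Suc j))}"
      proof (rule bij_betwI')
        fix b b' assume b: "b \<in> {b \<in> diagram \<gamma>. x \<in> F b}" "b' \<in> {b \<in> diagram \<gamma>. x \<in> F b}"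
        obtain i j i' j' where ij: "b = (i, Suc j)" "b' = (i', Suc j')"
          using b unfolding diagram_eq by auto
        then show "(snd b - 1 = snd b' - 1) = (b = b')"
          using pick_filling_disjoint[OF pf, of x i j i'] b by auto
      next
        fix b assume b: "b \<in> {b \<in> diagram \<gamma>. x \<in> F b}"
        obtain i j where ij: "b = (i, Suc j)"
          using b unfolding diagram_eq by auto
        then show "snd b - 1 \<in> {j. x \<in> (\<Union>i. F (i, Suc j))}" using b by auto
      next
        fix j assume "j \<in> {j. x \<in> (\<Union>i. F (i, Suc j))}"
        then obtain i where i: "x \<in> F (i, Suc j)" by blast
        have "j < row_length \<gamma> i" using pick_filling_row_le(1)[OF pf, of x i j] i by simp
        then show "\<exists>b\<in>{b \<in> diagram \<gamma>. x \<in> F b}. j = snd b - 1"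
          using i by (intro bexI[of _ "(i, Suc j)"]) auto
      qed
    qed
    finally show ?thesis .
  qed
  then show ?thesis by (auto simp: has_weight_def multiset_eq_iff)
qed

definition num_data :: "((nat \<Rightarrow> nat set) \<Rightarrow> bool) \<Rightarrow> nat multiset \<Rightarrow> nat" where
  "num_data R m = card {(C, U). (C, U) \<in> coldata \<and> has_weight U m \<and> R C}"

lemma num_data_cong:
  assumes "\<And>C U. (C, U) \<in> coldata \<Longrightarrow> R C \<longleftrightarrow> R' C"
  shows "num_data R m = num_data R' m"
  unfolding num_data_def by (rule arg_cong[where f = card]) (use assms in blast)

text \<open>Column \<open>Suc j\<close> of a filling is column \<open>j\<close> of the data, and
  column 0 is fixed as \<open>F0\<close>: the basement of a skyline filling, or empty for a reverse
  tableau.\<close>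

lemma card_fillings:
  fixes \<F> :: "filling set"
  assumes pick: "\<And>S. finite S \<Longrightarrow> S \<noteq> {} \<Longrightarrow> pick S \<in> S"
    and unique: "\<And>A A' i j. arrangement p A \<Longrightarrow> P A \<Longrightarrow> arrangement p A' \<Longrightarrow> P A' \<Longrightarrow>
      column p A = column p A' \<Longrightarrow> j < p i \<Longrightarrow> A i j = A' i j"
    and cong: "\<And>A A'. P A \<Longrightarrow> (\<And>i j. j < p i \<Longrightarrow> A i j = A' i j) \<Longrightarrow> P A'"
    and p: "p = row_length \<gamma>"
    and \<F>: "\<And>F. F \<in> \<F> \<longleftrightarrow> pick_filling pick p (\<lambda>i j. F (i, Suc j)) \<and>
      P (\<lambda>i j. Max (F (i, Suc j))) \<and> (\<forall>i. F (i, 0) = F0 i)"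
  shows "card {F \<in> \<F>. weight (diagram \<gamma>) F = m} =
    num_data (\<lambda>C. \<exists>A. arrangement p A \<and> P A \<and> column p A = C) m"
proof -
  let ?H = "\<lambda>F i j. F (i, Suc j) :: nat set"
  let ?f = "\<lambda>H. (column p (\<lambda>i j. Max (H i j)), \<lambda>j. \<Union>i. H i j)"
  have "bij_betw ?H \<F> {H. pick_filling pick p H \<and> P (\<lambda>i j. Max (H i j))}"
  proof (rule bij_betwI')
    fix F F' assume F: "F \<in> \<F>" "F' \<in> \<F>"
    show "(?H F = ?H F') = (F = F')"
    proof
      assume eq: "?H F = ?H F'"
      have "F (i, k) = F' (i, k)" for i k
        using F \<F> fun_cong[OF fun_cong[OF eq]] by (cases k) simp_all
      then show "F = F'" by auto
    qed simp
  next
    fix F assume "F \<in> \<F>"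
    then show "?H F \<in> {H. pick_filling pick p H \<and> P (\<lambda>i j. Max (H i j))}" using \<F> by simp
  next
    fix H assume H: "H \<in> {H. pick_filling pick p H \<and> P (\<lambda>i j. Max (H i j))}"
    define F where "F = (\<lambda>(i, k). case k of 0 \<Rightarrow> F0 i | Suc j \<Rightarrow> H i j)"
    have "?H F = H" by (simp add: F_def)
    moreover have "F \<in> \<F>" unfolding \<F> using H by (simp add: F_def)
    ultimately show "\<exists>F\<in>\<F>. H = ?H F" by metis
  qed
  moreover have "bij_betw ?f {H. pick_filling pick p H \<and> P (\<lambda>i j. Max (H i j))}
      {(C, U). (C, U) \<in> coldata \<and> (\<exists>A. arrangement p A \<and> P A \<and> column p A = C)}"
    by (rule bij_betw_pick_fillings) (fact pick, erule (5) unique, erule cong, simp)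
  ultimately have "bij_betw (?f \<circ> ?H) \<F>
      {(C, U). (C, U) \<in> coldata \<and> (\<exists>A. arrangement p A \<and> P A \<and> column p A = C)}"
    by (rule bij_betw_trans)
  then have "bij_betw (?f \<circ> ?H) {F \<in> \<F>. weight (diagram \<gamma>) F = m}
      {CU \<in> {(C, U). (C, U) \<in> coldata \<and> (\<exists>A. arrangement p A \<and> P A \<and> column p A = C)}.
        has_weight (snd CU) m}"
    by (rule bij_betw_Collect) (use \<F> p has_weight_pick_filling in auto)
  then have "card {F \<in> \<F>. weight (diagram \<gamma>) F = m} = card
      {CU \<in> {(C, U). (C, U) \<in> coldata \<and> (\<exists>A. arrangement p A \<and> P A \<and> column p A = C)}.
        has_weight (snd CU) m}"
    by (rule bij_betw_same_card)
  also have "\<dots> = num_data (\<lambda>C. \<exists>A. arrangement p A \<and> P A \<and> column p A = C) m"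
    unfolding num_data_def by (rule arg_cong[where f = card]) auto
  finally show ?thesis .
qed

definition has_shape :: "nat list \<Rightarrow> (nat \<Rightarrow> nat set) \<Rightarrow> bool" where
  "has_shape \<gamma> C \<longleftrightarrow> (\<exists>A. arrangement (row_length \<gamma>) A \<and> greedy (row_length \<gamma>) A \<and>
    column (row_length \<gamma>) A = C)"

lemma greedy_cong: "greedy p A \<Longrightarrow> (\<And>i j. j < p i \<Longrightarrow> A i j = A' i j) \<Longrightarrow> greedy p A'"
  unfolding greedy_def by (metis Suc_lessD)

lemma strict_columns_cong:
  "strict_columns p A \<Longrightarrow> (\<And>i j. j < p i \<Longrightarrow> A i j = A' i j) \<Longrightarrow> strict_columns p A'"
  unfolding strict_columns_def by simp

lemma lascoux_atom_eq:
  "lascoux_atom \<gamma> m = monom (int (num_data (has_shape \<gamma>) m)) (size m - sum_list \<gamma>)"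
proof -
  have "card {F \<in> SetSkyFill \<gamma>. weight (diagram \<gamma>) F = m} = num_data
    (\<lambda>C. \<exists>A. arrangement (row_length \<gamma>) A \<and> greedy (row_length \<gamma>) A \<and> column (row_length \<gamma>) A = C) m"
  proof (rule card_fillings[OF _ _ _ refl])
    show "Min S \<in> S" if "finite S" "S \<noteq> {}" for S :: "nat set" using that by (rule Min_in)
    show "A i j = A' i j"
      if "arrangement (row_length \<gamma>) A" "greedy (row_length \<gamma>) A" "arrangement (row_length \<gamma>) A'"
        "greedy (row_length \<gamma>) A'" "column (row_length \<gamma>) A = column (row_length \<gamma>) A'"
        "j < row_length \<gamma> i" for A A' i j
      using greedy_unique(2)[OF that(1,3,2,4,5,6)] .
    show "F \<in> SetSkyFill \<gamma> \<longleftrightarrow> pick_filling Min (row_length \<gamma>) (\<lambda>i j. F (i, Suc j)) \<and>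
        greedy (row_length \<gamma>) (\<lambda>i j. Max (F (i, Suc j))) \<and>
        (\<forall>i. F (i, 0) = (if 1 \<le> i \<and> i \<le> length \<gamma> then {i} else {}))" for F
      using SetSkyFill_imp SetSkyFillI SetSkyFill_basement by blast
  qed (rule greedy_cong)
  then show ?thesis
    unfolding lascoux_atom_def gen_series_eq has_shape_def by simp
qed

lemma grothendieck_eq:
  assumes \<mu>: "\<mu> \<in> partitions"
  shows "grothendieck \<mu> m =
    monom (int (num_data (\<lambda>C. \<forall>j. card (C j) = card {i. j < row_length \<mu> i}) m)) (size m - sum_list \<mu>)"
proof -
  let ?p = "row_length \<mu>"
  note rows = row_length_partition[OF \<mu>]
  have "card {T \<in> SetRT \<mu>. weight (diagram \<mu>) T = m} = num_data
    (\<lambda>C. \<exists>A. arrangement ?p A \<and> strict_columns ?p A \<and> column ?p A = C) m"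
  proof (rule card_fillings[OF _ _ _ refl])
    show "Max S \<in> S" if "finite S" "S \<noteq> {}" for S :: "nat set" using that by (rule Max_in)
    show "A i j = A' i j"
      if "arrangement ?p A" "strict_columns ?p A" "arrangement ?p A'" "strict_columns ?p A'"
        "column ?p A = column ?p A'" "j < ?p i" for A A' i j
      using strict_columns_unique[OF that(1,3,2,4,5,6) rows] .
    show "T \<in> SetRT \<mu> \<longleftrightarrow> pick_filling Max ?p (\<lambda>i j. T (i, Suc j)) \<and>
        strict_columns ?p (\<lambda>i j. Max (T (i, Suc j))) \<and> (\<forall>i. T (i, 0) = {})" for T
      using SetRT_imp[OF \<mu>] SetRTI[OF \<mu>] SetRT_basement by blast
  qed (rule strict_columns_cong)
  also have "\<dots> = num_data (\<lambda>C. \<forall>j. card (C j) = card {i. j < ?p i}) m"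
  proof (rule num_data_cong)
    fix C U assume cd: "(C, U) \<in> coldata"
    show "(\<exists>A. arrangement ?p A \<and> strict_columns ?p A \<and> column ?p A = C) \<longleftrightarrow>
        (\<forall>j. card (C j) = card {i. j < ?p i})"
    proof
      assume "\<exists>A. arrangement ?p A \<and> strict_columns ?p A \<and> column ?p A = C"
      then show "\<forall>j. card (C j) = card {i. j < ?p i}"
        by (auto simp: column_def arrangement_def card_image)
    next
      assume "\<forall>j. card (C j) = card {i. j < ?p i}"
      then show "\<exists>A. arrangement ?p A \<and> strict_columns ?p A \<and> column ?p A = C"
        using rows by (intro strict_columns_exists[OF cd]) auto
    qed
  qed
  finally show ?thesis unfolding grothendieck_def gen_series_eq by simp
qed

section \<open>Shapes of column data, and sums of atoms over sets of shapes\<close>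

lemma row_length_inj:
  assumes "\<gamma> \<in> weak_compositions" "\<delta> \<in> weak_compositions" "row_length \<gamma> = row_length \<delta>"
  shows "\<gamma> = \<delta>"
proof -
  have nth: "row_length \<gamma> (Suc k) = (if k < length \<gamma> then \<gamma> ! k else 0)" for \<gamma> k
    by (simp add: row_length_def part_def)
  have le: "length \<gamma> \<le> length \<delta>"
    if g: "\<gamma> \<in> weak_compositions" and eq: "row_length \<gamma> = row_length \<delta>" for \<gamma> \<delta>
  proof (rule ccontr)
    assume lt: "\<not> length \<gamma> \<le> length \<delta>"
    then have "\<gamma> \<noteq> []" by auto
    then have "0 < row_length \<gamma> (Suc (length \<gamma> - 1))"
      using g unfolding nth by (simp add: weak_compositions_def last_conv_nth)
    moreover have "row_length \<delta> (Suc (length \<gamma> - 1)) = 0"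
      using lt unfolding nth by auto
    ultimately show False using eq by simp
  qed
  have len: "length \<gamma> = length \<delta>" using le[of \<gamma> \<delta>] le[of \<delta> \<gamma>] assms by simp
  show ?thesis
  proof (rule nth_equalityI[OF len])
    fix k assume "k < length \<gamma>"
    then show "\<gamma> ! k = \<delta> ! k" using nth[of \<gamma> k] nth[of \<delta> k] assms(3) len by simp
  qed
qed

lemma row_length_surj:
  assumes "finite {i. 0 < p i}" "p 0 = 0"
  shows "\<exists>\<gamma>\<in>weak_compositions. row_length \<gamma> = p"
proof -
  define n where "n = Max (insert 0 {i. 0 < p i})"
  define \<gamma> where "\<gamma> = map (\<lambda>k. p (Suc k)) [0..<n]"
  have fin: "finite (insert 0 {i. 0 < p i})" using assms(1) by simp
  have n: "i \<le> n" if "0 < p i" for i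
    unfolding n_def using that by (intro Max_ge[OF fin]) simp
  have "n \<in> insert 0 {i. 0 < p i}" unfolding n_def by (rule Max_in[OF fin]) simp
  then have pn: "0 < p n" if "n \<noteq> 0" using that by simp
  have "\<gamma> \<in> weak_compositions"
    unfolding weak_compositions_def \<gamma>_def
    using pn by (auto simp: last_map)
  moreover have "row_length \<gamma> = p"
  proof
    fix i show "row_length \<gamma> i = p i"
      using n[of i] assms(2) by (cases i) (auto simp: row_length_def part_def \<gamma>_def)
  qed
  ultimately show ?thesis by blast
qed

definition shape_of :: "(nat \<Rightarrow> nat set) \<Rightarrow> nat list" where
  "shape_of C = (THE \<gamma>. \<gamma> \<in> weak_compositions \<and> has_shape \<gamma> C)"

lemma
  assumes cd: "(C, U) \<in> coldata"
  shows has_shape_iff: "\<gamma> \<in> weak_compositions \<Longrightarrow> has_shape \<gamma> C \<longleftrightarrow> shape_of C = \<gamma>"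
    and shape_of_weak_composition: "shape_of C \<in> weak_compositions"
proof -
  obtain p A where A: "arrangement p A" "greedy p A" "column p A = C"
    using greedy_exists[OF cd] by blast
  \<comment> \<open>A nonempty row 0 would begin with the anchor 0, which is not a letter; so
    \<open>p\<close> comes from a list whose rows are numbered from 1.\<close>
  have "p 0 = 0"
  proof (rule ccontr)
    assume "p 0 \<noteq> 0"
    moreover from this have "A 0 0 = 0" using A(2) by (simp add: greedy_def)
    moreover have "j < p i \<Longrightarrow> 0 < A i j" for i j using A(1) by (simp add: arrangement_def)
    ultimately show False by (metis not_gr_zero)
  qed
  then obtain \<delta> where \<delta>: "\<delta> \<in> weak_compositions" "row_length \<delta> = p"
    using row_length_surj[of p] A(1) by (auto simp: arrangement_def)
  have sh: "has_shape \<delta> C" using A \<delta> by (auto simp: has_shape_def)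
  have uniq: "\<epsilon> = \<delta>" if "\<epsilon> \<in> weak_compositions" "has_shape \<epsilon> C" for \<epsilon>
  proof -
    obtain A' where A': "arrangement (row_length \<epsilon>) A'" "greedy (row_length \<epsilon>) A'"
      "column (row_length \<epsilon>) A' = C" using \<open>has_shape \<epsilon> C\<close> by (auto simp: has_shape_def)
    have "row_length \<epsilon> = p" using greedy_unique(1)[OF A'(1) A(1) A'(2) A(2)] A' A by simp
    then show ?thesis using row_length_inj that \<delta> by simp
  qed
  have eq: "shape_of C = \<delta>"
    unfolding shape_of_def
    by (rule the_equality) (use \<delta>(1) sh uniq in blast)+
  then show "shape_of C \<in> weak_compositions"
    "\<gamma> \<in> weak_compositions \<Longrightarrow> has_shape \<gamma> C \<longleftrightarrow> shape_of C = \<gamma>"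
    using \<delta>(1) sh uniq unfolding eq by blast+
qed

text \<open>Each column datum has exactly one shape, so adding the atoms of a fibre of
  \<open>g\<close> counts the data whose shape lies in it. The common degree \<open>s\<close> makes
  the power of \<beta> the same for all summands. It serves both \<open>flatten\<close> and
  \<open>sort_parts\<close>.\<close>

lemma lin_comb_lascoux_fibre:
  assumes s: "\<And>\<gamma>. g \<gamma> = y \<Longrightarrow> sum_list \<gamma> = s"
  shows "lin_comb {\<gamma> \<in> weak_compositions. g \<gamma> = y} (\<lambda>_. 1) lascoux_atom m =
    monom (int (num_data (\<lambda>C. g (shape_of C) = y) m)) (size m - s)"
proof -
  let ?X = "{(C, U). (C, U) \<in> coldata \<and> has_weight U m}"
  let ?X' = "{(C, U). (C, U) \<in> coldata \<and> has_weight U m \<and> g (shape_of C) = y}"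
  let ?sh = "\<lambda>(C, U). shape_of C"
  let ?\<Gamma> = "{\<gamma> \<in> weak_compositions. g \<gamma> = y}"
  have fin: "finite ?X'" by (rule finite_subset[OF _ finite_coldata_weight[of m]]) auto
  have L: "lascoux_atom \<gamma> m = monom (int (card {x \<in> ?X'. ?sh x = \<gamma>})) (size m - s)" if "\<gamma> \<in> ?\<Gamma>" for \<gamma>
  proof -
    have "num_data (has_shape \<gamma>) m = card {x \<in> ?X'. ?sh x = \<gamma>}"
      using that unfolding num_data_def
      by (intro arg_cong[where f = card]) (auto simp: has_shape_iff)
    then show ?thesis using that s by (simp add: lascoux_atom_eq)
  qed
  have sub: "{\<gamma>. \<gamma> \<in> ?\<Gamma> \<and> 1 * lascoux_atom \<gamma> m \<noteq> 0} = ?sh ` ?X'"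
  proof (intro equalityI subsetI)
    fix \<gamma> assume \<gamma>: "\<gamma> \<in> {\<gamma>. \<gamma> \<in> ?\<Gamma> \<and> 1 * lascoux_atom \<gamma> m \<noteq> 0}"
    then have "card {x \<in> ?X'. ?sh x = \<gamma>} \<noteq> 0" using L[of \<gamma>] by auto
    then have "{x \<in> ?X'. ?sh x = \<gamma>} \<noteq> {}" by (metis card.empty)
    then show "\<gamma> \<in> ?sh ` ?X'" by blast
  next
    fix \<gamma> assume "\<gamma> \<in> ?sh ` ?X'"
    then obtain x where x: "x \<in> ?X'" "?sh x = \<gamma>" by blast
    then have \<gamma>: "\<gamma> \<in> ?\<Gamma>" using shape_of_weak_composition by auto
    have "{x \<in> ?X'. ?sh x = \<gamma>} \<noteq> {}" using x by blast
    then have "card {x \<in> ?X'. ?sh x = \<gamma>} \<noteq> 0" using fin by (simp add: card_eq_0_iff)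
    then show "\<gamma> \<in> {\<gamma>. \<gamma> \<in> ?\<Gamma> \<and> 1 * lascoux_atom \<gamma> m \<noteq> 0}" using \<gamma> L[OF \<gamma>] by simp
  qed
  have "lin_comb ?\<Gamma> (\<lambda>_. 1) lascoux_atom m = (\<Sum>\<gamma>\<in>?sh ` ?X'. lascoux_atom \<gamma> m)"
    unfolding lin_comb_def sub by simp
  also have "\<dots> = (\<Sum>\<gamma>\<in>?sh ` ?X'. monom (int (card {x \<in> ?X'. ?sh x = \<gamma>})) (size m - s))"
    using sub by (intro sum.cong refl L) blast
  also have "\<dots> = monom (int (\<Sum>\<gamma>\<in>?sh ` ?X'. card {x \<in> ?X'. ?sh x = \<gamma>})) (size m - s)"
    unfolding of_nat_sum monom_sum ..
  also have "(\<Sum>\<gamma>\<in>?sh ` ?X'. card {x \<in> ?X'. ?sh x = \<gamma>}) = card ?X'"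
    using sum.group[OF fin finite_imageI[OF fin] subset_refl, of "\<lambda>_. 1::nat" ?sh] by simp
  finally show ?thesis by (simp add: num_data_def)
qed

section \<open>Adding letters one at a time\<close>

fun hd0 :: "nat list \<Rightarrow> nat" where
  "hd0 [] = 0"
| "hd0 (x # xs) = x"

text \<open>
  Adding a smallest letter to column data with heights \<open>\<mu>\<close> so that the heights become \<open>\<nu>\<close>: \<open>x\<close> marks
  the columns containing the new letter. It is an anchor in the columns that grow; in a column that
  does not grow it may occur as a free entry if the next column is shorter.
\<close>

fun transfer :: "'a::comm_ring_1 \<Rightarrow> nat list \<Rightarrow> nat list \<Rightarrow> 'a" where
  "transfer x [] [] = 1"
| "transfer x (m # \<mu>) (v # \<nu>) =
    (if hd0 \<nu> \<le> v \<and> (v = m \<or> v = Suc m)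
     then (if v = Suc m then x else if hd0 \<mu> < m then 1 + x else 1) * transfer x \<mu> \<nu> else 0)"
| "transfer x _ _ = 0"

text \<open>Candidates for the heights after one letter has been added. Lists that are not weakly
  decreasing are included, and \<open>transfer\<close> vanishes on them.\<close>

fun mids :: "nat list \<Rightarrow> nat list list" where
  "mids [] = [[]]"
| "mids (m # \<mu>) = map ((#) m) (mids \<mu>) @ map ((#) (Suc m)) (mids \<mu>)"

lemma distinct_mids: "distinct (mids \<mu>)"
  by (induction \<mu>) (auto simp: distinct_map)

lemma Cons_mem_image: "v # \<nu> \<in> (#) m ` S \<longleftrightarrow> v = m \<and> \<nu> \<in> S"
  by auto

lemma transfer_eq_0: "\<nu> \<notin> set (mids \<mu>) \<Longrightarrow> transfer x \<mu> \<nu> = 0"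
  by (induction x \<mu> \<nu> rule: transfer.induct) (auto simp: Cons_mem_image)

lemma mids_bounded: "\<nu> \<in> set (mids \<mu>) \<Longrightarrow> set \<nu> \<subseteq> {..B} \<Longrightarrow> set \<mu> \<subseteq> {..B}"
  by (induction \<mu> arbitrary: \<nu>) fastforce+

lemma length_mids: "\<nu> \<in> set (mids \<mu>) \<Longrightarrow> length \<nu> = length \<mu>"
  by (induction \<mu> arbitrary: \<nu>) auto

lemma hd0_mids: "\<nu> \<in> set (mids \<mu>) \<Longrightarrow> hd0 \<nu> = hd0 \<mu> \<or> hd0 \<nu> = Suc (hd0 \<mu>)"
  by (cases \<mu>) auto

text \<open>The part of an entry of the product of two transfer matrices in which the first column
  grows by \<open>e\<close> with the first letter. The split is needed because the factor of a
  column put in front depends on this intermediate height.\<close>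

definition two_step :: "nat \<Rightarrow> 'a::comm_ring_1 \<Rightarrow> 'a \<Rightarrow> nat list \<Rightarrow> nat list \<Rightarrow> 'a" where
  "two_step e x y \<mu> \<rho> =
    (\<Sum>\<nu>\<leftarrow>mids \<mu>. if hd0 \<nu> = hd0 \<mu> + e then transfer x \<mu> \<nu> * transfer y \<nu> \<rho> else 0)"

lemma sum_mids_by_head:
  "(\<Sum>\<nu>\<leftarrow>mids \<mu>. c (hd0 \<nu>) * (transfer x \<mu> \<nu> * transfer y \<nu> \<rho>)) =
    c (hd0 \<mu>) * two_step 0 x y \<mu> \<rho> + c (Suc (hd0 \<mu>)) * two_step 1 x y \<mu> \<rho>"
proof -
  have "(\<Sum>\<nu>\<leftarrow>mids \<mu>. c (hd0 \<nu>) * (transfer x \<mu> \<nu> * transfer y \<nu> \<rho>)) =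
    (\<Sum>\<nu>\<leftarrow>mids \<mu>. c (hd0 \<mu>) * (if hd0 \<nu> = hd0 \<mu> + 0 then transfer x \<mu> \<nu> * transfer y \<nu> \<rho> else 0) +
      c (Suc (hd0 \<mu>)) * (if hd0 \<nu> = hd0 \<mu> + 1 then transfer x \<mu> \<nu> * transfer y \<nu> \<rho> else 0))"
    by (intro arg_cong[where f = sum_list] map_cong refl) (use hd0_mids in fastforce)
  then show ?thesis by (simp add: two_step_def sum_list_addf sum_list_const_mult)
qed

text \<open>
  The factor contributed by a new first column, whose heights are \<open>m\<close>, \<open>m + e\<close> and \<open>r\<close>; the
  heights of the next column are \<open>m'\<close>, \<open>h\<close> and \<open>r'\<close>.
\<close>

definition column_factor ::
  "nat \<Rightarrow> 'a::comm_ring_1 \<Rightarrow> 'a \<Rightarrow> nat \<Rightarrow> nat \<Rightarrow> nat \<Rightarrow> nat \<Rightarrow> nat \<Rightarrow> 'a" where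
  "column_factor e x y m r m' r' h =
    (if h \<le> m + e \<and> r' \<le> r \<and> (r = m + e \<or> r = Suc (m + e))
     then (if e = 1 then x else if m' < m then 1 + x else 1) *
       (if r = Suc (m + e) then y else if h < m + e then 1 + y else 1)
     else 0)"

text \<open>The factor of the new column depends on the intermediate list only through its head,
  which is \<open>hd0 \<mu>\<close> or \<open>Suc (hd0 \<mu>)\<close>.\<close>

lemma two_step_Cons:
  assumes "e = 0 \<or> e = 1"
  shows "two_step e x y (m # \<mu>) (r # \<rho>) =
    column_factor e x y m r (hd0 \<mu>) (hd0 \<rho>) (hd0 \<mu>) * two_step 0 x y \<mu> \<rho> +
    column_factor e x y m r (hd0 \<mu>) (hd0 \<rho>) (Suc (hd0 \<mu>)) * two_step 1 x y \<mu> \<rho>"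
proof -
  have "two_step e x y (m # \<mu>) (r # \<rho>) = (\<Sum>\<nu>\<leftarrow>mids \<mu>.
      column_factor e x y m r (hd0 \<mu>) (hd0 \<rho>) (hd0 \<nu>) * (transfer x \<mu> \<nu> * transfer y \<nu> \<rho>))"
    using assms unfolding two_step_def
    by (auto simp: o_def column_factor_def mult_ac intro!: arg_cong[where f = sum_list])
  then show ?thesis unfolding sum_mids_by_head .
qed

text \<open>Heights never decrease, so the intermediate height of the first column cannot exceed the
  final one.\<close>

lemma two_step_1_eq_0: "length \<mu> = length \<rho> \<Longrightarrow> hd0 \<rho> \<le> hd0 \<mu> \<Longrightarrow> two_step 1 x y \<mu> \<rho> = 0"
  by (cases \<mu>; cases \<rho>)
    (simp_all add: two_step_Cons[of 1, simplified] column_factor_def, simp add: two_step_def)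

text \<open>
  The second identity is there for the induction: if \<open>\<mu>\<close> is extended by a column of the same height and
  \<open>\<rho>\<close> by a column that is higher by one, the left-hand side of the first identity becomes that of
  the second.
\<close>

lemma two_step_symmetric:
  fixes x y :: "'a::comm_ring_1"
  assumes "length \<mu> = length \<rho>" "sorted_wrt (\<ge>) \<mu>"
  defines "P \<equiv> \<lambda>x y. two_step 0 x y \<mu> \<rho>" and "Q \<equiv> \<lambda>x y. two_step 1 x y \<mu> \<rho>"
  shows "P x y + Q x y = P y x + Q y x"
    and "hd0 \<rho> \<le> Suc (hd0 \<mu>) \<Longrightarrow>
      x * (P x y + Q x y) + (1 + x) * y * P x y = y * (P y x + Q y x) + (1 + y) * x * P y x"
proof -
  have "P x y + Q x y = P y x + Q y x \<and> (hd0 \<rho> \<le> Suc (hd0 \<mu>) \<longrightarrow>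
      x * (P x y + Q x y) + (1 + x) * y * P x y = y * (P y x + Q y x) + (1 + y) * x * P y x)"
    using assms(1,2) unfolding P_def Q_def
  proof (induction \<mu> \<rho> rule: list_induct2)
    case Nil
    then show ?case by (simp add: two_step_def algebra_simps)
  next
    case (Cons m \<mu> r \<rho>)
    define p p' q q' where "p = two_step 0 x y \<mu> \<rho>" and "p' = two_step 0 y x \<mu> \<rho>"
      and "q = two_step 1 x y \<mu> \<rho>" and "q' = two_step 1 y x \<mu> \<rho>"
    have hd: "hd0 \<mu> \<le> m" using Cons.prems by (cases \<mu>) auto
    have I: "p + q = p' + q'" and
      J: "hd0 \<rho> \<le> Suc (hd0 \<mu>) \<Longrightarrow> x * (p + q) + (1 + x) * y * p = y * (p' + q') + (1 + y) * x * p'"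
      using Cons unfolding p_def p'_def q_def q'_def by auto
    have Z: "q = 0" "q' = 0" if "hd0 \<rho> \<le> hd0 \<mu>"
      using two_step_1_eq_0[OF Cons.hyps that] unfolding q_def q'_def by auto
    have step: "two_step e x y (m # \<mu>) (r # \<rho>) =
        column_factor e x y m r (hd0 \<mu>) (hd0 \<rho>) (hd0 \<mu>) * p +
        column_factor e x y m r (hd0 \<mu>) (hd0 \<rho>) (Suc (hd0 \<mu>)) * q"
      "two_step e y x (m # \<mu>) (r # \<rho>) =
        column_factor e y x m r (hd0 \<mu>) (hd0 \<rho>) (hd0 \<mu>) * p' +
        column_factor e y x m r (hd0 \<mu>) (hd0 \<rho>) (Suc (hd0 \<mu>)) * q'" if "e = 0 \<or> e = 1" for e
      unfolding p_def p'_def q_def q'_def using that by (rule two_step_Cons)+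
    note step = step[of 0, simplified] step[of 1, simplified]
    \<comment> \<open>The first column grows by 0, 1 or 2 in total. If it grows by less than 2, it
      may hold a free entry, and what is possible depends on whether the next column is as high,
      lower by one, or lower still.\<close>
    consider "\<not> hd0 \<rho> \<le> r \<or> r < m \<or> Suc (Suc m) < r" | "hd0 \<rho> \<le> r" "r = m" "hd0 \<mu> = m"
      | "hd0 \<rho> \<le> r" "r = m" "Suc (hd0 \<mu>) = m" | "hd0 \<rho> \<le> r" "r = m" "Suc (hd0 \<mu>) < m"
      | "hd0 \<rho> \<le> r" "r = Suc m" "hd0 \<mu> = m" | "hd0 \<rho> \<le> r" "r = Suc m" "hd0 \<mu> < m"
      | "hd0 \<rho> \<le> r" "r = Suc (Suc m)"
      using hd by linarith
    then show ?case
    proof cases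
      case 1
      then have "column_factor e a b m r m' (hd0 \<rho>) h = 0" if "e \<le> 1" for e m' h and a b :: 'a
        using that by (auto simp: column_factor_def)
      then show ?thesis by (simp add: step)
    next
      case 2
      then have "two_step 0 x y (m # \<mu>) (r # \<rho>) = p" "two_step (Suc 0) x y (m # \<mu>) (r # \<rho>) = 0"
        "two_step 0 y x (m # \<mu>) (r # \<rho>) = p'" "two_step (Suc 0) y x (m # \<mu>) (r # \<rho>) = 0"
        unfolding step by (simp_all add: column_factor_def)
      \<comment> \<open>The final height of the next column is at most \<open>r = hd0 \<mu>\<close>,
        so this column cannot grow and \<open>q\<close>, \<open>q'\<close> vanish.\<close>
      moreover have "p = p'" using 2 I Z by simp
      ultimately show ?thesis by (simp add: algebra_simps)
    next
      case 3
      then have "two_step 0 x y (m # \<mu>) (r # \<rho>) = (1 + x) * (1 + y) * p + (1 + x) * q"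
        "two_step (Suc 0) x y (m # \<mu>) (r # \<rho>) = 0"
        "two_step 0 y x (m # \<mu>) (r # \<rho>) = (1 + y) * (1 + x) * p' + (1 + y) * q'"
        "two_step (Suc 0) y x (m # \<mu>) (r # \<rho>) = 0"
        unfolding step by (auto simp: column_factor_def algebra_simps)
      \<comment> \<open>This is the sum of the identities \<open>I\<close> and \<open>J\<close>. The
        term with \<open>q\<close> lacks the factor \<open>1 + y\<close>: once the next column has
        grown it is as high as the first, so the second letter cannot be free there.\<close>
      moreover have "(1 + x) * (1 + y) * p + (1 + x) * q = (1 + y) * (1 + x) * p' + (1 + y) * q'"
      proof -
        have "x * (p + q) + (1 + x) * y * p = y * (p' + q') + (1 + y) * x * p'" using J 3 by simp
        then have "(p + q) + (x * (p + q) + (1 + x) * y * p) = (p' + q') + (y * (p' + q') + (1 + y) * x * p')"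
          using I by simp
        then show ?thesis by (simp add: algebra_simps)
      qed
      ultimately have "two_step 0 x y (m # \<mu>) (r # \<rho>) = two_step 0 y x (m # \<mu>) (r # \<rho>)"
        "two_step (Suc 0) x y (m # \<mu>) (r # \<rho>) = 0" "two_step (Suc 0) y x (m # \<mu>) (r # \<rho>) = 0"
        by simp_all
      then show ?thesis by (simp add: algebra_simps)
    next
      case 4
      then have "two_step 0 x y (m # \<mu>) (r # \<rho>) = (1 + x) * (1 + y) * (p + q)"
        "two_step (Suc 0) x y (m # \<mu>) (r # \<rho>) = 0"
        "two_step 0 y x (m # \<mu>) (r # \<rho>) = (1 + y) * (1 + x) * (p' + q')"
        "two_step (Suc 0) y x (m # \<mu>) (r # \<rho>) = 0"
        unfolding step by (auto simp: column_factor_def algebra_simps)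
      then show ?thesis using I by (simp add: algebra_simps)
    next
      case 5
      then have E: "two_step 0 x y (m # \<mu>) (r # \<rho>) = y * p"
        "two_step (Suc 0) x y (m # \<mu>) (r # \<rho>) = x * ((1 + y) * p + q)"
        "two_step 0 y x (m # \<mu>) (r # \<rho>) = x * p'"
        "two_step (Suc 0) y x (m # \<mu>) (r # \<rho>) = y * ((1 + x) * p' + q')"
        unfolding step by (auto simp: column_factor_def algebra_simps)
      have J': "x * (p + q) + (1 + x) * y * p = y * (p' + q') + (1 + y) * x * p'"
        using J 5 by simp
      \<comment> \<open>The second identity for the longer lists is \<open>x + y\<close> times
        \<open>J\<close> minus \<open>x * y\<close> times \<open>I\<close>; both multipliers are
        symmetric in \<open>x\<close> and \<open>y\<close>. The first identity for the longer lists
        is \<open>J\<close> itself.\<close>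
      have "x * (y * p + x * ((1 + y) * p + q)) + (1 + x) * y * (y * p) =
          (x + y) * (x * (p + q) + (1 + x) * y * p) - x * y * (p + q)"
        by (simp add: algebra_simps)
      also have "\<dots> = (x + y) * (y * (p' + q') + (1 + y) * x * p') - x * y * (p' + q')"
        unfolding J' unfolding I ..
      also have "\<dots> = y * (x * p' + y * ((1 + x) * p' + q')) + (1 + y) * x * (x * p')"
        by (simp add: algebra_simps)
      finally have B: "x * (y * p + x * ((1 + y) * p + q)) + (1 + x) * y * (y * p) =
          y * (x * p' + y * ((1 + x) * p' + q')) + (1 + y) * x * (x * p')" .
      have A: "y * p + x * ((1 + y) * p + q) = x * p' + y * ((1 + x) * p' + q')"
        using J' by (simp add: algebra_simps)
      show ?thesis unfolding One_nat_def E using A B by simp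
    next
      case 6
      then have "two_step 0 x y (m # \<mu>) (r # \<rho>) = (1 + x) * y * (p + q)"
        "two_step (Suc 0) x y (m # \<mu>) (r # \<rho>) = x * (1 + y) * (p + q)"
        "two_step 0 y x (m # \<mu>) (r # \<rho>) = (1 + y) * x * (p' + q')"
        "two_step (Suc 0) y x (m # \<mu>) (r # \<rho>) = y * (1 + x) * (p' + q')"
        unfolding step by (auto simp: column_factor_def algebra_simps)
      then show ?thesis unfolding I One_nat_def by (simp add: algebra_simps)
    next
      case 7
      then have "two_step 0 x y (m # \<mu>) (r # \<rho>) = 0"
        "two_step (Suc 0) x y (m # \<mu>) (r # \<rho>) = x * y * (p + q)"
        "two_step 0 y x (m # \<mu>) (r # \<rho>) = 0"
        "two_step (Suc 0) y x (m # \<mu>) (r # \<rho>) = y * x * (p' + q')"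
        using hd unfolding step by (auto simp: column_factor_def algebra_simps)
      then show ?thesis using I 7 by (simp add: algebra_simps)
    qed
  qed
  then show "P x y + Q x y = P y x + Q y x"
    and "hd0 \<rho> \<le> Suc (hd0 \<mu>) \<Longrightarrow>
      x * (P x y + Q x y) + (1 + x) * y * P x y = y * (P y x + Q y x) + (1 + y) * x * P y x"
    by blast+
qed

text \<open>A finite index set for the matrix products. Adding a letter keeps the length and never
  lowers a height, so every list from which a member can be reached is a member too, and no
  intermediate list is lost.\<close>

definition height_lists :: "nat \<Rightarrow> nat \<Rightarrow> nat list set" where
  "height_lists n B = {L. set L \<subseteq> {..B} \<and> length L = n}"

lemma finite_height_lists: "finite (height_lists n B)"
  unfolding height_lists_def by (rule finite_lists_length_eq) simp

lemma transfer_eq_0_height_lists: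
  assumes "\<nu> \<in> height_lists n B" "\<mu> \<notin> height_lists n B"
  shows "transfer x \<mu> \<nu> = 0"
  by (rule transfer_eq_0) (use assms length_mids[of \<nu> \<mu>] mids_bounded[of \<nu> \<mu> B] in \<open>auto simp: height_lists_def\<close>)

lemma transfer_commute:
  fixes x y :: "'a::comm_ring_1"
  assumes "\<mu> \<in> height_lists n B" "\<rho> \<in> height_lists n B" "sorted_wrt (\<ge>) \<mu>"
  shows "(\<Sum>\<nu>\<in>height_lists n B. transfer x \<mu> \<nu> * transfer y \<nu> \<rho>) =
    (\<Sum>\<nu>\<in>height_lists n B. transfer y \<mu> \<nu> * transfer x \<nu> \<rho>)"
proof -
  have eq: "(\<Sum>\<nu>\<in>height_lists n B. transfer x \<mu> \<nu> * transfer y \<nu> \<rho>) =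
      two_step 0 x y \<mu> \<rho> + two_step 1 x y \<mu> \<rho>" for x y :: 'a
  proof -
    have "(\<Sum>\<nu>\<in>height_lists n B. transfer x \<mu> \<nu> * transfer y \<nu> \<rho>) =
        (\<Sum>\<nu>\<in>set (mids \<mu>). transfer x \<mu> \<nu> * transfer y \<nu> \<rho>)"
    proof (rule sum.mono_neutral_cong[OF _ finite_height_lists])
      show "transfer x \<mu> \<nu> * transfer y \<nu> \<rho> = 0" if "\<nu> \<in> set (mids \<mu>) - height_lists n B" for \<nu>
        using that transfer_eq_0_height_lists[OF assms(2), of \<nu> y] by simp
      show "transfer x \<mu> \<nu> * transfer y \<nu> \<rho> = 0" if "\<nu> \<in> height_lists n B - set (mids \<mu>)" for \<nu>
        using that transfer_eq_0[of \<nu> \<mu> x] by auto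
    qed simp_all
    also have "\<dots> = (\<Sum>\<nu>\<leftarrow>mids \<mu>. (\<lambda>_. 1) (hd0 \<nu>) * (transfer x \<mu> \<nu> * transfer y \<nu> \<rho>))"
      by (simp add: sum_list_distinct_conv_sum_set distinct_mids)
    finally show ?thesis using sum_mids_by_head[where c = "\<lambda>_. 1" and \<mu> = \<mu> and x = x and y = y and \<rho> = \<rho>] by simp
  qed
  have "length \<mu> = length \<rho>" using assms by (simp add: height_lists_def)
  then show ?thesis unfolding eq using two_step_symmetric(1)[OF _ assms(3)] by blast
qed

section \<open>Combinatorial meaning of the transfer matrix\<close>

definition nth0 :: "nat list \<Rightarrow> nat \<Rightarrow> nat" where
  "nth0 L j = (if j < length L then L ! j else 0)"

lemma nth0_Cons [simp]: "nth0 (x # L) 0 = x" "nth0 (x # L) (Suc j) = nth0 L j"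
  by (simp_all add: nth0_def)

lemma hd0_eq_nth0: "hd0 L = nth0 L 0"
  by (cases L) (simp_all add: nth0_def)

definition valid_step :: "nat list \<Rightarrow> nat list \<Rightarrow> bool" where
  "valid_step \<mu> \<nu> \<longleftrightarrow> length \<mu> = length \<nu> \<and>
    (\<forall>j<length \<mu>. nth0 \<nu> (Suc j) \<le> nth0 \<nu> j \<and> (nth0 \<nu> j = nth0 \<mu> j \<or> nth0 \<nu> j = Suc (nth0 \<mu> j)))"

text \<open>The columns that can receive a new smallest letter. Growing columns take it as an
  anchor. The other members of \<open>V\<close> take it as a free entry; by the strict inequality in
  \<open>coldata\<close> the next column must then be shorter, not counting the new letter.\<close>

definition letter_columns :: "nat list \<Rightarrow> nat list \<Rightarrow> nat set set" where
  "letter_columns \<mu> \<nu> = {V. valid_step \<mu> \<nu> \<and> V \<subseteq> {..<length \<mu>} \<and>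
    {j \<in> {..<length \<mu>}. nth0 \<nu> j = Suc (nth0 \<mu> j)} \<subseteq> V \<and>
    (\<forall>j\<in>V. nth0 \<nu> j = Suc (nth0 \<mu> j) \<or> nth0 \<mu> (Suc j) < nth0 \<mu> j)}"

lemma finite_letter_columns: "finite (letter_columns \<mu> \<nu>)"
  by (rule finite_subset[of _ "Pow {..<length \<mu>}"]) (auto simp: letter_columns_def)

lemma transfer_eq_prod:
  "transfer x \<mu> \<nu> = (if valid_step \<mu> \<nu> then (\<Prod>j<length \<mu>. if nth0 \<nu> j = Suc (nth0 \<mu> j) then x
    else if nth0 \<mu> (Suc j) < nth0 \<mu> j then 1 + x else 1) else 0)"
proof (induction x \<mu> \<nu> rule: transfer.induct)
  case (2 x m \<mu> v \<nu>)
  have "valid_step (m # \<mu>) (v # \<nu>) \<longleftrightarrow> hd0 \<nu> \<le> v \<and> (v = m \<or> v = Suc m) \<and> valid_step \<mu> \<nu>"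
    unfolding valid_step_def hd0_eq_nth0 by (auto simp: All_less_Suc2)
  then show ?case using 2 by (auto simp: prod.lessThan_Suc_shift hd0_eq_nth0 simp del: prod.lessThan_Suc cong: if_cong)
qed (simp_all add: valid_step_def)

lemma sum_Pow_power_card:
  "finite S \<Longrightarrow> (\<Sum>V\<in>Pow S. x ^ card V) = (1 + x :: 'a::comm_ring_1) ^ card S"
  using prod_add[of S "\<lambda>_. x" "\<lambda>_. 1"] by (simp add: add.commute)

text \<open>The growing columns \<open>F\<close> are forced and give a power of \<open>x\<close>;
  the columns of \<open>S\<close> may be chosen independently, and expanding the power of
  \<open>1 + x\<close> lists the choices.\<close>

lemma transfer_eq_sum: "transfer x \<mu> \<nu> = (\<Sum>V\<in>letter_columns \<mu> \<nu>. x ^ card V)"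
proof (cases "valid_step \<mu> \<nu>")
  case True
  define N where "N = {..<length \<mu>}"
  define F where "F = {j \<in> N. nth0 \<nu> j = Suc (nth0 \<mu> j)}"
  define S where "S = {j \<in> N. nth0 \<nu> j \<noteq> Suc (nth0 \<mu> j) \<and> nth0 \<mu> (Suc j) < nth0 \<mu> j}"
  have fin: "finite N" "finite F" "finite S" by (auto simp: N_def F_def S_def)
  have disj: "F \<inter> S = {}" by (auto simp: F_def S_def)
  have "letter_columns \<mu> \<nu> = (\<lambda>V. F \<union> V) ` Pow S"
  proof (intro equalityI subsetI)
    fix V assume "V \<in> letter_columns \<mu> \<nu>"
    then have "V = F \<union> (V - F)" "V - F \<in> Pow S"
      by (auto simp: letter_columns_def N_def F_def S_def)
    then show "V \<in> (\<lambda>V. F \<union> V) ` Pow S" by blast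
  qed (use True in \<open>auto simp: letter_columns_def N_def F_def S_def\<close>)
  moreover have "inj_on (\<lambda>V. F \<union> V) (Pow S)" using disj by (auto intro!: inj_onI)
  ultimately have "(\<Sum>V\<in>letter_columns \<mu> \<nu>. x ^ card V) = (\<Sum>V\<in>Pow S. x ^ card (F \<union> V))"
    by (simp add: sum.reindex)
  also have "\<dots> = (\<Sum>V\<in>Pow S. x ^ card F * x ^ card V)"
  proof (rule sum.cong[OF refl])
    fix V assume "V \<in> Pow S"
    then have "finite V" "F \<inter> V = {}" using fin disj by (auto intro: finite_subset)
    then show "x ^ card (F \<union> V) = x ^ card F * x ^ card V"
      using fin by (simp add: card_Un_disjoint power_add)
  qed
  also have "\<dots> = x ^ card F * (1 + x) ^ card S"
    by (simp add: sum_Pow_power_card[OF fin(3)] flip: sum_distrib_left)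
  also have "\<dots> = (\<Prod>j\<in>N. (if j \<in> F then x else 1) * (if j \<in> S then 1 + x else 1))"
    using fin by (simp add: prod.distrib prod.If_cases Int_absorb1 F_def S_def Collect_conj_eq)
  also have "\<dots> = transfer x \<mu> \<nu>"
    using True unfolding transfer_eq_prod N_def[symmetric]
    by (auto intro!: prod.cong simp: F_def S_def)
  finally show ?thesis ..
qed (simp add: transfer_eq_prod letter_columns_def)

definition num_letter_columns :: "nat list \<Rightarrow> nat list \<Rightarrow> nat \<Rightarrow> nat" where
  "num_letter_columns \<mu> \<nu> k = card {V \<in> letter_columns \<mu> \<nu>. card V = k}"

text \<open>Two independent indeterminates are obtained in polynomials over \<open>int poly\<close>:
  the inner variable marks the first letter and the outer one the second, so that both
  multiplicities can be read off as exponents.\<close>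

lemma coeff_transfer_mult:
  "coeff (coeff (transfer (monom (monom (1::int) 1) 0) \<mu> \<nu> * transfer (monom 1 1) \<mu>' \<nu>') b) a =
    int (num_letter_columns \<mu> \<nu> a * num_letter_columns \<mu>' \<nu>' b)"
proof -
  have pow: "monom (monom (1::int) 1) 0 ^ i * monom 1 1 ^ j = monom (monom 1 i) j" for i j
    by (simp add: monom_power mult_monom)
  have "transfer (monom (monom (1::int) 1) 0) \<mu> \<nu> * transfer (monom 1 1) \<mu>' \<nu>' =
      (\<Sum>V\<in>letter_columns \<mu> \<nu>. \<Sum>W\<in>letter_columns \<mu>' \<nu>'. monom (monom 1 (card V)) (card W))"
    unfolding transfer_eq_sum sum_product pow ..
  then have "coeff (coeff (transfer (monom (monom (1::int) 1) 0) \<mu> \<nu> * transfer (monom 1 1) \<mu>' \<nu>') b) a =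
      (\<Sum>V\<in>letter_columns \<mu> \<nu>. \<Sum>W\<in>letter_columns \<mu>' \<nu>'.
        (if card V = a then 1 else 0) * (if card W = b then 1 else 0))"
    by (simp add: coeff_sum) (auto intro!: sum.cong)
  also have "\<dots> = (\<Sum>V\<in>letter_columns \<mu> \<nu>. if card V = a then 1 else 0) *
      (\<Sum>W\<in>letter_columns \<mu>' \<nu>'. if card W = b then 1 else 0)"
    by (simp only: sum_product)
  also have "\<dots> = int (num_letter_columns \<mu> \<nu> a * num_letter_columns \<mu>' \<nu>' b)"
    by (simp add: num_letter_columns_def sum.If_cases finite_letter_columns Int_def)
  finally show ?thesis .
qed

text \<open>Commutation with indeterminates refines to fixed multiplicities by comparing
  coefficients.\<close>

lemma num_letter_columns_commute:
  assumes "\<mu> \<in> height_lists n B" "\<rho> \<in> height_lists n B" "sorted_wrt (\<ge>) \<mu>"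
  shows "(\<Sum>\<nu>\<in>height_lists n B. num_letter_columns \<mu> \<nu> a * num_letter_columns \<nu> \<rho> b) =
    (\<Sum>\<nu>\<in>height_lists n B. num_letter_columns \<mu> \<nu> b * num_letter_columns \<nu> \<rho> a)"
proof -
  let ?X = "monom (monom (1::int) 1) 0" and ?Y = "monom (1::int poly) 1"
  have "int (\<Sum>\<nu>\<in>height_lists n B. num_letter_columns \<mu> \<nu> a * num_letter_columns \<nu> \<rho> b) =
      coeff (coeff (\<Sum>\<nu>\<in>height_lists n B. transfer ?X \<mu> \<nu> * transfer ?Y \<nu> \<rho>) b) a"
    unfolding coeff_sum coeff_transfer_mult of_nat_sum ..
  also have "\<dots> = coeff (coeff (\<Sum>\<nu>\<in>height_lists n B. transfer ?X \<nu> \<rho> * transfer ?Y \<mu> \<nu>) b) a"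
    unfolding transfer_commute[OF assms, of ?X ?Y] by (simp add: mult.commute)
  also have "\<dots> = int (\<Sum>\<nu>\<in>height_lists n B. num_letter_columns \<nu> \<rho> a * num_letter_columns \<mu> \<nu> b)"
    unfolding coeff_sum coeff_transfer_mult of_nat_sum ..
  finally show ?thesis unfolding of_nat_eq_iff by (simp add: mult.commute)
qed

section \<open>Removing and adding the least letter\<close>

definition num_heights :: "nat list \<Rightarrow> nat multiset \<Rightarrow> nat" where
  "num_heights L m = num_data (\<lambda>C. \<forall>j. card (C j) = nth0 L j) m"

lemma num_above_Diff: "t \<le> x \<Longrightarrow> num_above (X - {t}) x = num_above X x"
  unfolding num_above_def by (rule arg_cong[where f = card]) auto

lemma num_above_below:
  "X \<subseteq> {t..} \<Longrightarrow> x < t \<Longrightarrow> num_above X x = card X"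
  unfolding num_above_def by (rule arg_cong[where f = card]) auto

lemma num_above_least: "X \<subseteq> {t..} \<Longrightarrow> num_above X t = card (X - {t})"
  unfolding num_above_def by (rule arg_cong[where f = card]) auto

text \<open>Counts above \<open>x\<close> with \<open>t \<le> x\<close> do not notice the removal of
  \<open>t\<close>. For \<open>x < t\<close> the count after removal is the full height of the
  column, which is the old count above \<open>t\<close>, so the old inequality at \<open>t\<close>
  applies. The same equality turns the strict inequality for a free \<open>t\<close> into strictly
  decreasing heights of the remaining columns.\<close>

lemma remove_least_letter:
  assumes cd: "(C, U) \<in> coldata" and wt: "has_weight U m" and m: "\<forall>x\<in>#m. t \<le> x"
    and h: "\<forall>j. card (C j) = nth0 L j" and L: "L \<in> height_lists n B"
  defines "C' \<equiv> \<lambda>j. C j - {t}" and "U' \<equiv> \<lambda>j. U j - {t}"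
  defines "L' \<equiv> map (\<lambda>j. card (C j - {t})) [0..<n]" and "V \<equiv> {j. t \<in> U j}"
  shows "L' \<in> height_lists n B" "(C', U') \<in> coldata" "has_weight U' (filter_mset (\<lambda>x. x \<noteq> t) m)"
    "\<forall>j. card (C' j) = nth0 L' j" "V \<in> letter_columns L' L" "card V = count m t"
proof -
  have len: "length L = n" and B: "set L \<subseteq> {..B}" using L by (auto simp: height_lists_def)
  have fin: "finite (U j)" "finite (C j)" and sub: "C j \<subseteq> U j" "U j \<subseteq> {1..}" for j
    using cd by (auto simp: coldata_def intro: finite_subset)
  have ge: "U j \<subseteq> {t..}" "C j \<subseteq> {t..}" for j
    using m has_weight_mem[OF cd wt] sub(1)[of j] by fastforce+
  have il: "num_above (C (Suc j)) x \<le> num_above (C j) x" for j x using cd by (auto simp: coldata_def)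
  have fr: "num_above (C (Suc j)) u < num_above (C j) u" if "u \<in> U j - C j" for j u
    using cd that by (auto simp: coldata_def)
  have empty: "C j = {}" if "n \<le> j" for j
    using h[rule_format, of j] that len fin(2)[of j] by (simp add: nth0_def)
  have emptyU: "U j = {}" if "n \<le> j" for j
    using coldata_nonempty[OF cd] empty[OF that] by blast
  have L': "nth0 L' j = card (C' j)" for j
    using empty[of j] by (simp add: nth0_def L'_def C'_def not_less)
  then show "\<forall>j. card (C' j) = nth0 L' j" by simp
  have cardC: "nth0 L j = card (C' j) + (if t \<in> C j then 1 else 0)" for j
  proof -
    have "nth0 L j = card (C j)" using h by simp
    also have "\<dots> = card (C' j) + (if t \<in> C j then 1 else 0)"
      using card.remove[OF fin(2), of t j] by (auto simp: C'_def)
    finally show ?thesis .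
  qed
  have "card (C' j) \<le> B" if "j < n" for j
  proof -
    have "nth0 L j \<le> B" using that len subsetD[OF B nth_mem[of j L]] by (simp add: nth0_def)
    then show ?thesis using cardC[of j] by simp
  qed
  then show "L' \<in> height_lists n B" by (auto simp: height_lists_def L'_def C'_def)
  show "(C', U') \<in> coldata"
    unfolding coldata_def mem_Collect_eq prod.case
  proof (intro conjI allI ballI)
    fix j
    show "finite (U' j)" "C' j \<subseteq> U' j" "U' j \<subseteq> {1..}"
      using fin(1)[of j] sub[of j] by (auto simp: U'_def C'_def)
    show "\<exists>n. \<forall>j\<ge>n. C' j = {}" using empty by (auto simp: C'_def)
    show "num_above (C' (Suc j)) x \<le> num_above (C' j) x" for x
    proof (cases "t \<le> x")
      case True
      then show ?thesis using il by (simp add: C'_def num_above_Diff)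
    next
      case False
      have "C' k \<subseteq> {t..}" for k using ge(2)[of k] by (auto simp: C'_def)
      then have "num_above (C' k) x = num_above (C k) t" for k
        using False num_above_below[of "C' k" t x] num_above_least[OF ge(2)[of k]] by (simp add: C'_def)
      then show ?thesis using il by simp
    qed
    show "num_above (C' (Suc j)) u < num_above (C' j) u" if "u \<in> U' j - C' j" for u
    proof -
      have "u \<in> U j - C j" "t \<le> u" using that ge(1)[of j] by (auto simp: U'_def C'_def)
      then show ?thesis using fr by (simp add: C'_def num_above_Diff)
    qed
  qed
  show "has_weight U' (filter_mset (\<lambda>x. x \<noteq> t) m)"
    using wt by (auto simp: has_weight_def U'_def)
  show "card V = count m t" using wt by (simp add: has_weight_def V_def)
  have Vn: "j < n" if "j \<in> V" for j using that emptyU[of j] by (force simp: V_def)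
  have lenL': "length L' = n" by (simp add: L'_def)
  have "nth0 L (Suc j) \<le> nth0 L j" for j
    using il[of j 0] num_above_0 sub[of j] sub[of "Suc j"] h by (metis order_trans)
  then have "valid_step L' L"
    unfolding valid_step_def using len lenL' by (auto simp: L' cardC)
  moreover have "nth0 L' (Suc j) < nth0 L' j" if "j \<in> V" "nth0 L j \<noteq> Suc (nth0 L' j)" for j
  proof -
    have "t \<in> U j - C j" using that by (auto simp: V_def L' cardC split: if_splits)
    then show ?thesis using fr[of t j] num_above_least[OF ge(2)] by (simp add: L' C'_def)
  qed
  moreover have "j \<in> V" if "nth0 L j = Suc (nth0 L' j)" for j
    using that sub(1)[of j] by (auto simp: V_def L' cardC split: if_splits)
  ultimately show "V \<in> letter_columns L' L"
    using Vn lenL' by (auto simp: letter_columns_def)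
qed

text \<open>The inverse construction. Interlacing below \<open>t\<close> now concerns full heights
  and follows from \<open>L\<close> being weakly decreasing. If \<open>t\<close> is added as a free
  entry, \<open>letter_columns\<close> gives a shorter next column, which is the strict inequality
  at \<open>t\<close>.\<close>

lemma add_least_letter:
  assumes cd: "(C', U') \<in> coldata" and wt: "has_weight U' (filter_mset (\<lambda>x. x \<noteq> t) m)"
    and m: "\<forall>x\<in>#m. t \<le> x" and t: "1 \<le> t" and h: "\<forall>j. card (C' j) = nth0 L' j"
    and L: "L \<in> height_lists n B" and V: "V \<in> letter_columns L' L" "card V = count m t"
  defines "C \<equiv> \<lambda>j. C' j \<union> (if nth0 L j = Suc (nth0 L' j) then {t} else {})"
    and "U \<equiv> \<lambda>j. U' j \<union> (if j \<in> V then {t} else {})"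
  shows "(C, U) \<in> coldata" "has_weight U m" "\<forall>j. card (C j) = nth0 L j"
    "(\<lambda>j. C j - {t}) = C'" "(\<lambda>j. U j - {t}) = U'" "{j. t \<in> U j} = V"
    "L' = map (\<lambda>j. card (C j - {t})) [0..<n]"
proof -
  have step: "valid_step L' L"
    and grow: "\<And>j. j < length L' \<Longrightarrow> nth0 L j = Suc (nth0 L' j) \<Longrightarrow> j \<in> V"
    and stay: "\<And>j. j \<in> V \<Longrightarrow> nth0 L j \<noteq> Suc (nth0 L' j) \<Longrightarrow> nth0 L' (Suc j) < nth0 L' j"
    using V(1) by (auto simp: letter_columns_def)
  have len: "length L = n" "length L' = n" using L step by (auto simp: height_lists_def valid_step_def)
  have out: "nth0 L j = 0" "nth0 L' j = 0" if "n \<le> j" for j using that len by (simp_all add: nth0_def)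
  have L01: "nth0 L j = nth0 L' j \<or> nth0 L j = Suc (nth0 L' j)" for j
    using step out[of j] len by (cases "j < n") (auto simp: valid_step_def)
  have anti: "nth0 L (Suc j) \<le> nth0 L j" for j
    using step out[of "Suc j"] len by (cases "j < n") (auto simp: valid_step_def)
  have CV: "j \<in> V" if "t \<in> C j" "t \<notin> C' j" for j
    using that grow[of j] out[of j] len by (cases "j < n") (auto simp: C_def split: if_splits)
  have fin: "finite (U' j)" "finite (C' j)" and sub: "C' j \<subseteq> U' j" "U' j \<subseteq> {1..}" for j
    using cd by (auto simp: coldata_def intro: finite_subset)
  have gt: "t < x" if "x \<in> U' j" for x j
  proof -
    have "x \<in># filter_mset (\<lambda>x. x \<noteq> t) m" using has_weight_mem[OF cd wt] that by blast
    then show ?thesis using m by (auto simp: le_less)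
  qed
  have tn: "t \<notin> U' j" "t \<notin> C' j" for j using gt[of t j] sub(1)[of j] by auto
  show C': "(\<lambda>j. C j - {t}) = C'" using tn by (auto simp: C_def fun_eq_iff)
  show U': "(\<lambda>j. U j - {t}) = U'" using tn by (auto simp: U_def fun_eq_iff)
  show tU: "{j. t \<in> U j} = V" using tn by (auto simp: U_def)
  show card: "\<forall>j. card (C j) = nth0 L j"
    using h fin(2) tn(2) L01 by (auto simp: C_def) (metis)+
  show "L' = map (\<lambda>j. card (C j - {t})) [0..<n]"
    using h len fun_cong[OF C'] by (intro nth_equalityI) (auto simp: nth0_def)
  have ge: "C j \<subseteq> {t..}" for j
  proof
    fix x assume "x \<in> C j"
    then have "x \<in> U' j \<or> x = t" using sub(1)[of j] by (auto simp: C_def split: if_splits)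
    then show "x \<in> {t..}" using gt[of x j] by auto
  qed
  have above: "num_above (C j) x = num_above (C' j) x" if "t \<le> x" for j x
    using num_above_Diff[OF that, of "C j"] fun_cong[OF C', of j] by simp
  show "(C, U) \<in> coldata"
    unfolding coldata_def mem_Collect_eq prod.case
  proof (intro conjI allI ballI)
    fix j
    show "finite (U j)" "U j \<subseteq> {1..}" using fin(1)[of j] sub[of j] t by (auto simp: U_def)
    show "C j \<subseteq> U j" using sub(1)[of j] CV[of j] tn by (auto simp: C_def U_def split: if_splits)
    have "C j = {}" if "n \<le> j" for j
    proof -
      have "finite (C j)" using fin(2)[of j] by (simp add: C_def)
      then show ?thesis using card[rule_format, of j] out(1)[OF that] by simp
    qed
    then show "\<exists>n. \<forall>j\<ge>n. C j = {}" by blast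
    show "num_above (C (Suc j)) x \<le> num_above (C j) x" for x
    proof (cases "t \<le> x")
      case True
      then show ?thesis using cd by (simp add: above coldata_def)
    next
      case False
      then show ?thesis using anti card by (simp add: num_above_below[OF ge])
    qed
    show "num_above (C (Suc j)) u < num_above (C j) u" if u: "u \<in> U j - C j" for u
    proof (cases "u = t")
      case True
      then have "j \<in> V" "nth0 L j \<noteq> Suc (nth0 L' j)" using u tn(1)[of j] by (auto simp: C_def U_def split: if_splits)
      then have "nth0 L' (Suc j) < nth0 L' j" by (rule stay)
      then show ?thesis using h num_above_least[OF ge] fun_cong[OF C'] True by simp
    next
      case False
      then have "u \<in> U' j - C' j" using u by (auto simp: C_def U_def split: if_splits)
      moreover from this have "t \<le> u" using gt[of u j] by simp
      ultimately show ?thesis using cd by (simp add: above coldata_def)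
    qed
  qed
  show "has_weight U m"
    unfolding has_weight_def
  proof
    fix x
    show "count m x = card {j. x \<in> U j}"
    proof (cases "x = t")
      case True
      then show ?thesis using tU V(2) by simp
    next
      case False
      then have "{j. x \<in> U j} = {j. x \<in> U' j}" by (auto simp: U_def)
      moreover have "count (filter_mset (\<lambda>x. x \<noteq> t) m) x = count m x" using False by simp
      ultimately show ?thesis using wt by (simp add: has_weight_def)
    qed
  qed
qed

lemma num_heights_remove:
  assumes m: "\<forall>x\<in>#m. t \<le> x" and t: "1 \<le> t" and L: "L \<in> height_lists n B"
  shows "num_heights L m = (\<Sum>L'\<in>height_lists n B.
    num_heights L' (filter_mset (\<lambda>x. x \<noteq> t) m) * num_letter_columns L' L (count m t))"
proof -
  let ?m = "filter_mset (\<lambda>x. x \<noteq> t) m"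
  let ?X = "\<lambda>L m. {(C, U). (C, U) \<in> coldata \<and> has_weight U m \<and> (\<forall>j. card (C j) = nth0 L j)}"
  let ?W = "\<lambda>L'. {V \<in> letter_columns L' L. card V = count m t}"
  let ?S = "SIGMA L':height_lists n B. ?X L' ?m \<times> ?W L'"
  let ?f = "\<lambda>(C, U). (map (\<lambda>j. card (C j - {t})) [0..<n],
    (\<lambda>j. C j - {t :: nat}, \<lambda>j. U j - {t}), {j :: nat. t \<in> U j})"
  let ?g = "\<lambda>(L', (C', U'), V). (\<lambda>j. C' j \<union> (if nth0 L j = Suc (nth0 L' j) then {t} else {}),
    \<lambda>j. U' j \<union> (if j \<in> V then {t} else {}))"
  have fin: "finite (?X L' m')" for L' m'
    by (rule finite_subset[OF _ finite_coldata_weight[of m']]) auto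
  have "bij_betw ?f (?X L m) ?S"
  proof (rule bij_betw_byWitness[where f' = ?g])
    show "?f ` ?X L m \<subseteq> ?S"
    proof
      fix z assume "z \<in> ?f ` ?X L m"
      then obtain C U where z: "z = ?f (C, U)" and cd: "(C, U) \<in> coldata" and wt: "has_weight U m"
        and h: "\<forall>j. card (C j) = nth0 L j" by auto
      show "z \<in> ?S"
        unfolding z prod.case
        by (intro SigmaI CollectI case_prodI conjI) (rule remove_least_letter[OF cd wt m h L])+
    qed
    show "?g ` ?S \<subseteq> ?X L m"
    proof
      fix z assume "z \<in> ?g ` ?S"
      then obtain L' C' U' V where z: "z = ?g (L', (C', U'), V)" and cd: "(C', U') \<in> coldata"
        and wt: "has_weight U' ?m" and h: "\<forall>j. card (C' j) = nth0 L' j"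
        and V: "V \<in> letter_columns L' L" "card V = count m t" by auto
      show "z \<in> ?X L m"
        unfolding z prod.case
        by (intro CollectI case_prodI conjI) (rule add_least_letter[OF cd wt m t h L V])+
    qed
    show "\<forall>z\<in>?S. ?f (?g z) = z"
    proof
      fix z assume "z \<in> ?S"
      then obtain L' C' U' V where z: "z = (L', (C', U'), V)" and cd: "(C', U') \<in> coldata"
        and wt: "has_weight U' ?m" and h: "\<forall>j. card (C' j) = nth0 L' j"
        and V: "V \<in> letter_columns L' L" "card V = count m t" by auto
      show "?f (?g z) = z" unfolding z prod.case
        unfolding add_least_letter(4-6)[OF cd wt m t h L V] add_least_letter(7)[OF cd wt m t h L V, symmetric] ..
    qed
    show "\<forall>z\<in>?X L m. ?g (?f z) = z"
    proof
      fix z assume "z \<in> ?X L m"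
      then obtain C U where z: "z = (C, U)" and cd: "(C, U) \<in> coldata" and wt: "has_weight U m"
        and h: "\<forall>j. card (C j) = nth0 L j" by auto
      define L' where "L' = map (\<lambda>j. card (C j - {t})) [0..<n]"
      note r = remove_least_letter[OF cd wt m h L, folded L'_def]
      have finC: "finite (C j)" for j using cd by (auto simp: coldata_def intro: finite_subset)
      have L: "nth0 L j = card (C j)" "nth0 L' j = card (C j - {t})" for j
        using h r(4) by simp_all
      have "C j - {t} \<union> (if nth0 L j = Suc (nth0 L' j) then {t} else {}) = C j" for j
      \<comment> \<open>The heights tell whether \<open>t\<close> was an anchor: its removal lowers
        the height of column \<open>j\<close> exactly in that case.\<close>
      proof (cases "t \<in> C j")
        case True
        then have "nth0 L j = Suc (nth0 L' j)"
          unfolding L by (rule card.remove[OF finC])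
        then show ?thesis using True by auto
      next
        case False
        then have "nth0 L j = nth0 L' j"
          unfolding L by simp
        then show ?thesis using False by simp
      qed
      moreover have "U j - {t} \<union> (if j \<in> {j. t \<in> U j} then {t} else {}) = U j" for j by auto
      ultimately show "?g (?f z) = z" unfolding z prod.case L'_def[symmetric] by simp
    qed
  qed
  then have "card (?X L m) = card ?S" by (rule bij_betw_same_card)
  also have "\<dots> = (\<Sum>L'\<in>height_lists n B. card (?X L' ?m \<times> ?W L'))"
    using finite_height_lists fin finite_letter_columns by (intro card_SigmaI) auto
  finally show ?thesis
    by (simp add: num_heights_def num_data_def num_letter_columns_def card_cartesian_product)
qed

section \<open>Symmetry in the letters of the number of column data with given heights\<close>

lemma count_image_mset_injective:
  assumes "inj_on f S" "set_mset m \<subseteq> S" "x \<in> S"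
  shows "count (image_mset f m) (f x) = count m x"
  using assms(2) by (induction m) (use assms(1,3) in \<open>auto dest: inj_onD\<close>)

text \<open>Supplies the sortedness needed for commutation: for other lists the count is 0, so their
  summands vanish anyway.\<close>

lemma num_heights_sorted:
  assumes "num_heights L m \<noteq> 0" "L \<in> height_lists n B"
  shows "sorted_wrt (\<ge>) L"
proof -
  have "{(C, U). (C, U) \<in> coldata \<and> has_weight U m \<and> (\<forall>j. card (C j) = nth0 L j)} \<noteq> {}"
    using assms(1) unfolding num_heights_def num_data_def by (metis card.empty)
  then obtain C U where cd: "(C, U) \<in> coldata" and h: "\<forall>j. card (C j) = nth0 L j" by blast
  have pos: "C j \<subseteq> {1..}" for j using cd by (auto simp: coldata_def)
  have "nth0 L j \<le> nth0 L i" if "i \<le> j" for i j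
    using coldata_column_antimono[OF cd that, of 0] h by (simp add: num_above_0[OF pos])
  note le = this
  show ?thesis
    unfolding sorted_wrt_iff_nth_less
  proof (intro allI impI)
    fix i j assume "i < j" "j < length L"
    then show "L ! j \<le> L ! i" using le[of i j] by (simp add: nth0_def)
  qed
qed

text \<open>Removing \<open>t\<close> and then \<open>Suc t\<close> expresses the count by a product
  of two transfer matrices applied to the remaining letters. The transposition leaves those letters
  alone and exchanges the two multiplicities, so commutation applies.\<close>

lemma num_heights_swap_least:
  assumes m: "\<forall>x\<in>#m. t \<le> x" and t: "1 \<le> t" and L: "L \<in> height_lists n B"
  shows "num_heights L (image_mset (transpose t (Suc t)) m) = num_heights L m"
proof -
  let ?\<H> = "height_lists n B" and ?rest = "filter_mset (\<lambda>x. x \<noteq> Suc t) \<circ> filter_mset (\<lambda>x. x \<noteq> t)"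
  have two: "num_heights L m = (\<Sum>\<nu>\<in>?\<H>. \<Sum>\<mu>\<in>?\<H>. num_heights \<mu> (?rest m) *
      (num_letter_columns \<mu> \<nu> (count m (Suc t)) * num_letter_columns \<nu> L (count m t)))"
    if m: "\<forall>x\<in>#m. t \<le> x" for m
  proof -
    have "\<forall>x\<in>#filter_mset (\<lambda>x. x \<noteq> t) m. Suc t \<le> x" using m by (auto simp: Suc_le_eq le_less)
    then have "num_heights \<nu> (filter_mset (\<lambda>x. x \<noteq> t) m) = (\<Sum>\<mu>\<in>?\<H>. num_heights \<mu> (?rest m) *
        num_letter_columns \<mu> \<nu> (count m (Suc t)))" if "\<nu> \<in> ?\<H>" for \<nu>
      using num_heights_remove[of "filter_mset (\<lambda>x. x \<noteq> t) m" "Suc t", OF _ _ that] by simp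
    then show ?thesis
      unfolding num_heights_remove[OF m t L] by (simp add: sum_distrib_right mult.assoc)
  qed
  let ?m = "image_mset (transpose t (Suc t)) m"
  have m': "\<forall>x\<in>#?m. t \<le> x" using m by (auto simp: transpose_def)
  have count: "count ?m (transpose t (Suc t) x) = count m x" for x
    by (rule count_image_mset_injective[where S = UNIV]) simp_all
  have "count ?m x = count m x" if "x \<noteq> t" "x \<noteq> Suc t" for x
    using count[of x] that by simp
  then have rest: "?rest ?m = ?rest m" by (auto simp: multiset_eq_iff)
  have "num_heights L ?m = (\<Sum>\<nu>\<in>?\<H>. \<Sum>\<mu>\<in>?\<H>. num_heights \<mu> (?rest m) *
      (num_letter_columns \<mu> \<nu> (count m t) * num_letter_columns \<nu> L (count m (Suc t))))"
    unfolding two[OF m'] rest using count[of t] count[of "Suc t"] by simp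
  also have "\<dots> = (\<Sum>\<mu>\<in>?\<H>. num_heights \<mu> (?rest m) *
      (\<Sum>\<nu>\<in>?\<H>. num_letter_columns \<mu> \<nu> (count m t) * num_letter_columns \<nu> L (count m (Suc t))))"
    by (subst sum.swap) (simp only: sum_distrib_left)
  also have "\<dots> = (\<Sum>\<mu>\<in>?\<H>. num_heights \<mu> (?rest m) *
      (\<Sum>\<nu>\<in>?\<H>. num_letter_columns \<mu> \<nu> (count m (Suc t)) * num_letter_columns \<nu> L (count m t)))"
  proof (rule sum.cong[OF refl])
    fix \<mu> assume \<mu>: "\<mu> \<in> ?\<H>"
    show "num_heights \<mu> (?rest m) *
        (\<Sum>\<nu>\<in>?\<H>. num_letter_columns \<mu> \<nu> (count m t) * num_letter_columns \<nu> L (count m (Suc t))) =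
      num_heights \<mu> (?rest m) *
        (\<Sum>\<nu>\<in>?\<H>. num_letter_columns \<mu> \<nu> (count m (Suc t)) * num_letter_columns \<nu> L (count m t))"
    proof (cases "num_heights \<mu> (?rest m) = 0")
      case False
      show ?thesis
        unfolding num_letter_columns_commute[OF \<mu> L num_heights_sorted[OF False \<mu>], of "count m t"] ..
    qed simp
  qed
  also have "\<dots> = num_heights L m"
    unfolding two[OF m] by (subst sum.swap) (simp only: sum_distrib_left)
  finally show ?thesis .
qed

text \<open>Letters smaller than \<open>t\<close> are removed beforehand. The transposition fixes
  them and their multiplicities, so the recursion of \<open>num_heights_remove\<close> has the same
  coefficients for both monomials. The induction lowers the bound \<open>s'\<close> on the letters,
  starting from \<open>t\<close>.\<close>

lemma num_heights_swap_adjacent: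
  assumes t: "1 \<le> t" and L: "L \<in> height_lists n B" and m: "\<forall>x\<in>#m. 1 \<le> x"
  shows "num_heights L (image_mset (transpose t (Suc t)) m) = num_heights L m"
proof -
  have "\<forall>L\<in>height_lists n B. \<forall>m. (\<forall>x\<in>#m. s' \<le> x) \<longrightarrow>
      num_heights L (image_mset (transpose t (Suc t)) m) = num_heights L m" if "1 \<le> s'" "s' \<le> t" for s'
    using that(2)
  proof (induction s' rule: inc_induct)
    case base
    then show ?case using num_heights_swap_least t by blast
  next
    case (step s)
    show ?case
    proof (intro ballI allI impI)
      fix L m assume L: "L \<in> height_lists n B" and m: "\<forall>x\<in>#m. s \<le> x"
      let ?\<tau> = "transpose t (Suc t)" and ?f = "filter_mset (\<lambda>x. x \<noteq> s)"
      have s: "1 \<le> s" using step.hyps \<open>1 \<le> s'\<close> by simp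
      have eq: "?\<tau> x = s \<longleftrightarrow> x = s" for x using step.hyps by (auto simp: transpose_def)
      have m': "\<forall>x\<in>#image_mset ?\<tau> m. s \<le> x" using m step.hyps by (auto simp: transpose_def)
      have "count (image_mset ?\<tau> m) (?\<tau> s) = count m s" by (rule count_image_mset_injective[where S = UNIV]) simp_all
      then have count: "count (image_mset ?\<tau> m) s = count m s" using eq[of s] by simp
      have filter: "?f (image_mset ?\<tau> m) = image_mset ?\<tau> (?f m)"
        by (simp add: filter_mset_image_mset eq)
      have "\<forall>x\<in>#?f m. Suc s \<le> x" using m by (auto simp: Suc_le_eq le_less)
      then have "num_heights L' (image_mset ?\<tau> (?f m)) = num_heights L' (?f m)"
        if "L' \<in> height_lists n B" for L'
        using step.IH that by blast
      then show "num_heights L (image_mset ?\<tau> m) = num_heights L m"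
        unfolding num_heights_remove[OF m' s L] num_heights_remove[OF m s L] count filter by simp
    qed
  qed
  then show ?thesis using assms by blast
qed

lemma num_data_0: "0 \<in># m \<Longrightarrow> num_data R m = 0"
proof -
  assume 0: "0 \<in># m"
  have "\<not> has_weight U m" if cd: "(C, U) \<in> coldata" for C U
  proof
    assume "has_weight U m"
    then obtain j where "0 \<in> U j" using has_weight_mem[OF cd] 0 by blast
    moreover have "U j \<subseteq> {1..}" using cd by (auto simp: coldata_def)
    ultimately show False by auto
  qed
  then have "{(C, U). (C, U) \<in> coldata \<and> has_weight U m \<and> R C} = {}" by blast
  then show ?thesis unfolding num_data_def by (simp only: card.empty)
qed

text \<open>Conjugation: exchanging \<open>a\<close> and \<open>Suc b\<close> is exchanging
  \<open>a\<close> and \<open>b\<close>, then \<open>b\<close> and \<open>Suc b\<close>, then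
  \<open>a\<close> and \<open>b\<close> again.\<close>

lemma num_heights_swap:
  assumes "1 \<le> a" "a < b" "\<forall>x\<in>#m. 1 \<le> x"
  shows "num_heights L (image_mset (transpose a b) m) = num_heights L m"
proof -
  have L: "L \<in> height_lists (length L) (Max (insert 0 (set L)))"
    by (auto simp: height_lists_def)
  show ?thesis
    using assms(2,3)
  proof (induction b arbitrary: m)
    case (Suc b)
    show ?case
    proof (cases "a = b")
      case True
      then show ?thesis using num_heights_swap_adjacent[OF assms(1) L Suc.prems(2)] by simp
    next
      case False
      then have ab: "a < b" using Suc.prems by simp
      let ?\<tau> = "transpose a b" and ?\<sigma> = "transpose b (Suc b)"
      have pos: "\<forall>x\<in>#image_mset ?\<tau> m'. 1 \<le> x" "\<forall>x\<in>#image_mset ?\<sigma> m'. 1 \<le> x"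
        if "\<forall>x\<in>#m'. 1 \<le> x" for m'
        using that assms(1) ab by (auto simp: transpose_def)
      have "transpose a (Suc b) = ?\<tau> \<circ> ?\<sigma> \<circ> ?\<tau>"
        using ab by (intro transpose_comp_triple[symmetric]) auto
      then have "image_mset (transpose a (Suc b)) m = image_mset ?\<tau> (image_mset ?\<sigma> (image_mset ?\<tau> m))"
        by (simp add: multiset.map_comp comp_assoc)
      also have "num_heights L \<dots> = num_heights L (image_mset ?\<sigma> (image_mset ?\<tau> m))"
        by (rule Suc.IH[OF ab pos(2)[OF pos(1)[OF Suc.prems(2)]]])
      also have "\<dots> = num_heights L (image_mset ?\<tau> m)"
        by (rule num_heights_swap_adjacent[OF _ L pos(1)[OF Suc.prems(2)]]) (use ab in simp)
      also have "\<dots> = num_heights L m" by (rule Suc.IH[OF ab Suc.prems(2)])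
      finally show ?thesis .
    qed
  qed simp
qed

text \<open>Permutations are products of transpositions. Monomials with the index 0 are treated
  apart: \<pi> fixes 0, and both counts are 0.\<close>

lemma num_heights_permute:
  assumes "finite S" "S \<subseteq> {1..}" "\<pi> permutes S"
  shows "num_heights L (image_mset \<pi> m) = num_heights L m"
proof (cases "0 \<in># m")
  case True
  have "\<pi> 0 = 0" using assms by (auto simp: permutes_def)
  then have "0 \<in># image_mset \<pi> m" using True by force
  then show ?thesis using True by (simp add: num_heights_def num_data_0)
next
  case False
  have pos: "\<forall>x\<in>#image_mset p m. 1 \<le> x" if "p permutes S" for p
  proof -
    have "p x \<noteq> 0" if "x \<noteq> 0" for x
      using permutes_in_image[OF \<open>p permutes S\<close>, of x] permutes_not_in[OF \<open>p permutes S\<close>, of x] assms(2) that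
      by (cases "x \<in> S") (force, simp)
    then show ?thesis using False by (auto simp: Suc_le_eq) (metis not_gr_zero)
  qed
  show ?thesis
    using assms(3,1)
  proof (induction \<pi> rule: permutes_induct)
    case id
    then show ?case by simp
  next
    case (swap a b p)
    have "num_heights L (image_mset (transpose a b) (image_mset p m)) = num_heights L (image_mset p m)"
    proof (rule linorder_cases[of a b])
      assume "a < b"
      then show ?thesis using swap assms(2) by (intro num_heights_swap pos) auto
    next
      assume "b < a"
      then have "num_heights L (image_mset (transpose b a) (image_mset p m)) = num_heights L (image_mset p m)"
        using swap assms(2) by (intro num_heights_swap pos) auto
      then show ?thesis by (simp add: transpose_commute)
    qed simp
    then show ?case using swap by (simp only: multiset.map_comp)
  qed
qed

section \<open>Symmetry and quasisymmetry\<close>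

lemma card_row_length: "card {i. j < row_length \<gamma> i} = length (filter (\<lambda>a. j < a) \<gamma>)"
proof -
  have "{i. j < row_length \<gamma> i} = Suc ` {k. k < length \<gamma> \<and> j < \<gamma> ! k}"
  proof (intro equalityI subsetI)
    fix i assume "i \<in> {i. j < row_length \<gamma> i}"
    then show "i \<in> Suc ` {k. k < length \<gamma> \<and> j < \<gamma> ! k}"
      by (intro image_eqI[of _ _ "i - 1"]) (auto simp: row_length_def part_def split: if_splits)
  qed (auto simp: row_length_def part_def)
  then show ?thesis by (simp add: length_filter_conv_card card_image)
qed

lemma positive_list_weak_composition: "\<forall>a\<in>set \<alpha>. 0 < a \<Longrightarrow> \<alpha> \<in> weak_compositions"
  unfolding weak_compositions_def using last_in_set by force

lemma sort_parts_partition: "sort_parts \<gamma> \<in> partitions"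
proof -
  have "sorted_wrt (\<ge>) (sort_parts \<gamma>)"
    by (simp add: sort_parts_def sorted_wrt_rev)
  moreover have "\<forall>a\<in>set (sort_parts \<gamma>). 0 < a" by (auto simp: sort_parts_def flatten_def)
  ultimately show ?thesis by (simp add: partitions_def positive_list_weak_composition)
qed

lemma sum_list_flatten: "sum_list (flatten \<gamma>) = sum_list \<gamma>"
  unfolding flatten_def by (induction \<gamma>) auto

lemma sum_list_sort_parts: "sum_list (sort_parts \<gamma>) = sum_list \<gamma>"
proof -
  have "sum_list (sort_parts \<gamma>) = sum_list (flatten \<gamma>)"
    unfolding sort_parts_def by (metis mset_rev mset_sort sum_mset_sum_list)
  then show ?thesis by (simp add: sum_list_flatten)
qed

text \<open>The column heights are the conjugate partition, which does not see the order of the rows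
  and determines a partition.\<close>

lemma sort_parts_eq_iff:
  assumes "\<mu> \<in> partitions"
  shows "sort_parts \<gamma> = \<mu> \<longleftrightarrow> (\<forall>j. card {i. j < row_length \<gamma> i} = card {i. j < row_length \<mu> i})"
proof -
  have h: "card {i. j < row_length (sort_parts \<gamma>) i} = card {i. j < row_length \<gamma> i}" for j
  proof -
    have "length (filter (\<lambda>a. j < a) (sort_parts \<gamma>)) = size (filter_mset (\<lambda>a. j < a) (mset (sort_parts \<gamma>)))"
      by (simp flip: mset_filter)
    also have "mset (sort_parts \<gamma>) = filter_mset (\<lambda>a. 0 < a) (mset \<gamma>)"
      by (simp add: sort_parts_def flatten_def)
    also have "filter_mset (\<lambda>a. j < a) \<dots> = mset (filter (\<lambda>a. j < a) \<gamma>)"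
      by (auto simp: filter_filter_mset intro!: filter_mset_cong)
    finally show ?thesis by (simp only: card_row_length size_mset)
  qed
  have "sort_parts \<gamma> = \<mu>" if "\<forall>j. card {i. j < row_length (sort_parts \<gamma>) i} = card {i. j < row_length \<mu> i}"
  proof (rule row_length_inj)
    show "sort_parts \<gamma> \<in> weak_compositions" "\<mu> \<in> weak_compositions"
      using sort_parts_partition[of \<gamma>] assms by (auto simp: partitions_def)
    have "{i. j < row_length (sort_parts \<gamma>) i} = {i. j < row_length \<mu> i}" for j
      using row_length_partition[OF sort_parts_partition, of j \<gamma>] row_length_partition[OF assms, of j] that
      by simp
    then have "j < row_length (sort_parts \<gamma>) i \<longleftrightarrow> j < row_length \<mu> i" for i j by blast
    then show "row_length (sort_parts \<gamma>) = row_length \<mu>"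
      by (intro ext) (metis linorder_neqE_nat less_irrefl)
  qed
  then show ?thesis using h by auto
qed

lemma card_column:
  assumes "arrangement p A"
  shows "card (column p A j) = card {i. j < p i}"
  using assms by (simp add: column_def arrangement_def card_image)

lemma card_coldata_column:
  assumes "(C, U) \<in> coldata"
  shows "card (C j) = card {i. j < row_length (shape_of C) i}"
proof -
  have "has_shape (shape_of C) C" using has_shape_iff[OF assms] shape_of_weak_composition[OF assms] by simp
  then obtain A where "arrangement (row_length (shape_of C)) A" "column (row_length (shape_of C)) A = C"
    by (auto simp: has_shape_def)
  then show ?thesis using card_column by metis
qed

lemma grothendieck_eq_lin_comb:
  assumes "\<mu> \<in> partitions"
  shows "grothendieck \<mu> = lin_comb {\<gamma> \<in> weak_compositions. sort_parts \<gamma> = \<mu>} (\<lambda>_. 1) lascoux_atom"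
proof
  fix m
  have "num_data (\<lambda>C. sort_parts (shape_of C) = \<mu>) m =
      num_data (\<lambda>C. \<forall>j. card (C j) = card {i. j < row_length \<mu> i}) m"
    by (rule num_data_cong) (simp add: sort_parts_eq_iff[OF assms] card_coldata_column)
  moreover have "sum_list \<gamma> = sum_list \<mu>" if "sort_parts \<gamma> = \<mu>" for \<gamma>
    using that sum_list_sort_parts by metis
  ultimately show "grothendieck \<mu> m =
      lin_comb {\<gamma> \<in> weak_compositions. sort_parts \<gamma> = \<mu>} (\<lambda>_. 1) lascoux_atom m"
    by (simp add: grothendieck_eq[OF assms] lin_comb_lascoux_fibre[where g = sort_parts and s = "sum_list \<mu>"])
qed

lemma grothendieck_permute:
  assumes "\<mu> \<in> partitions" "finite S" "S \<subseteq> {1..}" "\<pi> permutes S"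
  shows "grothendieck \<mu> (image_mset \<pi> m) = grothendieck \<mu> m"
proof -
  \<comment> \<open>No part exceeds \<open>sum_list \<mu>\<close>, so this list includes every
    nonempty column.\<close>
  define L where "L = map (\<lambda>j. card {i. j < row_length \<mu> i}) [0..<sum_list \<mu>]"
  have "card {i. j < row_length \<mu> i} = nth0 L j" for j
  proof (cases "j < sum_list \<mu>")
    case False
    have "filter (\<lambda>a. j < a) \<mu> = []" using False member_le_sum_list by (fastforce simp: filter_empty_conv)
    then show ?thesis using False by (simp add: card_row_length nth0_def L_def)
  qed (simp add: nth0_def L_def)
  then have "num_data (\<lambda>C. \<forall>j. card (C j) = card {i. j < row_length \<mu> i}) m = num_heights L m" for m
    by (simp add: num_heights_def)
  then show ?thesis using num_heights_permute[OF assms(2-4)] by (simp add: grothendieck_eq[OF assms(1)])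
qed

section \<open>Increasing relabelling of the letters\<close>

lemma sorted_list_of_set_image:
  fixes \<phi> :: "nat \<Rightarrow> nat"
  assumes "finite S" "strict_mono_on S \<phi>"
  shows "sorted_list_of_set (\<phi> ` S) = map \<phi> (sorted_list_of_set S)"
proof (rule sorted_distinct_set_unique)
  have "sorted_wrt (<) (sorted_list_of_set S)" by simp
  then have "sorted_wrt (\<lambda>x y. \<phi> x \<le> \<phi> y) (sorted_list_of_set S)"
    by (rule sorted_wrt_mono_rel[rotated])
      (use assms in \<open>auto simp: strict_mono_on_def less_imp_le\<close>)
  then show "sorted (map \<phi> (sorted_list_of_set S))" by (simp add: sorted_wrt_map)
  show "distinct (map \<phi> (sorted_list_of_set S))"
    using assms by (simp add: distinct_map strict_mono_on_imp_inj_on)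
qed (use assms in simp_all)

lemma sorted_list_of_set_rows:
  "sorted_list_of_set {i. 0 < row_length \<gamma> i} = filter (\<lambda>i. 0 < row_length \<gamma> i) [1..<length \<gamma> + 1]"
proof (rule sorted_distinct_set_unique)
  show "set (sorted_list_of_set {i. 0 < row_length \<gamma> i}) =
      set (filter (\<lambda>i. 0 < row_length \<gamma> i) [1..<length \<gamma> + 1])"
    using finite_row_length[of 0 \<gamma>] by (auto dest: row_length_pos)
qed (simp_all only: sorted_sorted_list_of_set distinct_sorted_list_of_set sorted_wrt_filter
      sorted_upt distinct_filter distinct_upt)

lemma map_row_length: "map (row_length \<gamma>) [1..<length \<gamma> + 1] = \<gamma>"
  by (intro nth_equalityI) (auto simp: row_length_def part_def simp del: upt_Suc)

lemma flatten_eq: "flatten \<gamma> = map (row_length \<gamma>) (sorted_list_of_set {i. 0 < row_length \<gamma> i})"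
proof -
  have "flatten \<gamma> = filter (\<lambda>a. 0 < a) (map (row_length \<gamma>) [1..<length \<gamma> + 1])"
    unfolding map_row_length flatten_def ..
  then show ?thesis unfolding sorted_list_of_set_rows by (simp add: filter_map o_def)
qed

lemma num_above_relabel:
  assumes "strict_mono_on I \<phi>" "X \<subseteq> I" "u \<in> I"
  shows "num_above (\<phi> ` X) (\<phi> u) = num_above X u"
proof -
  have "{a \<in> \<phi> ` X. \<phi> u < a} = \<phi> ` {a \<in> X. u < a}"
    using assms by (auto simp: strict_mono_on_less subset_iff)
  moreover have "inj_on \<phi> {a \<in> X. u < a}"
    using strict_mono_on_imp_inj_on[OF assms(1)] by (rule inj_on_subset) (use assms(2) in auto)
  ultimately show ?thesis by (simp add: num_above_def card_image)
qed

text \<open>The threshold \<open>x\<close> need not be a relabelled letter. It is replaced by the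
  least \<open>d\<close> in \<open>D\<close> with \<phi> \<open>d\<close> above \<open>x\<close>,
  and the old interlacing is used at \<open>d\<close>, in its weak form.\<close>

lemma num_above_relabel_mono:
  assumes \<phi>: "strict_mono_on I \<phi>" and sub: "C \<subseteq> I" "D \<subseteq> I" and fin: "finite C" "finite D"
    and D: "D \<subseteq> {1..}" and le: "\<And>x. num_above D x \<le> num_above C x"
  shows "num_above (\<phi> ` D) x \<le> num_above (\<phi> ` C) x"
proof (cases "{d \<in> D. x < \<phi> d} = {}")
  case True
  then have "{a \<in> \<phi> ` D. x < a} = {}" by blast
  then show ?thesis unfolding num_above_def by (simp only: card.empty)
next
  case False
  define d where "d = Min {d \<in> D. x < \<phi> d}"
  have d: "d \<in> D" "x < \<phi> d" using Min_in[OF _ False] fin(2) unfolding d_def by auto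
  have le': "\<phi> d \<le> \<phi> e" if "d \<le> e" "e \<in> I" for e
    using strict_mono_on_leD[OF \<phi>, of d e] that d sub by blast
  have "{a \<in> \<phi> ` D. x < a} \<subseteq> \<phi> ` {e \<in> D. d \<le> e}"
    using Min_le[of "{d \<in> D. x < \<phi> d}"] fin(2) unfolding d_def by auto
  then have "num_above (\<phi> ` D) x \<le> card (\<phi> ` {e \<in> D. d \<le> e})"
    unfolding num_above_def using fin(2) by (intro card_mono) auto
  also have "\<dots> \<le> card {e \<in> D. d \<le> e}" using fin(2) by (intro card_image_le) simp
  also have "\<dots> \<le> card {c \<in> C. d \<le> c}"
    using D d(1) by (intro interlace_above_eq[OF le]) auto
  also have "\<dots> = card (\<phi> ` {c \<in> C. d \<le> c})"
    by (rule card_image[symmetric], rule inj_on_subset[OF strict_mono_on_imp_inj_on[OF \<phi>]])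
      (use sub in auto)
  also have "\<dots> \<le> num_above (\<phi> ` C) x"
    unfolding num_above_def using fin(1) le' d(2) sub(1)
    by (intro card_mono) (auto intro: less_le_trans)
  finally show ?thesis .
qed

lemma relabel_coldata:
  assumes cd: "(C, U) \<in> coldata" and \<phi>: "strict_mono_on I \<phi>" and I: "\<And>j. U j \<subseteq> I" and pos: "\<phi> ` I \<subseteq> {1..}"
  shows "(\<lambda>j. \<phi> ` C j, \<lambda>j. \<phi> ` U j) \<in> coldata"
  unfolding coldata_def mem_Collect_eq prod.case
proof (intro conjI allI ballI)
  have fin: "finite (U j)" "finite (C j)" and sub: "C j \<subseteq> U j" "U j \<subseteq> {1..}" for j
    using cd by (auto simp: coldata_def intro: finite_subset)
  have CI: "C j \<subseteq> I" for j using sub(1)[of j] I[of j] by simp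
  fix j
  show "finite (\<phi> ` U j)" using fin by simp
  show "\<phi> ` C j \<subseteq> \<phi> ` U j" using sub(1) by (rule image_mono)
  show "\<phi> ` U j \<subseteq> {1..}" using image_mono[OF I[of j], of \<phi>] pos by (rule subset_trans)
  show "\<exists>n. \<forall>j\<ge>n. \<phi> ` C j = {}" using cd by (auto simp: coldata_def)
  show "num_above (\<phi> ` C (Suc j)) x \<le> num_above (\<phi> ` C j) x" for x
  proof (rule num_above_relabel_mono[OF \<phi> CI CI fin(2) fin(2)])
    show "C (Suc j) \<subseteq> {1..}" using sub by blast
    show "num_above (C (Suc j)) x \<le> num_above (C j) x" for x using cd by (auto simp: coldata_def)
  qed
  show "num_above (\<phi> ` C (Suc j)) u < num_above (\<phi> ` C j) u" if u: "u \<in> \<phi> ` U j - \<phi> ` C j" for u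
  proof -
    obtain v where v: "u = \<phi> v" "v \<in> U j" using u by blast
    then have "v \<in> U j - C j" using u by blast
    then have "num_above (C (Suc j)) v < num_above (C j) v" using cd by (auto simp: coldata_def)
    moreover have "v \<in> I" using v I by blast
    ultimately show ?thesis unfolding v(1) by (simp only: num_above_relabel[OF \<phi> CI])
  qed
qed

lemma relabel_weight:
  assumes wt: "has_weight U m" and inj: "inj_on \<phi> (set_mset m)" and sub: "\<And>j. U j \<subseteq> set_mset m"
  shows "has_weight (\<lambda>j. \<phi> ` U j) (image_mset \<phi> m)"
  unfolding has_weight_def
proof
  fix y
  show "count (image_mset \<phi> m) y = card {j. y \<in> \<phi> ` U j}"
  proof (cases "y \<in> \<phi> ` set_mset m")
    case True
    then obtain x where x: "y = \<phi> x" "x \<in># m" by blast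
    have "{j. y \<in> \<phi> ` U j} = {j. x \<in> U j}"
      using x inj_on_image_mem_iff[OF inj x(2) sub] by simp
    then show ?thesis
      using wt count_image_mset_injective[OF inj subset_refl x(2)] x(1) by (simp add: has_weight_def)
  next
    case False
    then have "{j. y \<in> \<phi> ` U j} = {}" using sub by blast
    moreover have "count (image_mset \<phi> m) y = 0" using False by (simp add: count_eq_zero_iff)
    ultimately show ?thesis by simp
  qed
qed

text \<open>The row number is the first anchor of the row, so relabelling moves row \<open>i\<close>
  to row \<phi> \<open>i\<close>. The greedy condition only compares letters and survives; by
  uniqueness the moved arrangement gives the new shape. As \<phi> is increasing, the nonempty rows
  keep their order and lengths.\<close>

lemma relabel_flatten:
  assumes cd: "(C, U) \<in> coldata" and \<phi>: "strict_mono_on I \<phi>" and I: "\<And>j. U j \<subseteq> I" and pos: "\<phi> ` I \<subseteq> {1..}"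
  shows "flatten (shape_of (\<lambda>j. \<phi> ` C j)) = flatten (shape_of C)"
proof -
  let ?C' = "\<lambda>j. \<phi> ` C j"
  have cd': "(?C', \<lambda>j. \<phi> ` U j) \<in> coldata" by (rule relabel_coldata[OF cd \<phi> I pos])
  have CI: "C j \<subseteq> I" for j using cd I[of j] by (fastforce simp: coldata_def)
  define p where "p = row_length (shape_of C)"
  have "has_shape (shape_of C) C" using has_shape_iff[OF cd] shape_of_weak_composition[OF cd] by simp
  then obtain A where A: "arrangement p A" "greedy p A" "column p A = C"
    by (auto simp: has_shape_def p_def)
  have first: "A i 0 = i" if "0 < p i" for i using A(2) that by (simp add: greedy_def)
  have AI: "A i j \<in> I" if "j < p i" for i j
    using A(3) CI[of j] that by (auto simp: column_def)
  have rowI: "i \<in> I" if "0 < p i" for i using AI[OF that] first[OF that] by simp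
  have inj: "inj_on \<phi> I" by (rule strict_mono_on_imp_inj_on[OF \<phi>])
  define \<psi> where "\<psi> = inv_into I \<phi>"
  have \<psi>: "\<psi> (\<phi> i) = i" if "i \<in> I" for i using that inj by (simp add: \<psi>_def)
  define p' where "p' k = (if k \<in> \<phi> ` I then p (\<psi> k) else 0)" for k
  define A' where "A' k j = \<phi> (A (\<psi> k) j)" for k j
  have p': "p' (\<phi> i) = p i" if "i \<in> I" for i using that \<psi> by (simp add: p'_def)
  have A': "A' (\<phi> i) j = \<phi> (A i j)" if "i \<in> I" for i j using that \<psi> by (simp add: A'_def)
  have row': "\<exists>i\<in>I. k = \<phi> i \<and> j < p i" if "j < p' k" for j k
    using that \<psi> by (auto simp: p'_def split: if_splits)
  have rows': "{k. j < p' k} = \<phi> ` {i. j < p i}" for j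
  proof (intro equalityI subsetI)
    fix k assume "k \<in> \<phi> ` {i. j < p i}"
    then obtain i where i: "k = \<phi> i" "j < p i" by blast
    then have "i \<in> I" by (intro rowI) simp
    then show "k \<in> {k. j < p' k}" using i p' by simp
  qed (use row' in blast)
  have col': "column p' A' j = \<phi> ` C j" for j
  proof -
    have "column p' A' j = (\<lambda>i. A' (\<phi> i) j) ` {i. j < p i}"
      unfolding column_def rows' image_image ..
    also have "\<dots> = (\<lambda>i. \<phi> (A i j)) ` {i. j < p i}"
      using rowI A' by (intro image_cong refl) (auto dest: less_imp_Suc_add)
    finally show ?thesis using A(3) by (auto simp: column_def)
  qed
  have less: "\<phi> a < \<phi> b \<longleftrightarrow> a < b" if "a \<in> I" "b \<in> I" for a b
    using strict_mono_on_less[OF \<phi> that] .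
  have "arrangement p' A'"
    unfolding arrangement_def
  proof (intro conjI allI impI)
    show "finite {i. 0 < p' i}" unfolding rows' using finite_rows[OF A(1)] by simp
    show "0 < A' k j" if k: "j < p' k" for k j
    proof -
      obtain i where i: "i \<in> I" "k = \<phi> i" "j < p i" using row'[OF k] by blast
      then have "A' k j \<in> \<phi> ` I" using A' AI by simp
      then show ?thesis using pos by auto
    qed
    show "A' k (Suc j) \<le> A' k j" if k: "Suc j < p' k" for k j
    proof -
      obtain i where i: "i \<in> I" "k = \<phi> i" "Suc j < p i" using row'[OF k] by blast
      then show ?thesis
        using strict_mono_on_leD[OF \<phi> AI AI, of "Suc j" i j i] arrangement_row_le[OF A(1)] A' by simp
    qed
    show "inj_on (\<lambda>k. A' k j) {k. j < p' k}" for j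
    proof (rule inj_onI)
      fix k l assume "k \<in> {k. j < p' k}" "l \<in> {k. j < p' k}" and eq: "A' k j = A' l j"
      then obtain i i' where i: "i \<in> I" "k = \<phi> i" "j < p i" "i' \<in> I" "l = \<phi> i'" "j < p i'"
        using row' by blast
      then have "\<phi> (A i j) = \<phi> (A i' j)" using eq A' by simp
      then have "A i j = A i' j" by (rule inj_onD[OF inj]) (use AI i in auto)
      moreover have "inj_on (\<lambda>i. A i j) {i. j < p i}" using A(1) by (simp add: arrangement_def)
      ultimately show "k = l" using i inj_onD by fastforce
    qed
  qed
  moreover have "greedy p' A'"
    unfolding greedy_def
  proof (intro conjI allI impI)
    fix k assume "0 < p' k"
    then obtain i where "i \<in> I" "k = \<phi> i" "0 < p i" using row' by blast
    then show "A' k 0 = k" using A' first by simp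
  next
    fix j k l assume h: "k < l \<and> j < p' k \<and> Suc j < p' l"
    obtain i where i: "i \<in> I" "k = \<phi> i" "j < p i" using row' h by blast
    obtain i' where i': "i' \<in> I" "l = \<phi> i'" "Suc j < p i'" using row' h by blast
    have "i < i'" using h i i' less by simp
    from greedyD[OF A(2) this i(3) i'(3)]
    show "A' k j < A' l (Suc j) \<or> Suc j < p' k \<and> A' l (Suc j) < A' k (Suc j)"
    proof
      assume "A i j < A i' (Suc j)"
      then have "A' k j < A' l (Suc j)" using i i' A' less AI by simp
      then show ?thesis ..
    next
      assume *: "Suc j < p i \<and> A i' (Suc j) < A i (Suc j)"
      then have "A' l (Suc j) < A' k (Suc j)" using i i' A' less AI by simp
      then show ?thesis using * i p' by simp
    qed
  qed
  moreover have "has_shape (shape_of ?C') ?C'"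
    using has_shape_iff[OF cd'] shape_of_weak_composition[OF cd'] by simp
  then obtain A'' where "arrangement (row_length (shape_of ?C')) A''" "greedy (row_length (shape_of ?C')) A''"
    "column (row_length (shape_of ?C')) A'' = ?C'" by (auto simp: has_shape_def)
  ultimately have rl: "row_length (shape_of ?C') = p'"
    using col' by (intro greedy_unique(1)) auto
  have S: "{i. 0 < p i} \<subseteq> I" using rowI by blast
  have "strict_mono_on {i. 0 < p i} \<phi>" using \<phi> S by (auto simp: strict_mono_on_def)
  then have "sorted_list_of_set {k. 0 < p' k} = map \<phi> (sorted_list_of_set {i. 0 < p i})"
    unfolding rows' by (intro sorted_list_of_set_image finite_rows[OF A(1)])
  then have "flatten (shape_of ?C') = map (p' \<circ> \<phi>) (sorted_list_of_set {i. 0 < p i})"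
    unfolding flatten_eq rl by simp
  also have "\<dots> = map p (sorted_list_of_set {i. 0 < p i})"
    using p' rowI finite_rows[OF A(1)] by (intro map_cong) auto
  finally show ?thesis unfolding flatten_eq p_def .
qed

text \<open>Relabelling is injective on the data, which gives only an inequality; equality comes
  from relabelling back.\<close>

lemma num_data_relabel_le:
  assumes \<phi>: "strict_mono_on (set_mset m) \<phi>" and pos: "\<phi> ` set_mset m \<subseteq> {1..}"
  shows "num_data (\<lambda>C. flatten (shape_of C) = \<alpha>) m \<le> num_data (\<lambda>C. flatten (shape_of C) = \<alpha>) (image_mset \<phi> m)"
proof -
  let ?X = "\<lambda>m. {(C, U). (C, U) \<in> coldata \<and> has_weight U m \<and> flatten (shape_of C) = \<alpha>}"
  let ?f = "\<lambda>(C, U). (\<lambda>j. \<phi> ` C j, \<lambda>j. \<phi> ` U j) :: (nat \<Rightarrow> nat set) \<times> (nat \<Rightarrow> nat set)"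
  have inj: "inj_on \<phi> (set_mset m)" by (rule strict_mono_on_imp_inj_on[OF \<phi>])
  have sub: "U j \<subseteq> set_mset m" "C j \<subseteq> set_mset m" if "(C, U) \<in> ?X m" for C U j
  proof -
    have "(C, U) \<in> coldata" "has_weight U m" using that by auto
    then show U: "U j \<subseteq> set_mset m" using has_weight_mem by blast
    show "C j \<subseteq> set_mset m" using \<open>(C, U) \<in> coldata\<close> U by (fastforce simp: coldata_def)
  qed
  have "card (?X m) \<le> card (?X (image_mset \<phi> m))"
  proof (rule card_inj_on_le)
    show "finite (?X (image_mset \<phi> m))"
      by (rule finite_subset[OF _ finite_coldata_weight[of "image_mset \<phi> m"]]) auto
    show "inj_on ?f (?X m)"
    proof (rule inj_onI)
      fix x y assume x: "x \<in> ?X m" and y: "y \<in> ?X m" and eq: "?f x = ?f y"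
      obtain C U C' U' where xy: "x = (C, U)" "y = (C', U')" by (cases x, cases y)
      have "C j = C' j" "U j = U' j" for j
        using eq sub[OF x[unfolded xy]] sub[OF y[unfolded xy]] inj_on_image_eq_iff[OF inj]
        unfolding xy by (auto dest: fun_cong[where x = j])
      then show "x = y" unfolding xy by auto
    qed
    show "?f ` ?X m \<subseteq> ?X (image_mset \<phi> m)"
    proof
      fix z assume "z \<in> ?f ` ?X m"
      then obtain C U where z: "z = ?f (C, U)" and CU: "(C, U) \<in> ?X m" by auto
      then have "(C, U) \<in> coldata" "has_weight U m" "flatten (shape_of C) = \<alpha>" by auto
      then show "z \<in> ?X (image_mset \<phi> m)"
        unfolding z using relabel_coldata[OF _ \<phi> sub(1)[OF CU] pos] relabel_weight[OF _ inj sub(1)[OF CU]]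
          relabel_flatten[OF _ \<phi> sub(1)[OF CU] pos] by simp
    qed
  qed
  then show ?thesis by (simp add: num_data_def)
qed

lemma quasi_grothendieck_eq:
  "quasi_grothendieck \<alpha> m =
    monom (int (num_data (\<lambda>C. flatten (shape_of C) = \<alpha>) m)) (size m - sum_list \<alpha>)"
  unfolding quasi_grothendieck_def
  by (rule lin_comb_lascoux_fibre) (use sum_list_flatten in metis)

lemma quasi_grothendieck_relabel:
  assumes \<phi>: "strict_mono_on (set_mset m) \<phi>" and pos: "\<phi> ` set_mset m \<subseteq> {1..}" "set_mset m \<subseteq> {1..}"
  shows "quasi_grothendieck \<alpha> (image_mset \<phi> m) = quasi_grothendieck \<alpha> m"
proof -
  let ?N = "num_data (\<lambda>C. flatten (shape_of C) = \<alpha>)"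
  \<comment> \<open>The inverse relabelling is again increasing, and it takes positive values
    because 0 does not occur in \<open>m\<close>.\<close>
  let ?\<psi> = "inv_into (set_mset m) \<phi>"
  have inj: "inj_on \<phi> (set_mset m)" by (rule strict_mono_on_imp_inj_on[OF \<phi>])
  have "strict_mono_on (set_mset (image_mset \<phi> m)) ?\<psi>"
    by (rule strict_mono_onI) (use inj strict_mono_on_less[OF \<phi>] in auto)
  moreover have "?\<psi> ` set_mset (image_mset \<phi> m) \<subseteq> {1..}" using inj pos(2) by auto
  ultimately have "?N (image_mset \<phi> m) \<le> ?N (image_mset ?\<psi> (image_mset \<phi> m))"
    by (rule num_data_relabel_le)
  also have "image_mset ?\<psi> (image_mset \<phi> m) = m"
    using inj by (simp add: multiset.map_comp cong: image_mset_cong)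
  finally have "?N (image_mset \<phi> m) \<le> ?N m" .
  moreover have "?N m \<le> ?N (image_mset \<phi> m)" by (rule num_data_relabel_le[OF \<phi> pos(1)])
  ultimately show ?thesis by (simp add: quasi_grothendieck_eq)
qed

section \<open>Triangularity\<close>

lemma sum_diagram:
  fixes f :: "nat \<Rightarrow> nat"
  shows "(\<Sum>b\<in>diagram \<gamma>. f (fst b)) = (\<Sum>k<length \<gamma>. f (Suc k) * \<gamma> ! k)"
proof -
  have "diagram \<gamma> = (\<lambda>(k, j). (Suc k, Suc j)) ` (SIGMA k:{..<length \<gamma>}. {..<\<gamma> ! k})"
  proof (intro equalityI subsetI)
    fix b assume "b \<in> diagram \<gamma>"
    then obtain i j where b: "b = (i, Suc j)" "j < row_length \<gamma> i" unfolding diagram_eq by auto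
    moreover have "i = Suc (i - 1)" using row_length_pos[of \<gamma> i] b by simp
    ultimately show "b \<in> (\<lambda>(k, j). (Suc k, Suc j)) ` (SIGMA k:{..<length \<gamma>}. {..<\<gamma> ! k})"
      by (intro image_eqI[of _ _ "(i - 1, j)"]) (auto simp: row_length_def part_def split: if_splits)
  qed (auto simp: row_length_def part_def)
  moreover have "inj_on (\<lambda>(k, j). (Suc k, Suc j)) (SIGMA k:{..<length \<gamma>}. {..<\<gamma> ! k})"
    by (auto intro!: inj_onI)
  ultimately have "(\<Sum>b\<in>diagram \<gamma>. f (fst b)) =
      (\<Sum>(k, j)\<in>(SIGMA k:{..<length \<gamma>}. {..<\<gamma> ! k}). f (Suc k))"
    by (simp add: sum.reindex o_def case_prod_unfold)
  then show ?thesis by (simp flip: sum.Sigma) (simp add: mult.commute)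
qed

lemma card_diagram: "card (diagram \<gamma>) = sum_list \<gamma>"
  using sum_diagram[of "\<lambda>_. 1" \<gamma>] by (simp add: sum_list_sum_nth atLeast0LessThan)

text \<open>This is the monomial with exponent vector \<gamma>, the weight of the filling whose
  boxes in row \<open>i\<close> all contain just \<open>i\<close>.\<close>

definition leading_monomial :: "nat list \<Rightarrow> nat multiset" where
  "leading_monomial \<gamma> = (\<Sum>b\<in>diagram \<gamma>. {#fst b#})"

lemma count_leading_monomial: "count (leading_monomial \<gamma>) i = row_length \<gamma> i"
proof -
  have "count (leading_monomial \<gamma>) i = (\<Sum>k<length \<gamma>. (if Suc k = i then 1 else 0) * \<gamma> ! k)"
    unfolding leading_monomial_def count_sum
    using sum_diagram[of "\<lambda>l. if l = i then 1 else 0" \<gamma>] by (simp cong: if_cong)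
  also have "\<dots> = (\<Sum>k<length \<gamma>. if k = i - 1 \<and> i \<noteq> 0 then \<gamma> ! k else 0)"
    by (intro sum.cong) auto
  also have "\<dots> = row_length \<gamma> i"
    by (cases i) (auto simp: row_length_def part_def)
  finally show ?thesis .
qed

lemma size_leading_monomial: "size (leading_monomial \<gamma>) = sum_list \<gamma>"
  by (simp add: leading_monomial_def card_diagram)

lemma leading_monomial_inj:
  "\<gamma> \<in> weak_compositions \<Longrightarrow> \<delta> \<in> weak_compositions \<Longrightarrow>
    leading_monomial \<gamma> = leading_monomial \<delta> \<Longrightarrow> \<gamma> = \<delta>"
  by (rule row_length_inj) (auto simp flip: count_leading_monomial)

lemma sum_mset_sum:
  fixes M :: "'b \<Rightarrow> nat multiset"
  assumes "finite D"
  shows "sum_mset (\<Sum>b\<in>D. M b) = (\<Sum>b\<in>D. sum_mset (M b))"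
  using assms by (induction D rule: finite_induct) auto

lemma sum_mset_leading_monomial:
  "sum_mset (leading_monomial \<gamma>) = (\<Sum>k<length \<gamma>. Suc k * \<gamma> ! k)"
proof -
  have "sum_mset (leading_monomial \<gamma>) = (\<Sum>b\<in>diagram \<gamma>. fst b)"
    unfolding leading_monomial_def by (simp add: sum_mset_sum[OF finite_diagram])
  then show ?thesis using sum_diagram[of "\<lambda>i. i" \<gamma>] by simp
qed

lemma SetSkyFill_anchor_le:
  assumes F: "F \<in> SetSkyFill \<gamma>" and "j < row_length \<gamma> i"
  shows "Max (F (i, Suc j)) \<le> i"
  using assms(2)
proof (induction j)
  case 0
  then show ?case using SetSkyFill_imp(2)[OF F] by (simp add: greedy_def)
next
  case (Suc j)
  have "arrangement (row_length \<gamma>) (\<lambda>i j. Max (F (i, Suc j)))"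
    using SetSkyFill_imp(1)[OF F] by (simp add: pick_filling_def)
  from arrangement_row_le[OF this Suc.prems] Suc show ?case by simp
qed

lemma SetSkyFill_entry_set:
  assumes F: "F \<in> SetSkyFill \<gamma>" and "b \<in> diagram \<gamma>"
  shows "is_entry_set (F b)" "Max (F b) \<le> fst b"
proof -
  obtain i j where "b = (i, Suc j)" "j < row_length \<gamma> i" using assms(2) unfolding diagram_eq by auto
  then show "is_entry_set (F b)" "Max (F b) \<le> fst b"
    using pick_filling_entry_set[OF SetSkyFill_imp(1)[OF F]] SetSkyFill_anchor_le[OF F] by auto
qed

lemma SetSkyFill_support:
  assumes F: "F \<in> SetSkyFill \<gamma>" and i: "0 < row_length \<gamma> i"
  shows "i \<in># weight (diagram \<gamma>) F"
proof -
  have "Max (F (i, Suc 0)) = i" using SetSkyFill_imp(2)[OF F] i by (simp add: greedy_def)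
  moreover have b: "(i, Suc 0) \<in> diagram \<gamma>" using i by simp
  ultimately have "i \<in> F (i, Suc 0)" "finite (F (i, Suc 0))"
    using SetSkyFill_entry_set(1)[OF F b] Max_in[of "F (i, Suc 0)"] by (auto simp: is_entry_set_def)
  then have "i \<in># mset_set (F (i, Suc 0))" by simp
  then show ?thesis
    unfolding weight_def using finite_diagram b by (subst set_mset_sum) auto
qed

lemma SetSkyFill_size:
  assumes F: "F \<in> SetSkyFill \<gamma>"
  shows "sum_list \<gamma> \<le> size (weight (diagram \<gamma>) F)"
proof -
  have "(\<Sum>b\<in>diagram \<gamma>. 1) \<le> (\<Sum>b\<in>diagram \<gamma>. card (F b))"
    using SetSkyFill_entry_set(1)[OF F]
    by (intro sum_mono) (auto simp: is_entry_set_def Suc_le_eq card_gt_0_iff)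
  then show ?thesis
    unfolding size_weight[OF finite_diagram] num_entries_def using card_diagram[of \<gamma>] by simp
qed

text \<open>In lowest degree every box has one entry, and the entries of row \<open>i\<close> are at
  most \<open>i\<close>. So the sum of all entries is at most that of the leading monomial, with
  equality only if row \<open>i\<close> is constantly \<open>i\<close>.\<close>

lemma SetSkyFill_minimal_size:
  assumes F: "F \<in> SetSkyFill \<gamma>" and size: "size (weight (diagram \<gamma>) F) = sum_list \<gamma>"
  shows "sum_mset (weight (diagram \<gamma>) F) < sum_mset (leading_monomial \<gamma>) \<or> (\<forall>b\<in>diagram \<gamma>. F b = {fst b})"
proof -
  note es = SetSkyFill_entry_set(1)[OF F]
  have "card (F b) = 1" if b: "b \<in> diagram \<gamma>" for b
  proof -
    have "(\<Sum>b\<in>diagram \<gamma>. 1) = (\<Sum>b\<in>diagram \<gamma>. card (F b))"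
      using size unfolding size_weight[OF finite_diagram] num_entries_def by (simp add: card_diagram)
    moreover have "1 \<le> card (F b)" if "b \<in> diagram \<gamma>" for b
      using es[OF that] by (auto simp: is_entry_set_def Suc_le_eq card_gt_0_iff)
    ultimately show ?thesis
      using sum_mono_inv[of "\<lambda>_. 1" "diagram \<gamma>" "\<lambda>b. card (F b)" b] b finite_diagram by simp
  qed
  then have single: "F b = {Max (F b)}" if "b \<in> diagram \<gamma>" for b
    using that by (metis Max_singleton card_1_singletonE)
  have "sum_mset (weight (diagram \<gamma>) F) = (\<Sum>b\<in>diagram \<gamma>. sum_mset (mset_set (F b)))"
    unfolding weight_def by (rule sum_mset_sum[OF finite_diagram])
  also have "\<dots> = (\<Sum>b\<in>diagram \<gamma>. Max (F b))"
  proof (rule sum.cong[OF refl])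
    fix b assume "b \<in> diagram \<gamma>"
    then obtain x where "F b = {x}" using single by blast
    then show "sum_mset (mset_set (F b)) = Max (F b)" by simp
  qed
  finally have w: "sum_mset (weight (diagram \<gamma>) F) = (\<Sum>b\<in>diagram \<gamma>. Max (F b))" .
  have l: "sum_mset (leading_monomial \<gamma>) = (\<Sum>b\<in>diagram \<gamma>. fst b)"
    using sum_diagram[of "\<lambda>i. i" \<gamma>] by (simp add: sum_mset_leading_monomial)
  have le: "(\<Sum>b\<in>diagram \<gamma>. Max (F b)) \<le> (\<Sum>b\<in>diagram \<gamma>. fst b)"
    using SetSkyFill_entry_set(2)[OF F] by (rule sum_mono)
  show ?thesis
  proof (cases "(\<Sum>b\<in>diagram \<gamma>. Max (F b)) = (\<Sum>b\<in>diagram \<gamma>. fst b)")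
    case True
    have "F b = {fst b}" if b: "b \<in> diagram \<gamma>" for b
    proof -
      have "Max (F b) = fst b"
        using sum_mono_inv[OF True SetSkyFill_entry_set(2)[OF F] b finite_diagram] .
      then show ?thesis using single[OF b] by simp
    qed
    then show ?thesis by blast
  next
    case False
    then show ?thesis using le w l by simp
  qed
qed

lemma lascoux_atom_eq_SetSkyFill:
  "lascoux_atom \<gamma> m =
    monom (int (card {F \<in> SetSkyFill \<gamma>. weight (diagram \<gamma>) F = m})) (size m - sum_list \<gamma>)"
  by (simp add: lascoux_atom_def gen_series_eq)

lemma weight_leading:
  assumes "\<forall>b\<in>diagram \<gamma>. F b = {fst b}"
  shows "weight (diagram \<gamma>) F = leading_monomial \<gamma>"
  unfolding weight_def leading_monomial_def using assms by (intro sum.cong) auto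

lemma lascoux_atom_nonzero:
  assumes "lascoux_atom \<gamma> m \<noteq> 0"
  shows "sum_list \<gamma> \<le> size m" "0 < row_length \<gamma> i \<Longrightarrow> i \<in># m"
    "size m = sum_list \<gamma> \<Longrightarrow> m = leading_monomial \<gamma> \<or> sum_mset m < sum_mset (leading_monomial \<gamma>)"
proof -
  have "{F \<in> SetSkyFill \<gamma>. weight (diagram \<gamma>) F = m} \<noteq> {}"
    using assms unfolding lascoux_atom_eq_SetSkyFill by (metis card.empty monom_eq_0 of_nat_0)
  then obtain F where F: "F \<in> SetSkyFill \<gamma>" "weight (diagram \<gamma>) F = m" by blast
  show "sum_list \<gamma> \<le> size m" "0 < row_length \<gamma> i \<Longrightarrow> i \<in># m"
    using SetSkyFill_size[OF F(1)] SetSkyFill_support[OF F(1)] F(2) by auto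
  show "m = leading_monomial \<gamma> \<or> sum_mset m < sum_mset (leading_monomial \<gamma>)" if "size m = sum_list \<gamma>"
    using SetSkyFill_minimal_size[OF F(1)] weight_leading[of \<gamma> F] F(2) that by auto
qed

text \<open>Exactly one filling has this weight: the degree forces single entries, and the sum of
  the entries forces each to be its row number.\<close>

lemma lascoux_atom_leading: "lascoux_atom \<gamma> (leading_monomial \<gamma>) = 1"
proof -
  define F0 where "F0 = (\<lambda>(i, k). if 1 \<le> i \<and> i \<le> length \<gamma> \<and> k \<le> row_length \<gamma> i then {i} else {} :: nat set)"
  have inside: "F0 (i, Suc j) = (if j < row_length \<gamma> i then {i} else {})" for i j
    using row_length_pos[of \<gamma> i] by (auto simp: F0_def)
  have pos: "0 < i" if "j < row_length \<gamma> i" for i j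
    using row_length_pos[of \<gamma> i] that by simp
  have arr: "arrangement (row_length \<gamma>) (\<lambda>i j. Max (F0 (i, Suc j)))"
    unfolding arrangement_def inside using finite_row_length[of 0 \<gamma>] pos
    by (auto intro!: inj_onI)
  have F0: "F0 \<in> SetSkyFill \<gamma>"
  proof (rule SetSkyFillI)
    show "pick_filling Min (row_length \<gamma>) (\<lambda>i j. F0 (i, Suc j))"
      unfolding pick_filling_def
    proof (intro conjI allI ballI impI)
      fix i j
      show "if j < row_length \<gamma> i then is_entry_set (F0 (i, Suc j)) else F0 (i, Suc j) = {}"
        using pos[of j i] by (auto simp: inside is_entry_set_def)
      fix x assume "x \<in> F0 (i, Suc j)" "x \<noteq> Max (F0 (i, Suc j))"
      then have False by (simp add: inside split: if_splits)
      then show "x \<notin> column (row_length \<gamma>) (\<lambda>i j. Max (F0 (i, Suc j))) j"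
        "i \<in> allowed_rows (row_length \<gamma>) (\<lambda>i j. Max (F0 (i, Suc j))) j x"
        "i = Min (allowed_rows (row_length \<gamma>) (\<lambda>i j. Max (F0 (i, Suc j))) j x)" by blast+
    qed (rule arr)
    show "greedy (row_length \<gamma>) (\<lambda>i j. Max (F0 (i, Suc j)))"
      unfolding greedy_def inside by auto
    show "F0 (i, 0) = (if 1 \<le> i \<and> i \<le> length \<gamma> then {i} else {})" for i by (simp add: F0_def)
  qed
  have lead: "\<forall>b\<in>diagram \<gamma>. F0 b = {fst b}"
    unfolding diagram_eq by (auto simp: inside)
  have "{F \<in> SetSkyFill \<gamma>. weight (diagram \<gamma>) F = leading_monomial \<gamma>} = {F0}"
  proof (intro equalityI subsetI)
    fix F assume "F \<in> {F \<in> SetSkyFill \<gamma>. weight (diagram \<gamma>) F = leading_monomial \<gamma>}"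
    then have F: "F \<in> SetSkyFill \<gamma>" "weight (diagram \<gamma>) F = leading_monomial \<gamma>" by auto
    have b: "\<forall>b\<in>diagram \<gamma>. F b = {fst b}"
      using SetSkyFill_minimal_size[OF F(1)] F(2) by (simp add: size_leading_monomial)
    have "F (i, k) = F0 (i, k)" for i k
    proof (cases k)
      case 0
      then show ?thesis using SetSkyFill_basement[OF F(1)] SetSkyFill_basement[OF F0] by simp
    next
      case (Suc j)
      have "F (i, Suc j) = {}" if "\<not> j < row_length \<gamma> i"
        using F(1) that by (auto simp: SetSkyFill_def sky_filling_iff)
      then show ?thesis using b Suc inside by auto
    qed
    then show "F \<in> {F0}" by auto
  qed (use F0 weight_leading[OF lead] in auto)
  then show ?thesis
    unfolding lascoux_atom_eq_SetSkyFill by (simp add: size_leading_monomial)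
qed

text \<open>
  \<open>coweight \<gamma>\<close> is \<open>\<Sum>i. (\<ell> - i) \<gamma>\<^sub>i\<close> with \<open>\<ell>\<close> the length of \<open>\<gamma>\<close>. Among the atoms of a fixed degree
  the expansion into monomials is triangular with respect to it.
\<close>

fun coweight :: "nat list \<Rightarrow> nat" where
  "coweight [] = 0"
| "coweight (x # \<gamma>) = x * length \<gamma> + coweight \<gamma>"

lemma coweight_eq: "coweight \<gamma> + sum_mset (leading_monomial \<gamma>) = length \<gamma> * sum_list \<gamma>"
  unfolding sum_mset_leading_monomial
proof (induction \<gamma>)
  case (Cons x \<gamma>)
  have "(\<Sum>k<length (x # \<gamma>). Suc k * (x # \<gamma>) ! k) = x + (\<Sum>k<length \<gamma>. Suc k * \<gamma> ! k + \<gamma> ! k)"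
    by (simp add: sum.lessThan_Suc_shift del: sum.lessThan_Suc) (intro sum.cong, simp_all)
  also have "\<dots> = x + (\<Sum>k<length \<gamma>. Suc k * \<gamma> ! k) + sum_list \<gamma>"
    by (simp add: sum.distrib sum_list_sum_nth atLeast0LessThan)
  finally show ?case using Cons by (simp add: algebra_simps)
qed simp

text \<open>In equal degree the sum of indices of \<delta> is larger, the wrong direction for a
  descending induction. Subtracting it from length times degree turns it into the decreasing
  \<open>coweight\<close>; this works because the last row of \<delta> has its number as an anchor,
  which must occur in the monomial, so \<delta> is not longer than \<gamma>.\<close>

lemma lascoux_atom_triangular:
  assumes \<gamma>: "\<gamma> \<in> weak_compositions" and \<delta>: "\<delta> \<in> weak_compositions"
    and nz: "lascoux_atom \<delta> (leading_monomial \<gamma>) \<noteq> 0" and "\<delta> \<noteq> \<gamma>"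
  shows "(\<delta>, \<gamma>) \<in> measures [sum_list, coweight]"
proof (cases "sum_list \<delta> = sum_list \<gamma>")
  case False
  then show ?thesis using lascoux_atom_nonzero(1)[OF nz] by (simp add: size_leading_monomial)
next
  case True
  have "sum_mset (leading_monomial \<gamma>) < sum_mset (leading_monomial \<delta>)"
    using lascoux_atom_nonzero(3)[OF nz] leading_monomial_inj[OF \<gamma> \<delta>] True \<open>\<delta> \<noteq> \<gamma>\<close>
    by (auto simp: size_leading_monomial)
  moreover have "length \<delta> \<le> length \<gamma>"
  proof (cases "\<delta> = []")
    case False
    then have "0 < row_length \<delta> (length \<delta>)"
      using \<delta> by (cases "length \<delta>") (auto simp: row_length_def part_def weak_compositions_def last_conv_nth)
    then have "length \<delta> \<in># leading_monomial \<gamma>" by (rule lascoux_atom_nonzero(2)[OF nz])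
    then have "0 < row_length \<gamma> (length \<delta>)" by (simp flip: count_leading_monomial)
    then show ?thesis using row_length_pos by blast
  qed simp
  then have "length \<delta> * sum_list \<delta> \<le> length \<gamma> * sum_list \<gamma>" using True by simp
  ultimately have "coweight \<delta> < coweight \<gamma>"
    using coweight_eq[of \<gamma>] coweight_eq[of \<delta>] by linarith
  then show ?thesis using True by simp
qed

text \<open>Parts are bounded by the degree of \<open>m\<close>, and the number of the last row
  occurs in \<open>m\<close>. Thus every monomial meets finitely many atoms, and combinations with
  arbitrary coefficients are true sums.\<close>

lemma finite_lascoux_support: "finite {\<gamma> \<in> weak_compositions. lascoux_atom \<gamma> m \<noteq> 0}"
proof (rule finite_subset)
  show "finite {\<gamma>. set \<gamma> \<subseteq> {..size m} \<and> length \<gamma> \<le> Max (insert 0 (set_mset m))}"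
    by (rule finite_lists_length_le) simp
  show "{\<gamma> \<in> weak_compositions. lascoux_atom \<gamma> m \<noteq> 0} \<subseteq>
      {\<gamma>. set \<gamma> \<subseteq> {..size m} \<and> length \<gamma> \<le> Max (insert 0 (set_mset m))}"
  proof
    fix \<gamma> assume "\<gamma> \<in> {\<gamma> \<in> weak_compositions. lascoux_atom \<gamma> m \<noteq> 0}"
    then have \<gamma>: "\<gamma> \<in> weak_compositions" and nz: "lascoux_atom \<gamma> m \<noteq> 0" by auto
    have "a \<le> size m" if "a \<in> set \<gamma>" for a
      using member_le_sum_list[OF that] lascoux_atom_nonzero(1)[OF nz] by simp
    moreover have "length \<gamma> \<le> Max (insert 0 (set_mset m))"
    proof (cases "\<gamma> = []")
      case False
      then have "0 < row_length \<gamma> (length \<gamma>)"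
        using \<gamma> by (cases "length \<gamma>") (auto simp: row_length_def part_def weak_compositions_def last_conv_nth)
      then have "length \<gamma> \<in># m" by (rule lascoux_atom_nonzero(2)[OF nz])
      then show ?thesis by (intro Max_ge) auto
    qed simp
    ultimately show "\<gamma> \<in> {\<gamma>. set \<gamma> \<subseteq> {..size m} \<and> length \<gamma> \<le> Max (insert 0 (set_mset m))}" by auto
  qed
qed

section \<open>Comparison of coefficients in expansions into atoms\<close>

lemma lin_comb_lascoux:
  "lin_comb weak_compositions c lascoux_atom m =
    (\<Sum>\<gamma> | \<gamma> \<in> weak_compositions \<and> lascoux_atom \<gamma> m \<noteq> 0. c \<gamma> * lascoux_atom \<gamma> m)"
  unfolding lin_comb_def by (rule sum.mono_neutral_left[OF finite_lascoux_support]) auto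

lemma lin_comb_lascoux_leading:
  assumes \<gamma>: "\<gamma> \<in> weak_compositions"
    and below: "\<And>\<delta>. \<delta> \<in> weak_compositions \<Longrightarrow> (\<delta>, \<gamma>) \<in> measures [sum_list, coweight] \<Longrightarrow> a \<delta> = 0"
  shows "lin_comb weak_compositions a lascoux_atom (leading_monomial \<gamma>) = a \<gamma>"
proof -
  have "lin_comb weak_compositions a lascoux_atom (leading_monomial \<gamma>) =
      (\<Sum>\<delta>\<in>{\<gamma>}. a \<delta> * lascoux_atom \<delta> (leading_monomial \<gamma>))"
    unfolding lin_comb_lascoux
    by (rule sum.mono_neutral_right[OF finite_lascoux_support])
      (use \<gamma> below lascoux_atom_triangular[OF \<gamma>] in \<open>auto simp: lascoux_atom_leading\<close>)
  then show ?thesis by (simp add: lascoux_atom_leading)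
qed

text \<open>Induction along the triangular order: \<open>a\<close> at \<gamma> is read off at the
  leading monomial of \<gamma>, invariance moves this to the leading monomial of the representative,
  and there it is \<open>a (r \<gamma>) = 0\<close>. As the representative has no larger
  \<open>coweight\<close>, whatever precedes it also precedes \<gamma>, so the induction hypothesis
  covers it.\<close>

lemma coefficients_vanish:
  assumes r: "\<And>\<gamma>. \<gamma> \<in> weak_compositions \<Longrightarrow> r \<gamma> \<in> weak_compositions \<and> sum_list (r \<gamma>) = sum_list \<gamma> \<and>
      coweight (r \<gamma>) \<le> coweight \<gamma> \<and> a (r \<gamma>) = 0"
    and g: "\<And>\<gamma>. \<gamma> \<in> weak_compositions \<Longrightarrow> lin_comb weak_compositions a lascoux_atom (leading_monomial \<gamma>) =
      lin_comb weak_compositions a lascoux_atom (leading_monomial (r \<gamma>))"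
  shows "\<gamma> \<in> weak_compositions \<Longrightarrow> a \<gamma> = 0"
proof (induction \<gamma> rule: wf_induct_rule[OF wf_measures[of "[sum_list, coweight]"]])
  case (1 \<gamma>)
  have "a \<gamma> = lin_comb weak_compositions a lascoux_atom (leading_monomial \<gamma>)"
    using 1 by (intro lin_comb_lascoux_leading[symmetric]) auto
  also have "\<dots> = lin_comb weak_compositions a lascoux_atom (leading_monomial (r \<gamma>))"
    by (rule g[OF 1(2)])
  also have "\<dots> = a (r \<gamma>)"
  proof (rule lin_comb_lascoux_leading)
    show "r \<gamma> \<in> weak_compositions" using r[OF 1(2)] by simp
    fix \<delta> assume "\<delta> \<in> weak_compositions" "(\<delta>, r \<gamma>) \<in> measures [sum_list, coweight]"
    moreover from this have "(\<delta>, \<gamma>) \<in> measures [sum_list, coweight]"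
      using r[OF 1(2)] by auto
    ultimately show "a \<delta> = 0" by (intro 1(1))
  qed
  also have "\<dots> = 0" using r[OF 1(2)] by simp
  finally show ?case .
qed

text \<open>Fibres of \<open>g\<close> may be infinite, but for a fixed monomial only the finite set
  \<open>?S\<close> of shapes matters, and finite sums can be exchanged.\<close>

lemma lin_comb_regroup:
  assumes g: "\<And>\<gamma>. \<gamma> \<in> weak_compositions \<Longrightarrow> g \<gamma> \<in> Y"
    and B: "\<And>y. y \<in> Y \<Longrightarrow> B y = lin_comb {\<gamma> \<in> weak_compositions. g \<gamma> = y} (\<lambda>_. 1) lascoux_atom"
  shows "lin_comb Y d B = lin_comb weak_compositions (\<lambda>\<gamma>. d (g \<gamma>)) lascoux_atom"
proof
  fix m
  let ?S = "{\<gamma> \<in> weak_compositions. lascoux_atom \<gamma> m \<noteq> 0}"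
  have By: "B y m = (\<Sum>\<gamma> | \<gamma> \<in> ?S \<and> g \<gamma> = y. lascoux_atom \<gamma> m)" if "y \<in> Y" for y
    unfolding B[OF that] lin_comb_def by (intro sum.cong) auto
  have B0: "B y m = 0" if "y \<in> Y" "y \<notin> g ` ?S" for y
    unfolding By[OF that(1)] using that(2) by (intro sum.neutral) blast
  have "lin_comb Y d B m = (\<Sum>y\<in>g ` ?S. d y * B y m)"
    unfolding lin_comb_def
  proof (rule sum.mono_neutral_left)
    show "finite (g ` ?S)" using finite_lascoux_support by (rule finite_imageI)
    show "{y. y \<in> Y \<and> d y * B y m \<noteq> 0} \<subseteq> g ` ?S" using B0 by fastforce
    show "\<forall>y\<in>g ` ?S - {y. y \<in> Y \<and> d y * B y m \<noteq> 0}. d y * B y m = 0" using g by blast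
  qed
  also have "\<dots> = (\<Sum>y\<in>g ` ?S. \<Sum>\<gamma> | \<gamma> \<in> ?S \<and> g \<gamma> = y. d (g \<gamma>) * lascoux_atom \<gamma> m)"
    using g by (intro sum.cong refl) (auto simp: By sum_distrib_left intro!: sum.cong)
  also have "\<dots> = (\<Sum>\<gamma>\<in>?S. d (g \<gamma>) * lascoux_atom \<gamma> m)"
    by (rule sum.group[OF finite_lascoux_support finite_imageI[OF finite_lascoux_support] subset_refl])
  finally show "lin_comb Y d B m = lin_comb weak_compositions (\<lambda>\<gamma>. d (g \<gamma>)) lascoux_atom m"
    unfolding lin_comb_lascoux .
qed

lemma lin_comb_cong: "(\<And>i. i \<in> I \<Longrightarrow> c i = d i) \<Longrightarrow> lin_comb I c B = lin_comb I d B"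
  unfolding lin_comb_def by (intro ext sum.cong) auto

lemma lin_comb_eq_coeff: "(\<And>i. i \<in> I \<Longrightarrow> B i m = B i m') \<Longrightarrow> lin_comb I c B m = lin_comb I c B m'"
  unfolding lin_comb_def by (intro sum.cong) auto

lemma lin_comb_diff:
  "lin_comb weak_compositions (\<lambda>\<gamma>. c \<gamma> - d \<gamma>) lascoux_atom m =
    lin_comb weak_compositions c lascoux_atom m - lin_comb weak_compositions d lascoux_atom m"
  unfolding lin_comb_lascoux by (simp add: left_diff_distrib sum_subtractf)

text \<open>
  Both parts of the proposition are instances of the following, where \<open>f\<close> is invariant if it takes
  equal values on the pairs in \<open>R\<close>, and \<open>r\<close> chooses in each fibre of \<open>g\<close> the weak composition of
  least \<open>coweight\<close>.
\<close>

lemma invariant_lin_comb: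
  fixes g :: "nat list \<Rightarrow> nat list" and R :: "(nat multiset \<times> nat multiset) set"
  defines "invar \<equiv> \<lambda>f :: series. \<forall>(m, m')\<in>R. f m = f m'"
  assumes g: "\<And>\<gamma>. \<gamma> \<in> weak_compositions \<Longrightarrow> g \<gamma> \<in> Y"
    and r: "\<And>y. y \<in> Y \<Longrightarrow> r y \<in> weak_compositions \<and> g (r y) = y"
    and deg: "\<And>\<gamma>. sum_list (r (g \<gamma>)) = sum_list \<gamma> \<and> coweight (r (g \<gamma>)) \<le> coweight \<gamma>"
    and B: "\<And>y. y \<in> Y \<Longrightarrow> B y = lin_comb {\<gamma> \<in> weak_compositions. g \<gamma> = y} (\<lambda>_. 1) lascoux_atom"
    and BR: "\<And>y m m'. y \<in> Y \<Longrightarrow> (m, m') \<in> R \<Longrightarrow> B y m = B y m'"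
    and lead: "\<And>f \<gamma>. invar f \<Longrightarrow> f (leading_monomial \<gamma>) = f (leading_monomial (r (g \<gamma>)))"
    and f: "f = lin_comb weak_compositions c lascoux_atom"
  shows "invar f \<longleftrightarrow> (\<forall>\<gamma>\<in>weak_compositions. \<forall>\<delta>\<in>weak_compositions. g \<gamma> = g \<delta> \<longrightarrow> c \<gamma> = c \<delta>)"
    and "invar f \<Longrightarrow> positive_in Y B f \<longleftrightarrow> positive_in weak_compositions lascoux_atom f"
proof -
  have regroup: "lin_comb Y d B = lin_comb weak_compositions (\<lambda>\<gamma>. d (g \<gamma>)) lascoux_atom" for d
    using g B by (rule lin_comb_regroup)
  have fibre_inv: "invar (lin_comb weak_compositions (\<lambda>\<gamma>. d (g \<gamma>)) lascoux_atom)" for d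
  proof -
    have "lin_comb Y d B m = lin_comb Y d B m'" if "(m, m') \<in> R" for m m'
      using BR that by (intro lin_comb_eq_coeff)
    then show ?thesis unfolding regroup[symmetric] invar_def by blast
  qed
  \<comment> \<open>Stated for every coefficient family of \<open>f\<close>, since the one
    witnessing positivity is not known in advance to be the given one.\<close>
  have const: "c \<gamma> = c (r (g \<gamma>))"
    if inv: "invar f" and f: "f = lin_comb weak_compositions c lascoux_atom" and \<gamma>: "\<gamma> \<in> weak_compositions"
    for c \<gamma>
  proof -
    \<comment> \<open>Subtracting the invariant combination whose coefficients are constant on
      fibres leaves an invariant series with coefficient 0 at every representative.\<close>
    let ?a = "\<lambda>\<gamma>. c \<gamma> - c (r (g \<gamma>))"
    have "invar (lin_comb weak_compositions ?a lascoux_atom)"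
      using inv fibre_inv[of "\<lambda>y. c (r y)"] unfolding invar_def f by (fastforce simp: lin_comb_diff)
    then have "?a \<gamma> = 0"
      by (intro coefficients_vanish[where a = ?a and r = "\<lambda>\<gamma>. r (g \<gamma>)", OF _ lead \<gamma>])
        (use g r deg in auto)
    then show ?thesis by simp
  qed
  show "invar f \<longleftrightarrow> (\<forall>\<gamma>\<in>weak_compositions. \<forall>\<delta>\<in>weak_compositions. g \<gamma> = g \<delta> \<longrightarrow> c \<gamma> = c \<delta>)"
  proof
    assume "invar f"
    then show "\<forall>\<gamma>\<in>weak_compositions. \<forall>\<delta>\<in>weak_compositions. g \<gamma> = g \<delta> \<longrightarrow> c \<gamma> = c \<delta>"
      using const[OF _ f] by metis
  next
    assume "\<forall>\<gamma>\<in>weak_compositions. \<forall>\<delta>\<in>weak_compositions. g \<gamma> = g \<delta> \<longrightarrow> c \<gamma> = c \<delta>"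
    then have "c \<gamma> = c (r (g \<gamma>))" if "\<gamma> \<in> weak_compositions" for \<gamma>
      using that r g by metis
    then have "f = lin_comb weak_compositions (\<lambda>\<gamma>. c (r (g \<gamma>))) lascoux_atom"
      unfolding f by (rule lin_comb_cong)
    then show "invar f" using fibre_inv[of "\<lambda>y. c (r y)"] by simp
  qed
  show "positive_in Y B f \<longleftrightarrow> positive_in weak_compositions lascoux_atom f" if inv: "invar f"
  proof
    assume "positive_in Y B f"
    then obtain d where d: "f = lin_comb Y d B" "\<forall>y\<in>Y. nonneg_coeffs (d y)"
      by (auto simp: positive_in_def)
    show "positive_in weak_compositions lascoux_atom f"
      unfolding positive_in_def
      by (rule exI[of _ "\<lambda>\<gamma>. d (g \<gamma>)"]) (use d g regroup in auto)
  next
    assume "positive_in weak_compositions lascoux_atom f"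
    then obtain d where d: "f = lin_comb weak_compositions d lascoux_atom"
      "\<forall>\<gamma>\<in>weak_compositions. nonneg_coeffs (d \<gamma>)"
      by (auto simp: positive_in_def)
    have "f = lin_comb weak_compositions (\<lambda>\<gamma>. d (r (g \<gamma>))) lascoux_atom"
      unfolding d(1) by (rule lin_comb_cong) (rule const[OF inv d(1)])
    then have "f = lin_comb Y (\<lambda>y. d (r y)) B" using regroup[of "\<lambda>y. d (r y)"] by simp
    then show "positive_in Y B f"
      unfolding positive_in_def using d(2) r by blast
  qed
qed

section \<open>Leading monomials and rearrangements of the parts\<close>

lemma count_monomial:
  assumes "distinct idx"
  shows "count (monomial idx (map p idx)) x = (if x \<in> set idx then p x else 0)"
proof -
  have "count (monomial idx (map p idx)) x = (\<Sum>j<length idx. if idx ! j = x then p (idx ! j) else 0)"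
    unfolding monomial_def by (auto simp: count_sum intro!: sum.cong)
  also have "\<dots> = (\<Sum>i\<in>set idx. if i = x then p i else 0)"
    using sum.reindex_bij_betw[OF bij_betw_nth[OF assms refl refl], of "\<lambda>i. if i = x then p i else 0"]
    by simp
  finally show ?thesis by simp
qed

lemma leading_monomial_eq:
  assumes "distinct idx" "\<And>i. 0 < row_length \<gamma> i \<Longrightarrow> i \<in> set idx"
  shows "monomial idx (map (row_length \<gamma>) idx) = leading_monomial \<gamma>"
  using assms(2) by (auto simp: multiset_eq_iff count_monomial[OF assms(1)] count_leading_monomial)

lemma leading_monomial_upt: "monomial [1..<length \<gamma> + 1] \<gamma> = leading_monomial \<gamma>"
proof -
  have "monomial [1..<length \<gamma> + 1] (map (row_length \<gamma>) [1..<length \<gamma> + 1]) = leading_monomial \<gamma>"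
    by (rule leading_monomial_eq) (auto dest: row_length_pos simp del: upt_Suc)
  then show ?thesis unfolding map_row_length .
qed

lemma image_mset_monomial:
  assumes "\<And>j. j < length \<alpha> \<Longrightarrow> \<phi> (idx ! j) = idx' ! j"
  shows "image_mset \<phi> (monomial idx \<alpha>) = monomial idx' \<alpha>"
proof -
  have "image_mset \<phi> (\<Sum>j<n. replicate_mset (\<alpha> ! j) (idx ! j)) = (\<Sum>j<n. replicate_mset (\<alpha> ! j) (idx' ! j))"
    if "n \<le> length \<alpha>" for n
    using that assms by (induction n) auto
  then show ?thesis by (simp add: monomial_def)
qed

lemma coweight_filter: "coweight (filter P \<gamma>) \<le> coweight \<gamma>"
  by (induction \<gamma>) (auto intro!: add_mono mult_le_mono)

lemma coweight_insort: "coweight (insort x \<gamma>) \<le> x * length \<gamma> + coweight \<gamma>"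
proof (induction \<gamma>)
  case (Cons y \<gamma>)
  show ?case
  proof (cases "x \<le> y")
    case False
    then have "coweight (insort x (y # \<gamma>)) \<le> y * Suc (length \<gamma>) + (x * length \<gamma> + coweight \<gamma>)"
      using Cons by simp
    also have "\<dots> \<le> x * length (y # \<gamma>) + coweight (y # \<gamma>)" using False by simp
    finally show ?thesis .
  qed simp
qed simp

text \<open>Earlier positions weigh more, so moving larger parts to the right can only lower
  \<open>coweight\<close>.\<close>

lemma coweight_sort: "coweight (sort \<gamma>) \<le> coweight \<gamma>"
proof (induction \<gamma>)
  case (Cons x \<gamma>)
  have "coweight (sort (x # \<gamma>)) \<le> x * length (sort \<gamma>) + coweight (sort \<gamma>)"
    using coweight_insort[of x "sort \<gamma>"] by simp
  then show ?case using Cons by simp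
qed simp

lemma mset_flatten_append_zeros:
  "mset (flatten \<gamma> @ replicate (length \<gamma> - length (flatten \<gamma>)) 0) = mset \<gamma>"
proof (induction \<gamma>)
  case (Cons a \<gamma>)
  have "length (flatten \<gamma>) \<le> length \<gamma>" by (simp add: flatten_def)
  then show ?case using Cons by (cases "a = 0") (simp_all add: flatten_def Suc_diff_le)
qed (simp add: flatten_def)

text \<open>Padded with zeros at the end, the increasing rearrangement has the same multiset of row
  lengths as \<gamma>, so some permutation of the rows matches the two.\<close>

lemma leading_monomial_sort:
  "\<exists>\<pi>. \<pi> permutes {1..length \<gamma>} \<and>
    image_mset \<pi> (leading_monomial \<gamma>) = leading_monomial (rev (sort_parts \<gamma>))"
proof -
  let ?\<delta> = "rev (sort_parts \<gamma>)" and ?n = "length \<gamma>"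
  have \<delta>: "mset ?\<delta> = mset (flatten \<gamma>)" by (simp add: sort_parts_def)
  then have len: "length ?\<delta> = length (flatten \<gamma>)" "length ?\<delta> \<le> ?n"
    by (auto simp: flatten_def sort_parts_def)
  have "map (row_length ?\<delta>) [1..<?n + 1] = ?\<delta> @ replicate (?n - length ?\<delta>) 0"
    using len(2) by (intro nth_equalityI) (auto simp: row_length_def part_def nth_append simp del: upt_Suc)
  then have "mset (map (row_length ?\<delta>) [1..<?n + 1]) = mset \<gamma>"
    using mset_flatten_append_zeros[of \<gamma>] \<delta> len(1) by simp
  then have "mset (map (row_length \<gamma>) [1..<?n + 1]) = mset (map (row_length ?\<delta>) [1..<?n + 1])"
    unfolding map_row_length by simp
  then have "image_mset (row_length \<gamma>) (mset_set {1..?n}) = image_mset (row_length ?\<delta>) (mset_set {1..?n})"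
    by (simp add: atLeastLessThanSuc_atLeastAtMost del: upt_Suc)
  from image_mset_eq_implies_permutes[OF _ this]
  obtain \<pi> where \<pi>: "\<pi> permutes {1..?n}" "\<forall>i\<in>{1..?n}. row_length \<gamma> i = row_length ?\<delta> (\<pi> i)"
    by auto
  have "count (image_mset \<pi> (leading_monomial \<gamma>)) (\<pi> i) = count (leading_monomial ?\<delta>) (\<pi> i)" for i
  proof -
    have "count (image_mset \<pi> (leading_monomial \<gamma>)) (\<pi> i) = row_length \<gamma> i"
      using count_image_mset_injective[OF permutes_inj[OF \<pi>(1)]] by (simp add: count_leading_monomial)
    also have "\<dots> = row_length ?\<delta> (\<pi> i)"
    proof (cases "i \<in> {1..?n}")
      case False
      then have "\<pi> i = i" using permutes_not_in[OF \<pi>(1)] by simp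
      moreover have "row_length \<gamma> i = 0" "row_length ?\<delta> i = 0"
        using False row_length_pos[of \<gamma> i] row_length_pos[of ?\<delta> i] len(2) by fastforce+
      ultimately show ?thesis by simp
    qed (use \<pi>(2) in blast)
    finally show ?thesis by (simp add: count_leading_monomial)
  qed
  then have "image_mset \<pi> (leading_monomial \<gamma>) = leading_monomial ?\<delta>"
    using permutes_surj[OF \<pi>(1)] by (metis multiset_eqI surjD)
  then show ?thesis using \<pi>(1) by blast
qed

lemma quasisymmetric_iff:
  "quasisymmetric f \<longleftrightarrow> (\<forall>(m, m')\<in>{(monomial idx \<alpha>, monomial [1..<length \<alpha> + 1] \<alpha>) | idx \<alpha>.
    (\<forall>a\<in>set \<alpha>. 0 < a) \<and> length idx = length \<alpha> \<and> (\<forall>i\<in>set idx. 0 < i) \<and> sorted_wrt (<) idx}. f m = f m')"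
  unfolding quasisymmetric_def by blast

lemma symmetric_iff:
  "symmetric f \<longleftrightarrow> (\<forall>(m, m')\<in>{(image_mset \<pi> m, m) | \<pi> S m.
    finite S \<and> S \<subseteq> {1..} \<and> \<pi> permutes S}. f m = f m')"
  unfolding symmetric_def by blast

lemma quasi_grothendieck_monomial:
  assumes "length idx = length \<beta>" "\<forall>i\<in>set idx. 0 < i" "sorted_wrt (<) idx"
  shows "quasi_grothendieck \<alpha> (monomial idx \<beta>) = quasi_grothendieck \<alpha> (monomial [1..<length \<beta> + 1] \<beta>)"
proof -
  \<comment> \<open>The index list becomes an increasing relabelling of the letters 1, 2, ...; list
    positions start at 0, hence the shift.\<close>
  let ?m = "monomial [1..<length \<beta> + 1] \<beta>" and ?\<phi> = "\<lambda>i. idx ! (i - 1)"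
  have sub: "i \<in> {1..length \<beta>}" if "i \<in># ?m" for i
    using that row_length_pos[of \<beta> i]
    unfolding leading_monomial_upt count_greater_zero_iff[symmetric] count_leading_monomial by simp
  have "image_mset ?\<phi> ?m = monomial idx \<beta>"
    by (rule image_mset_monomial) (simp del: upt_Suc)
  moreover have "quasi_grothendieck \<alpha> (image_mset ?\<phi> ?m) = quasi_grothendieck \<alpha> ?m"
  proof (rule quasi_grothendieck_relabel)
    show "strict_mono_on (set_mset ?m) ?\<phi>"
    proof (rule strict_mono_onI)
      fix i j assume "i \<in># ?m" "j \<in># ?m" "i < j"
      then show "?\<phi> i < ?\<phi> j"
        using sub[of i] sub[of j] assms(1) by (intro sorted_wrt_nth_less[OF assms(3)]) auto
    qed
    show "?\<phi> ` set_mset ?m \<subseteq> {1..}"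
    proof
      fix k assume "k \<in> ?\<phi> ` set_mset ?m"
      then obtain i where i: "k = ?\<phi> i" "i \<in> {1..length \<beta>}" using sub by blast
      have "i - 1 < length idx" using i(2) assms(1) by auto
      then have "k \<in> set idx" unfolding i(1) by (rule nth_mem)
      then have "0 < k" using assms(2) by blast
      then show "k \<in> {1..}" by simp
    qed
    show "set_mset ?m \<subseteq> {1..}"
    proof
      fix i assume "i \<in># ?m"
      then have "i \<in> {1..length \<beta>}" by (rule sub)
      then show "i \<in> {1..}" by simp
    qed
  qed
  ultimately show ?thesis by simp
qed

theorem proposition1p6:
  fixes f :: series and c :: "nat list \<Rightarrow> int poly"
  assumes "f = lin_comb weak_compositions c lascoux_atom"
  shows "(quasisymmetric f \<longleftrightarrow>
      (\<forall>\<gamma>\<in>weak_compositions. \<forall>\<delta>\<in>weak_compositions. flatten \<gamma> = flatten \<delta> \<longrightarrow> c \<gamma> = c \<delta>)) \<and>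
    (symmetric f \<longleftrightarrow>
      (\<forall>\<gamma>\<in>weak_compositions. \<forall>\<delta>\<in>weak_compositions. sort_parts \<gamma> = sort_parts \<delta> \<longrightarrow> c \<gamma> = c \<delta>)) \<and>
    (quasisymmetric f \<longrightarrow>
      (positive_in compositions quasi_grothendieck f \<longleftrightarrow>
        positive_in weak_compositions lascoux_atom f)) \<and>
    (symmetric f \<longrightarrow>
      (positive_in partitions grothendieck f \<longleftrightarrow>
        positive_in weak_compositions lascoux_atom f))"
proof -
  let ?Q = "{(monomial idx \<alpha>, monomial [1..<length \<alpha> + 1] \<alpha>) | idx \<alpha>.
    (\<forall>a\<in>set \<alpha>. 0 < a) \<and> length idx = length \<alpha> \<and> (\<forall>i\<in>set idx. 0 < i) \<and> sorted_wrt (<) idx}"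
  let ?P = "{(image_mset \<pi> m, m) | \<pi> S m. finite S \<and> S \<subseteq> {1..} \<and> \<pi> permutes S}"
  have flat: "flatten \<gamma> \<in> compositions" for \<gamma>
    by (simp add: compositions_def flatten_def)
  have id: "\<alpha> \<in> weak_compositions \<and> flatten \<alpha> = \<alpha>" if "\<alpha> \<in> compositions" for \<alpha>
    using that by (simp add: compositions_def flatten_def positive_list_weak_composition)
  have flat_deg: "sum_list (flatten \<gamma>) = sum_list \<gamma> \<and> coweight (flatten \<gamma>) \<le> coweight \<gamma>" for \<gamma>
    using sum_list_flatten[of \<gamma>] coweight_filter[of _ \<gamma>] by (simp add: flatten_def)
  have flat_inv: "quasi_grothendieck y m = quasi_grothendieck y m'" if "(m, m') \<in> ?Q" for y m m'
    using that quasi_grothendieck_monomial by auto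
  have flat_lead: "h (leading_monomial \<gamma>) = h (leading_monomial (flatten \<gamma>))"
    if h: "\<forall>(m, m')\<in>?Q. h m = h m'" for h :: series and \<gamma>
  proof -
    define idx where "idx = sorted_list_of_set {i. 0 < row_length \<gamma> i}"
    have set: "set idx = {i. 0 < row_length \<gamma> i}" using finite_row_length by (simp add: idx_def)
    have flat_idx: "flatten \<gamma> = map (row_length \<gamma>) idx" by (simp add: idx_def flatten_eq)
    have idx: "distinct idx" "sorted_wrt (<) idx" "length idx = length (flatten \<gamma>)"
      unfolding flat_idx by (simp_all add: idx_def)
    have pos: "\<forall>i\<in>set idx. 0 < i" "\<forall>a\<in>set (flatten \<gamma>). 0 < a"
      by (auto simp: set flatten_def dest: row_length_pos)
    have "quasisymmetric h" using h unfolding quasisymmetric_iff .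
    then have "h (monomial idx (flatten \<gamma>)) = h (monomial [1..<length (flatten \<gamma>) + 1] (flatten \<gamma>))"
      using idx pos unfolding quasisymmetric_def by blast
    moreover have "monomial idx (flatten \<gamma>) = leading_monomial \<gamma>"
      unfolding flat_idx by (rule leading_monomial_eq[OF idx(1)]) (simp add: set)
    ultimately show ?thesis unfolding leading_monomial_upt by simp
  qed
  have quasi: "quasisymmetric f \<longleftrightarrow>
      (\<forall>\<gamma>\<in>weak_compositions. \<forall>\<delta>\<in>weak_compositions. flatten \<gamma> = flatten \<delta> \<longrightarrow> c \<gamma> = c \<delta>)"
    "quasisymmetric f \<Longrightarrow> positive_in compositions quasi_grothendieck f \<longleftrightarrow>
      positive_in weak_compositions lascoux_atom f"
    unfolding quasisymmetric_iff
    by (rule invariant_lin_comb[where R = ?Q and g = flatten and r = "\<lambda>\<alpha>. \<alpha>" and Y = compositions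
          and B = quasi_grothendieck and c = c];
        (rule flat | erule id | rule flat_deg | rule quasi_grothendieck_def | erule flat_inv |
          erule flat_lead | rule assms | assumption))+
  \<comment> \<open>The representative of a fibre is the increasing arrangement
    \<open>rev \<mu>\<close> rather than \<mu>, because it has the least
    \<open>coweight\<close>.\<close>
  have part: "rev \<mu> \<in> weak_compositions \<and> sort_parts (rev \<mu>) = \<mu>" if "\<mu> \<in> partitions" for \<mu>
  proof -
    have \<mu>: "sort_parts \<mu> = \<mu>" by (simp add: sort_parts_eq_iff[OF that])
    have "\<forall>a\<in>set (sort_parts \<mu>). 0 < a" by (simp add: sort_parts_def flatten_def)
    then have "\<forall>a\<in>set \<mu>. 0 < a" unfolding \<mu> .
    then have "rev \<mu> \<in> weak_compositions" by (intro positive_list_weak_composition) simp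
    moreover have "sort_parts (rev \<mu>) = sort_parts \<mu>"
      unfolding sort_parts_def by (simp add: flatten_def properties_for_sort flip: rev_filter)
    ultimately show ?thesis using \<mu> by simp
  qed
  have part_deg: "sum_list (rev (sort_parts \<gamma>)) = sum_list \<gamma> \<and> coweight (rev (sort_parts \<gamma>)) \<le> coweight \<gamma>" for \<gamma>
    using sum_list_sort_parts[of \<gamma>] coweight_sort[of "flatten \<gamma>"] flat_deg[of \<gamma>]
    by (simp add: sum_list_rev sort_parts_def)
  have part_inv: "grothendieck \<mu> m = grothendieck \<mu> m'" if "\<mu> \<in> partitions" "(m, m') \<in> ?P" for \<mu> m m'
    using that grothendieck_permute by auto
  have part_lead: "h (leading_monomial \<gamma>) = h (leading_monomial (rev (sort_parts \<gamma>)))"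
    if h: "\<forall>(m, m')\<in>?P. h m = h m'" for h :: series and \<gamma>
  proof -
    obtain \<pi> where \<pi>: "\<pi> permutes {1..length \<gamma>}"
      "image_mset \<pi> (leading_monomial \<gamma>) = leading_monomial (rev (sort_parts \<gamma>))"
      using leading_monomial_sort by blast
    have "symmetric h" using h unfolding symmetric_iff .
    moreover have "finite {1..length \<gamma>} \<and> {1..length \<gamma>} \<subseteq> {1..} \<and> \<pi> permutes {1..length \<gamma>}"
      using \<pi>(1) by auto
    ultimately have "h (image_mset \<pi> (leading_monomial \<gamma>)) = h (leading_monomial \<gamma>)"
      unfolding symmetric_def by blast
    then show ?thesis unfolding \<pi>(2) by simp
  qed
  have symm: "symmetric f \<longleftrightarrow>
      (\<forall>\<gamma>\<in>weak_compositions. \<forall>\<delta>\<in>weak_compositions. sort_parts \<gamma> = sort_parts \<delta> \<longrightarrow> c \<gamma> = c \<delta>)"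
    "symmetric f \<Longrightarrow> positive_in partitions grothendieck f \<longleftrightarrow>
      positive_in weak_compositions lascoux_atom f"
    unfolding symmetric_iff
    by (rule invariant_lin_comb[where R = ?P and g = sort_parts and r = rev and Y = partitions
          and B = grothendieck and c = c];
        (rule sort_parts_partition | erule part | rule part_deg | erule grothendieck_eq_lin_comb |
          erule (1) part_inv | erule part_lead | rule assms | assumption))+
  show ?thesis using quasi symm by blast
qed

end
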